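(* Consider the semiparametric model $\mathcal{P}$ for the law of $Z$ defined by the conditional moment restrictions $E[g_j(Z,\theta)\mid X^{(j)}]=0$ almost surely, $j=1,2$, and suppose that Assumption T and Assumption SP (both stated in the context) hold. Write $g_i=g_i(Z,\theta_0)$, $i=1,2$. Define $a_1^{(0)}=0$ and, for $m=1,2,\dots$, $$\begin{aligned}a_1^{(m)}(X^{(1)})={}&-E\left(\partial_\theta g_1'\mid X^{(1)}\right)V^-\left(g_1\mid X^{(1)}\right)\\&+E\left[E\left(\partial_\theta g_2'\mid X^{(2)}\right)V^-\left(g_2\mid X^{(2)}\right)g_2\,g_1'\mid X^{(1)}\right]V^-\left(g_1\mid X^{(1)}\right)\\&+E\left[E\left[a_1^{(m-1)}(X^{(1)})\,g_1\,g_2'\mid X^{(2)}\right]V^-\left(g_2\mid X^{(2)}\right)g_2\,g_1'\mid X^{(1)}\right]V^-\left(g_1\mid X^{(1)}\right),\end{aligned}$$ $$a_2^{(m)}(X^{(2)})=-E\left(\partial_\theta g_2'\mid X^{(2)}\right)V^-\left(g_2\mid X^{(2)}\right)-E\left[a_1^{(m)}(X^{(1)})\,g_1\,g_2'\mid X^{(2)}\right]V^-\left(g_2\mid X^{(2)}\right).$$ Then, as $m\to\infty$, $$\overline S_{\theta_0}^{(m)}=a_1^{(m)}(X^{(1)})\,g_1+a_2^{(m)}(X^{(2)})\,g_2\ \longrightarrow\ \overline S_{\theta_0}=\Pi\left(S_{\theta_0}\mid\mathcal{T}^\perp\right)=\Pi\left(S_{\theta_0}\mid\overline{H_1+H_2}\right)$$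 in $\bigoplus_{k=1}^dL^2(P_0)$.
   Context: **Model.** $Z\in\mathcal{Z}\subset\mathbb{R}^q$ is a random vector with true law $P_0$; expectations and variances without index are under $P_0$. For $j=1,2$, $X^{(j)}$ is a $q_j$-dimensional subvector of $Z$, $0\le q_j<q$ (if $q_j=0$, $X^{(j)}$ is constant and conditioning on it is taking the marginal expectation), and $g_j:\mathbb{R}^q\times\mathbb{R}^d\to\mathbb{R}^{p_j}$ is a given function of $Z$ and of $\theta\in\Theta\subset\mathbb{R}^d$. $\mathcal{P}$ is the collection of laws of $Z$ (with densities with respect to a fixed dominating measure) for which the conditional restrictions hold for some $\theta\in\Theta$; $P_0\in\mathcal{P}$ and there is a unique $\theta_0\in\Theta$ for which $P_0$ satisfies the restrictions. Vectors are columns, $'$ denotes transpose, $\mathbb{N}^*=\{1,2,\dots\}$, and $A^-$ is a generalized (e.g. Moore–Penrose) inverse of a square matrix $A$; $V(g_i\mid X^{(i)})$ is the conditional variance matrix and $V^-(g_i\mid X^{(i)})$ its generalized inverse. For an $\mathbb{R}^m$-valued function $\zeta(Z,\theta)$, $E[\partial_{\theta'}\zeta\mid X]$ denotes the $m\times d$ matrix $\frac{\partial}{\partial\theta'}E[\zeta(Z,\theta)\mid X]\big|_{\theta=\theta_0}$ ($\theta\mapsto\zeta(z,\theta)$ itself need not be differentiable), similarly for marginal expectations, and $E(\partial_\theta\zeta'\mid X)$ denotes its transpose. **Score and spaces.** $S_{\theta_0}=\partial_\theta\log f(Z,\theta)|_{\theta=\theta_0}\in\bigoplus_{k=1}^dL^2(P_0)$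 is the score for $\theta$ at $P_0$ in $\mathcal{P}$ (derivative of the log-density in the mean square sense, nuisance parameter held fixed). $\bigoplus_{k=1}^dL^2(P_0)$ has the inner product $\langle(\phi_1,\dots,\phi_d),(\psi_1,\dots,\psi_d)\rangle=\sum_k\langle\phi_k,\psi_k\rangle$. Let $$\mathcal{T}_i=\left\{s\in\bigoplus_{k=1}^dL^2(P_0):E(s)=0,\ E\left(g_i(Z,\theta_0)s'(Z)\mid X^{(i)}\right)=0\right\},\ i=1,2,\qquad\mathcal{T}=\mathcal{T}_1\cap\mathcal{T}_2,$$ and $H_i=\mathcal{T}_i^\perp=\{s\in\bigoplus_{k=1}^dL^2(P_0):s(Z)=a_i(X^{(i)})g_i(Z,\theta_0)\text{ for some }d\times p_i\text{ matrix function }a_i\}$, so that $\mathcal{T}^\perp=\overline{H_1+H_2}$ (orthogonal complements are taken within the subspace of mean-zero elements). $\Pi(s\mid\mathcal{S})$ is the (componentwise) orthogonal projection of $s$ on the closure of $\mathcal{S}$. **Unconditional models $\mathcal{P}_k$** (used in Assumption SP). Let $p=p_1+p_2$, $\underline g=(g_1',g_2')'$, and let $\underline X$ be the vector of all components of $Z$ contained in $X^{(1)},X^{(2)}$. Let $\mathcal{W}=\{w_k:k\in\mathbb{N}^*\}\subset L^2(P_0)$ be a countable set with linear span dense in $L^2(P_0)$. Let $\underline w_s(\underline X)$ be the $p\times p$ diagonal matrix whose diagonal consists of $E[w_s(Z)\mid X^{(1)}]$ repeated $p_1$ times followed by $E[w_s(Z)\mid X^{(2)}]$ repeated $p_2$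 times; let $\underline w^{(k)}(\underline X)$ be the $kp\times p$ matrix stacking $\underline w_1,\dots,\underline w_k$ vertically, and $\underline g_k^w(Z,\theta)=\underline w^{(k)}(\underline X)\underline g(Z,\theta)$. $\mathcal{P}_k$ is the collection of laws of $Z$ for which $E[\underline g_k^w(Z,\theta)]=0$ for some $\theta\in\Theta$. The Fisher information on $\theta_0$ in $\mathcal{P}_k$ is $I_{\theta_0}^{(k)}=E[\partial_{\theta'}\underline g_k^w(Z,\theta_0)]'\,V^-[\underline g_k^w(Z,\theta_0)]\,E[\partial_{\theta'}\underline g_k^w(Z,\theta_0)]$. The Fisher information $I_{\theta_0}$ in $\mathcal{P}$ at $P_0$ is the inverse of the variance of the efficient influence function of the parameter $\psi(P_{\theta,\eta})=\theta$ (the representer of the derivative of $\psi$ with components in the tangent space of $\mathcal{P}$ at $P_0$, the latter being the closed linear span of the scores at $P_0$ of one-dimensional quadratic-mean-differentiable submodels). **Assumption T.** There is a subset $A\subset\operatorname{supp}Z$ such that, with $g_{i,A}=g_i(Z,\theta_0)\mathbf{I}_{\{Z\in A\}}$ and, for $(i,j)\in\{(1,2),(2,1)\}$, $$b_i=g_{i,A}-E\left(g_{i,A}g_{j,A}'\mid X^{(1)},X^{(2)}\right)E^{-1}\left(g_{j,A}g_{j,A}'\mid X^{(1)},X^{(2)}\right)g_{j,A},$$ one has for $i=1,2$: $g_{i,A}$ is bounded; (1) $E(g_{i,A}g_{i,A}'\mid X^{(1)},X^{(2)})$ is invertible and $\|E^{-1}(g_{i,A}g_{i,A}'\mid X^{(1)},X^{(2)})\|_\infty<\infty$;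 (2) $\|E^{-1}(b_ib_i'\mid X^{(i)})\|_\infty<\infty$. Here $E^{-1}(\cdot\mid\cdot)$ is the inverse of the conditional expectation matrix, and the norm of a vector or matrix is the sum of the componentwise norms. **Assumption SP.** (1) The models can be written in semiparametric form $\mathcal{P}=\{P_{\theta,\eta}:\theta\in\Theta,\eta\in H\}$ and $\mathcal{P}_k=\{P_{\theta,\eta}:\theta\in\Theta,\eta\in H_k^{\mathrm{nuis}}\}$, $k\in\mathbb{N}^*$ (where the functional parameter $\eta$ may have $\theta$ among its arguments; the nuisance sets $H$, $H_k^{\mathrm{nuis}}$ are unrelated to the subspaces $H_1,H_2$), with $P_0=P_{\theta_0,\eta_0}$, and each satisfies the assumptions of Lemma 25.25 of van der Vaart (Asymptotic Statistics, 1998), namely: with $S_{\theta_0}$ the score for $\theta$ at $P_0$ ($\eta=\eta_0$ fixed), for every $a\in\mathbb{R}^d$ and every $g$ in the tangent set at $P_0$ of the submodel in which $\theta=\theta_0$ is fixed and only $\eta$ varies, there is a path $t\mapsto\eta_t$ in the nuisance space such that $$\int\left[\frac{dP_{\theta_0+ta,\eta_t}^{1/2}-dP_{\theta_0,\eta_0}^{1/2}}{t}-\frac12\left(a'S_{\theta_0}+g\right)dP_{\theta_0,\eta_0}^{1/2}\right]^2\to0\quad\text{as }t\to0;$$ and the matrix $E(\widetilde\ell\,\widetilde\ell')$ is nonsingular, where $\widetilde\ell$ is the residual of the componentwise projection of $S_{\theta_0}$ on the closed linear span of the tangent set for $\eta$. (2) The Fisher information matrices $I_{\theta_0}$ and $I_{\theta_0}^{(k)}$,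 for any $k\in\mathbb{N}^*$, are well defined and nonsingular.
   Formalization: Added assumption, without which the claim can fail: for i=1,2, g_i(Z,θ) is square integrable under P_0 for θ near θ_0 and L²(P_0)-continuous at θ_0, and the second moment of g_i(Z,θ) under P_{θ,η_0} is finite and bounded for θ near θ_0. *)

theory Defs
  imports "HOL-Probability.Probability"
begin

section \<open>Square integrable functions and orthogonal projections\<close>

text \<open>
  Elements of \<open>L\<^sup>2\<close> are represented by functions; equality in \<open>L\<^sup>2\<close> is equality almost everywhere.
  For \<open>'b = real ^ 'd\<close> the space \<open>L2 M\<close> is the direct sum of \<open>d\<close> copies of the scalar space and
  \<open>l2_inner\<close> is the sum of the componentwise inner products.
\<close>

definition L2 :: "'a measure \<Rightarrow> ('a \<Rightarrow> 'b::euclidean_space) set" where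
  "L2 M = {f \<in> borel_measurable M. integrable M (\<lambda>x. (norm (f x))\<^sup>2)}"

definition l2_inner :: "'a measure \<Rightarrow> ('a \<Rightarrow> 'b::euclidean_space) \<Rightarrow> ('a \<Rightarrow> 'b) \<Rightarrow> real" where
  "l2_inner M f h = (\<integral>x. f x \<bullet> h x \<partial>M)"

definition l2_dist :: "'a measure \<Rightarrow> ('a \<Rightarrow> 'b::euclidean_space) \<Rightarrow> ('a \<Rightarrow> 'b) \<Rightarrow> real" where
  "l2_dist M f h = sqrt (\<integral>x. (norm (f x - h x))\<^sup>2 \<partial>M)"

definition l2_closure :: "'a measure \<Rightarrow> ('a \<Rightarrow> 'b::euclidean_space) set \<Rightarrow> ('a \<Rightarrow> 'b) set" where
  "l2_closure M V = {f \<in> L2 M. \<forall>\<epsilon>>0. \<exists>h\<in>V. l2_dist M f h < \<epsilon>}"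

definition lin_span :: "('a \<Rightarrow> real) set \<Rightarrow> ('a \<Rightarrow> real) set" where
  "lin_span V = {f. \<exists>(n::nat) c h. (\<forall>i<n. h i \<in> V) \<and> f = (\<lambda>x. \<Sum>i<n. c i * h i x)}"

text \<open>\<open>p\<close> is (a version of) the orthogonal projection of \<open>s\<close> on the closure of the subspace \<open>V\<close>.\<close>

definition is_proj ::
  "'a measure \<Rightarrow> ('a \<Rightarrow> 'b::euclidean_space) set \<Rightarrow> ('a \<Rightarrow> 'b) \<Rightarrow> ('a \<Rightarrow> 'b) \<Rightarrow> bool" where
  "is_proj M V s p \<longleftrightarrow>
     p \<in> l2_closure M V \<and> (\<forall>t\<in>V. l2_inner M (\<lambda>x. s x - p x) t = 0)"

text \<open>Orthogonal complements are taken within the mean-zero functions.\<close>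

definition orth_compl :: "'a measure \<Rightarrow> ('a \<Rightarrow> 'b::euclidean_space) set \<Rightarrow> ('a \<Rightarrow> 'b) set" where
  "orth_compl M V = {s \<in> L2 M. (\<integral>x. s x \<partial>M) = 0 \<and> (\<forall>t\<in>V. l2_inner M s t = 0)}"


section \<open>Subvectors and matrix-valued conditional moments\<close>

text \<open>
  The random vector is the identity on \<open>real ^ 'q\<close> under its law.  A subvector is given by the set
  \<open>J\<close> of its coordinates; the other coordinates are replaced by the constant 0, so that \<open>sigma_sub J\<close>
  is the sigma-algebra it generates (the trivial one for \<open>J = {}\<close>).
\<close>

definition subvec :: "'q set \<Rightarrow> real ^ 'q \<Rightarrow> real ^ 'q" where
  "subvec J z = (\<chi> i. if i \<in> J then z $ i else 0)"

definition sigma_sub :: "'q set \<Rightarrow> (real ^ 'q) measure" where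
  "sigma_sub J = vimage_algebra UNIV (subvec J) borel"

definition outer :: "real ^ 'm \<Rightarrow> real ^ 'n \<Rightarrow> real ^ 'n ^ 'm" where
  "outer u v = (\<chi> i j. u $ i * v $ j)"

definition cond_exp_vec ::
  "'a measure \<Rightarrow> 'a measure \<Rightarrow> ('a \<Rightarrow> real ^ 'm) \<Rightarrow> 'a \<Rightarrow> real ^ 'm" where
  "cond_exp_vec M F f z = (\<chi> i. real_cond_exp M F (\<lambda>x. f x $ i) z)"

definition cond_exp_mat ::
  "'a measure \<Rightarrow> 'a measure \<Rightarrow> ('a \<Rightarrow> real ^ 'n ^ 'm) \<Rightarrow> 'a \<Rightarrow> real ^ 'n ^ 'm" where
  "cond_exp_mat M F f z = (\<chi> i j. real_cond_exp M F (\<lambda>x. f x $ i $ j) z)"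

definition cond_var ::
  "'a measure \<Rightarrow> 'a measure \<Rightarrow> ('a \<Rightarrow> real ^ 'm) \<Rightarrow> 'a \<Rightarrow> real ^ 'm ^ 'm" where
  "cond_var M F f z =
     cond_exp_mat M F (\<lambda>x. outer (f x) (f x)) z
       - outer (cond_exp_vec M F f z) (cond_exp_vec M F f z)"

definition variance_mat :: "'a measure \<Rightarrow> ('a \<Rightarrow> real ^ 'm) \<Rightarrow> real ^ 'm ^ 'm" where
  "variance_mat M f =
     (\<integral>x. outer (f x) (f x) \<partial>M) - outer (\<integral>x. f x \<partial>M) (\<integral>x. f x \<partial>M)"

text \<open>
  A choice \<open>G\<close> of a generalized inverse of every square matrix of a given size.  Borel measurability
  makes \<open>G (V (X))\<close> a measurable function of \<open>X\<close>; the Moore--Penrose inverse is one instance.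
\<close>

definition generalized_inverse :: "(real ^ 'm ^ 'm \<Rightarrow> real ^ 'm ^ 'm) \<Rightarrow> bool" where
  "generalized_inverse G \<longleftrightarrow> G \<in> borel_measurable borel \<and> (\<forall>A. A ** G A ** A = A)"


section \<open>The models\<close>

definition dominated_laws :: "(real ^ 'q) measure \<Rightarrow> (real ^ 'q) measure set" where
  "dominated_laws \<mu> = {P. prob_space P \<and> sets P = sets borel \<and> absolutely_continuous \<mu> P}"

definition moment_restriction :: "'a measure \<Rightarrow> 'a measure \<Rightarrow> ('a \<Rightarrow> real ^ 'm) \<Rightarrow> bool" where
  "moment_restriction P F h \<longleftrightarrow> integrable P h \<and> (AE z in P. cond_exp_vec P F h z = 0)"

definition cond_model ::
  "(real ^ 'q) measure \<Rightarrow> 'q set \<Rightarrow> 'q set \<Rightarrow>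
   (real ^ 'q \<Rightarrow> real ^ 'd \<Rightarrow> real ^ 'p1) \<Rightarrow> (real ^ 'q \<Rightarrow> real ^ 'd \<Rightarrow> real ^ 'p2) \<Rightarrow>
   real ^ 'd \<Rightarrow> (real ^ 'q) measure set" where
  "cond_model \<mu> J1 J2 g1 g2 \<theta> =
     {P \<in> dominated_laws \<mu>. moment_restriction P (sigma_sub J1) (\<lambda>z. g1 z \<theta>)
                          \<and> moment_restriction P (sigma_sub J2) (\<lambda>z. g2 z \<theta>)}"

definition g_stack ::
  "(real ^ 'q \<Rightarrow> real ^ 'd \<Rightarrow> real ^ 'p1) \<Rightarrow> (real ^ 'q \<Rightarrow> real ^ 'd \<Rightarrow> real ^ 'p2) \<Rightarrow>
   real ^ 'q \<Rightarrow> real ^ 'd \<Rightarrow> real ^ ('p1::finite + 'p2::finite)" where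
  "g_stack g1 g2 z \<theta> = (\<chi> r. case r of Inl i \<Rightarrow> g1 z \<theta> $ i | Inr j \<Rightarrow> g2 z \<theta> $ j)"

definition w_mat ::
  "(real ^ 'q) measure \<Rightarrow> 'q set \<Rightarrow> 'q set \<Rightarrow> (real ^ 'q \<Rightarrow> real) \<Rightarrow>
   real ^ 'q \<Rightarrow> real ^ ('p1::finite + 'p2::finite) ^ ('p1 + 'p2)" where
  "w_mat P0 J1 J2 w z =
     (\<chi> r c. if r = c
             then (case r of Inl i \<Rightarrow> real_cond_exp P0 (sigma_sub J1) w z
                           | Inr j \<Rightarrow> real_cond_exp P0 (sigma_sub J2) w z)
             else 0)"

text \<open>
  Since \<open>k\<close> varies, a vector of length \<open>k p\<close> is a function on the finite index set \<open>stack_index k\<close>: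
  the entry \<open>(s, r)\<close> is the \<open>r\<close>-th entry of the \<open>s\<close>-th stacked block.
\<close>

definition stack_index :: "nat \<Rightarrow> (nat \<times> ('p1::finite + 'p2::finite)) set" where
  "stack_index k = {1..k} \<times> UNIV"

definition gw ::
  "(real ^ 'q) measure \<Rightarrow> 'q set \<Rightarrow> 'q set \<Rightarrow>
   (real ^ 'q \<Rightarrow> real ^ 'd \<Rightarrow> real ^ 'p1) \<Rightarrow> (real ^ 'q \<Rightarrow> real ^ 'd \<Rightarrow> real ^ 'p2) \<Rightarrow>
   (nat \<Rightarrow> real ^ 'q \<Rightarrow> real) \<Rightarrow> nat \<times> ('p1::finite + 'p2::finite) \<Rightarrow> real ^ 'q \<Rightarrow> real ^ 'd \<Rightarrow> real" where
  "gw P0 J1 J2 g1 g2 w sr z \<theta> =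
     (w_mat P0 J1 J2 (w (fst sr)) z *v g_stack g1 g2 z \<theta>) $ snd sr"

definition uncond_model ::
  "(real ^ 'q) measure \<Rightarrow> (real ^ 'q) measure \<Rightarrow> 'q set \<Rightarrow> 'q set \<Rightarrow>
   (real ^ 'q \<Rightarrow> real ^ 'd \<Rightarrow> real ^ 'p1) \<Rightarrow> (real ^ 'q \<Rightarrow> real ^ 'd \<Rightarrow> real ^ 'p2) \<Rightarrow>
   (nat \<Rightarrow> real ^ 'q \<Rightarrow> real) \<Rightarrow> nat \<Rightarrow> real ^ 'd \<Rightarrow> (real ^ 'q) measure set" where
  "uncond_model \<mu> P0 J1 J2 g1 g2 w k \<theta> =
     {P \<in> dominated_laws \<mu>. \<forall>sr \<in> stack_index k.
        integrable P (\<lambda>z. gw P0 J1 J2 g1 g2 w sr z \<theta>)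
        \<and> (\<integral>z. gw P0 J1 J2 g1 g2 w sr z \<theta> \<partial>P) = 0}"

text \<open>
  A model given as the union over \<open>\<theta> \<in> \<Theta>\<close> of the sets \<open>Mod \<theta>\<close> is \<open>{Par \<theta> \<eta> | \<theta> \<in> \<Theta>, \<eta> \<in> H}\<close>, where
  \<open>\<theta>\<close> is the parameter for which \<open>Par \<theta> \<eta>\<close> satisfies the restrictions.
\<close>

definition semiparametric_form ::
  "(real ^ 'd) set \<Rightarrow> (real ^ 'd \<Rightarrow> (real ^ 'q) measure set) \<Rightarrow>
   (real ^ 'd \<Rightarrow> 'e \<Rightarrow> (real ^ 'q) measure) \<Rightarrow> 'e set \<Rightarrow> bool" where
  "semiparametric_form \<Theta> Mod Par H \<longleftrightarrow>
     (\<forall>\<theta>\<in>\<Theta>. \<forall>\<eta>\<in>H. Par \<theta> \<eta> \<in> Mod \<theta>) \<and> (\<Union>\<theta>\<in>\<Theta>. Mod \<theta>) = {Par \<theta> \<eta> |\<theta> \<eta>. \<theta> \<in> \<Theta> \<and> \<eta> \<in> H}"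


section \<open>Derivatives of (conditional) moments\<close>

text \<open>
  \<open>D\<close> is a version of the matrix \<open>\<partial>/\<partial>\<theta>' E[g(Z,\<theta>) | F]\<close> at \<open>\<theta>0\<close>: the derivative, for almost every
  \<open>z\<close>, of a version \<open>m\<close> of the conditional expectation.  It does not depend on the version: two
  versions agree almost surely at countably many \<open>\<theta>\<close> simultaneously.
\<close>

definition cond_jacobian ::
  "'a measure \<Rightarrow> 'a measure \<Rightarrow> (real ^ 'd) set \<Rightarrow> real ^ 'd \<Rightarrow>
   ('a \<Rightarrow> real ^ 'd \<Rightarrow> real ^ 'm) \<Rightarrow> ('a \<Rightarrow> real ^ 'd ^ 'm) \<Rightarrow> bool" where
  "cond_jacobian M F \<Theta> \<theta>0 g D \<longleftrightarrow>
     D \<in> borel_measurable F \<and>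
     (\<exists>m. (\<forall>\<theta>\<in>\<Theta>. m \<theta> \<in> borel_measurable F
                \<and> (AE z in M. m \<theta> z = cond_exp_vec M F (\<lambda>x. g x \<theta>) z))
        \<and> (AE z in M. ((\<lambda>\<theta>. m \<theta> z) has_derivative (\<lambda>h. D z *v h)) (at \<theta>0 within \<Theta>)))"

text \<open>
  Smoothness of \<open>g\<close> in \<open>\<theta>\<close> at \<open>\<theta>0\<close>, in quadratic mean (no pointwise continuity), along the laws
  \<open>Pth \<theta>\<close>.  It is what allows differentiating \<open>E\<^sub>\<theta>[g(Z,\<theta>) | X] = 0\<close> at \<open>\<theta>0\<close>, with the derivative of the
  law entering through its quadratic mean score.
\<close>

definition quadratic_mean_regular ::
  "'a measure \<Rightarrow> (real ^ 'd) set \<Rightarrow> real ^ 'd \<Rightarrow> (real ^ 'd \<Rightarrow> 'a measure) \<Rightarrow>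
   ('a \<Rightarrow> real ^ 'd \<Rightarrow> real ^ 'm) \<Rightarrow> bool" where
  "quadratic_mean_regular P0 \<Theta> \<theta>0 Pth g \<longleftrightarrow>
     (\<lambda>z. g z \<theta>0) \<in> L2 P0 \<and>
     (\<forall>\<^sub>F \<theta> in at \<theta>0 within \<Theta>. (\<lambda>z. g z \<theta>) \<in> L2 P0) \<and>
     ((\<lambda>\<theta>. l2_dist P0 (\<lambda>z. g z \<theta>) (\<lambda>z. g z \<theta>0)) \<longlongrightarrow> 0) (at \<theta>0 within \<Theta>) \<and>
     (\<exists>C. \<forall>\<^sub>F \<theta> in at \<theta>0 within \<Theta>.
        (\<lambda>z. g z \<theta>) \<in> L2 (Pth \<theta>) \<and> (\<integral>z. (norm (g z \<theta>))\<^sup>2 \<partial>Pth \<theta>) \<le> C)"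


section \<open>Scores, tangent sets and Fisher information\<close>

definition root_density :: "'a measure \<Rightarrow> 'a measure \<Rightarrow> 'a \<Rightarrow> real" where
  "root_density \<mu> P z = sqrt (enn2real (RN_deriv \<mu> P z))"

text \<open>\<open>t \<mapsto> Pt t\<close> is differentiable in quadratic mean at \<open>P0\<close> as \<open>t \<down> 0\<close>, with score \<open>s\<close>.\<close>

definition qmd_path ::
  "'a measure \<Rightarrow> 'a measure \<Rightarrow> (real \<Rightarrow> 'a measure) \<Rightarrow> ('a \<Rightarrow> real) \<Rightarrow> bool" where
  "qmd_path \<mu> P0 Pt s \<longleftrightarrow>
     s \<in> L2 P0 \<and>
     ((\<lambda>t. \<integral>\<^sup>+z. ennreal (((root_density \<mu> (Pt t) z - root_density \<mu> P0 z) / t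
                           - 1 / 2 * s z * root_density \<mu> P0 z)\<^sup>2) \<partial>\<mu>)
        \<longlongrightarrow> 0) (at_right 0)"

text \<open>\<open>S\<close> is the mean square derivative of the log-density of \<open>Pth \<theta>\<close> at \<open>\<theta>0\<close>.\<close>

definition is_theta_score ::
  "'a measure \<Rightarrow> (real ^ 'd) set \<Rightarrow> real ^ 'd \<Rightarrow> (real ^ 'd \<Rightarrow> 'a measure) \<Rightarrow>
   ('a \<Rightarrow> real ^ 'd) \<Rightarrow> bool" where
  "is_theta_score \<mu> \<Theta> \<theta>0 Pth S \<longleftrightarrow>
     S \<in> L2 (Pth \<theta>0) \<and>
     ((\<lambda>\<theta>. \<integral>\<^sup>+z. ennreal (((root_density \<mu> (Pth \<theta>) z - root_density \<mu> (Pth \<theta>0) z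
                             - 1 / 2 * ((\<theta> - \<theta>0) \<bullet> S z) * root_density \<mu> (Pth \<theta>0) z)
                            / norm (\<theta> - \<theta>0))\<^sup>2) \<partial>\<mu>)
        \<longlongrightarrow> 0) (at \<theta>0 within \<Theta>)"

definition nuisance_tangent_set ::
  "'a measure \<Rightarrow> (real ^ 'd \<Rightarrow> 'e \<Rightarrow> 'a measure) \<Rightarrow> 'e set \<Rightarrow> real ^ 'd \<Rightarrow> 'e \<Rightarrow>
   ('a \<Rightarrow> real) set" where
  "nuisance_tangent_set \<mu> Par H \<theta>0 \<eta>0 =
     {s. \<exists>\<eta>. (\<forall>\<^sub>F t in at_right 0. \<eta> t \<in> H) \<and> qmd_path \<mu> (Par \<theta>0 \<eta>0) (\<lambda>t. Par \<theta>0 (\<eta> t)) s}"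

text \<open>The assumptions of Lemma 25.25 of van der Vaart, Asymptotic Statistics (1998).\<close>

definition vdv_25_25 ::
  "'a measure \<Rightarrow> (real ^ 'd) set \<Rightarrow> (real ^ 'd \<Rightarrow> 'e \<Rightarrow> 'a measure) \<Rightarrow> 'e set \<Rightarrow>
   real ^ 'd \<Rightarrow> 'e \<Rightarrow> ('a \<Rightarrow> real ^ 'd) \<Rightarrow> bool" where
  "vdv_25_25 \<mu> \<Theta> Par H \<theta>0 \<eta>0 S \<longleftrightarrow>
     (\<forall>a. \<forall>g \<in> nuisance_tangent_set \<mu> Par H \<theta>0 \<eta>0.
        \<exists>\<eta>. (\<forall>\<^sub>F t in at_right 0. \<theta>0 + t *\<^sub>R a \<in> \<Theta> \<and> \<eta> t \<in> H)
           \<and> qmd_path \<mu> (Par \<theta>0 \<eta>0) (\<lambda>t. Par (\<theta>0 + t *\<^sub>R a) (\<eta> t)) (\<lambda>z. a \<bullet> S z + g z)) \<and>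
     (\<exists>l \<in> L2 (Par \<theta>0 \<eta>0).
        (\<forall>k. is_proj (Par \<theta>0 \<eta>0) (lin_span (nuisance_tangent_set \<mu> Par H \<theta>0 \<eta>0))
               (\<lambda>z. S z $ k) (\<lambda>z. S z $ k - l z $ k))
        \<and> invertible (\<integral>z. outer (l z) (l z) \<partial>Par \<theta>0 \<eta>0))"

text \<open>Scores at \<open>P\<^sub>0\<close> of one-dimensional submodels \<open>t \<mapsto> Par (\<theta> t) (\<eta> t)\<close> of the whole model.\<close>

definition is_submodel_score ::
  "'a measure \<Rightarrow> (real ^ 'd) set \<Rightarrow> (real ^ 'd \<Rightarrow> 'e \<Rightarrow> 'a measure) \<Rightarrow> 'e set \<Rightarrow>
   real ^ 'd \<Rightarrow> 'e \<Rightarrow> (real \<Rightarrow> real ^ 'd) \<Rightarrow> (real \<Rightarrow> 'e) \<Rightarrow> ('a \<Rightarrow> real) \<Rightarrow> bool" where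
  "is_submodel_score \<mu> \<Theta> Par H \<theta>0 \<eta>0 \<theta> \<eta> s \<longleftrightarrow>
     (\<forall>\<^sub>F t in at_right 0. \<theta> t \<in> \<Theta> \<and> \<eta> t \<in> H) \<and>
     qmd_path \<mu> (Par \<theta>0 \<eta>0) (\<lambda>t. Par (\<theta> t) (\<eta> t)) s"

definition tangent_space ::
  "'a measure \<Rightarrow> (real ^ 'd) set \<Rightarrow> (real ^ 'd \<Rightarrow> 'e \<Rightarrow> 'a measure) \<Rightarrow> 'e set \<Rightarrow>
   real ^ 'd \<Rightarrow> 'e \<Rightarrow> ('a \<Rightarrow> real) set" where
  "tangent_space \<mu> \<Theta> Par H \<theta>0 \<eta>0 =
     l2_closure (Par \<theta>0 \<eta>0)
       (lin_span {s. \<exists>\<theta> \<eta>. is_submodel_score \<mu> \<Theta> Par H \<theta>0 \<eta>0 \<theta> \<eta> s})"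

text \<open>Efficient influence function of the functional \<open>Par \<theta> \<eta> \<mapsto> \<theta>\<close>.\<close>

definition is_efficient_influence ::
  "'a measure \<Rightarrow> (real ^ 'd) set \<Rightarrow> (real ^ 'd \<Rightarrow> 'e \<Rightarrow> 'a measure) \<Rightarrow> 'e set \<Rightarrow>
   real ^ 'd \<Rightarrow> 'e \<Rightarrow> ('a \<Rightarrow> real ^ 'd) \<Rightarrow> bool" where
  "is_efficient_influence \<mu> \<Theta> Par H \<theta>0 \<eta>0 \<psi> \<longleftrightarrow>
     \<psi> \<in> L2 (Par \<theta>0 \<eta>0) \<and>
     (\<forall>k. (\<lambda>z. \<psi> z $ k) \<in> tangent_space \<mu> \<Theta> Par H \<theta>0 \<eta>0) \<and>
     (\<forall>\<theta> \<eta> s. is_submodel_score \<mu> \<Theta> Par H \<theta>0 \<eta>0 \<theta> \<eta> s \<longrightarrow>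
        ((\<lambda>t. (\<theta> t - \<theta>0) /\<^sub>R t) \<longlongrightarrow> (\<integral>z. s z *\<^sub>R \<psi> z \<partial>Par \<theta>0 \<eta>0)) (at_right 0))"

definition is_fisher_information ::
  "'a measure \<Rightarrow> (real ^ 'd) set \<Rightarrow> (real ^ 'd \<Rightarrow> 'e \<Rightarrow> 'a measure) \<Rightarrow> 'e set \<Rightarrow>
   real ^ 'd \<Rightarrow> 'e \<Rightarrow> real ^ 'd ^ 'd \<Rightarrow> bool" where
  "is_fisher_information \<mu> \<Theta> Par H \<theta>0 \<eta>0 I \<longleftrightarrow>
     (\<exists>\<psi>. is_efficient_influence \<mu> \<Theta> Par H \<theta>0 \<eta>0 \<psi>
        \<and> invertible (variance_mat (Par \<theta>0 \<eta>0) \<psi>)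
        \<and> I = matrix_inv (variance_mat (Par \<theta>0 \<eta>0) \<psi>))"

text \<open>
  Fisher information of the unconditional models: \<open>B\<close> is the Jacobian of \<open>\<theta> \<mapsto> E[g\<^sub>k\<^sup>w(Z,\<theta>)]\<close>, \<open>V\<close> the
  variance matrix of \<open>g\<^sub>k\<^sup>w(Z,\<theta>0)\<close>, \<open>W\<close> a generalized inverse of \<open>V\<close>, and \<open>I = B' W B\<close>.
\<close>

definition is_fisher_information_k ::
  "(real ^ 'q) measure \<Rightarrow> 'q set \<Rightarrow> 'q set \<Rightarrow> (real ^ 'd) set \<Rightarrow> real ^ 'd \<Rightarrow>
   (real ^ 'q \<Rightarrow> real ^ 'd \<Rightarrow> real ^ 'p1) \<Rightarrow> (real ^ 'q \<Rightarrow> real ^ 'd \<Rightarrow> real ^ 'p2) \<Rightarrow>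
   (nat \<Rightarrow> real ^ 'q \<Rightarrow> real) \<Rightarrow> nat \<Rightarrow> real ^ 'd ^ 'd \<Rightarrow> bool" where
  "is_fisher_information_k P0 J1 J2 \<Theta> \<theta>0 g1 g2 w k I \<longleftrightarrow>
     (let gk = gw P0 J1 J2 g1 g2 w;
          K = stack_index k;
          V = (\<lambda>i j. (\<integral>z. gk i z \<theta>0 * gk j z \<theta>0 \<partial>P0)
                       - (\<integral>z. gk i z \<theta>0 \<partial>P0) * (\<integral>z. gk j z \<theta>0 \<partial>P0))
      in (\<forall>i\<in>K. (\<lambda>z. gk i z \<theta>0) \<in> L2 P0
               \<and> (\<forall>\<^sub>F \<theta> in at \<theta>0 within \<Theta>. integrable P0 (\<lambda>z. gk i z \<theta>)))
       \<and> (\<exists>B W. (\<forall>i\<in>K. ((\<lambda>\<theta>. \<integral>z. gk i z \<theta> \<partial>P0) has_derivative (\<lambda>h. B i \<bullet> h))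
                          (at \<theta>0 within \<Theta>))
             \<and> (\<forall>i\<in>K. \<forall>j\<in>K. (\<Sum>a\<in>K. \<Sum>b\<in>K. V i a * W a b * V b j) = V i j)
             \<and> I = (\<chi> m n. \<Sum>i\<in>K. \<Sum>j\<in>K. B i $ m * W i j * B j $ n)))"


section \<open>Assumptions T and SP\<close>

definition topological_support :: "(real ^ 'q) measure \<Rightarrow> (real ^ 'q) set" where
  "topological_support P = {z. \<forall>U. open U \<and> z \<in> U \<longrightarrow> emeasure P U > 0}"

text \<open>\<open>B\<close> is a.s. invertible with essentially bounded inverse (norm: sum of the entrywise norms).\<close>

definition bounded_inverse :: "'a measure \<Rightarrow> ('a \<Rightarrow> real ^ 'm ^ 'm) \<Rightarrow> bool" where
  "bounded_inverse M B \<longleftrightarrow>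
     (AE z in M. invertible (B z)) \<and>
     (\<exists>C. AE z in M. (\<Sum>i\<in>UNIV. \<Sum>j\<in>UNIV. \<bar>matrix_inv (B z) $ i $ j\<bar>) \<le> C)"

text \<open>
  The conditions on one function \<open>g\<close> restricted to \<open>A\<close>, with \<open>h\<close> the other one; \<open>F\<close> and \<open>F12\<close> are
  generated by the conditioning vector of \<open>g\<close> and by both conditioning vectors.
\<close>

definition assumption_T_for ::
  "'a measure \<Rightarrow> 'a measure \<Rightarrow> 'a measure \<Rightarrow> 'a set \<Rightarrow>
   ('a \<Rightarrow> real ^ 'm) \<Rightarrow> ('a \<Rightarrow> real ^ 'n) \<Rightarrow> bool" where
  "assumption_T_for P0 F F12 A g h \<longleftrightarrow>
     (let gA = (\<lambda>z. indicator A z *\<^sub>R g z);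
          hA = (\<lambda>z. indicator A z *\<^sub>R h z);
          b = (\<lambda>z. gA z - (cond_exp_mat P0 F12 (\<lambda>x. outer (gA x) (hA x)) z
                            ** matrix_inv (cond_exp_mat P0 F12 (\<lambda>x. outer (hA x) (hA x)) z)) *v hA z)
      in (\<exists>C. AE z in P0. (\<Sum>i\<in>UNIV. \<bar>gA z $ i\<bar>) \<le> C)
       \<and> bounded_inverse P0 (cond_exp_mat P0 F12 (\<lambda>x. outer (gA x) (gA x)))
       \<and> bounded_inverse P0 (cond_exp_mat P0 F (\<lambda>x. outer (b x) (b x))))"

definition assumption_T ::
  "(real ^ 'q) measure \<Rightarrow> 'q set \<Rightarrow> 'q set \<Rightarrow>
   (real ^ 'q \<Rightarrow> real ^ 'p1) \<Rightarrow> (real ^ 'q \<Rightarrow> real ^ 'p2) \<Rightarrow> bool" where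
  "assumption_T P0 J1 J2 g1 g2 \<longleftrightarrow>
     (\<exists>A \<in> sets borel. A \<subseteq> topological_support P0
        \<and> assumption_T_for P0 (sigma_sub J1) (sigma_sub (J1 \<union> J2)) A g1 g2
        \<and> assumption_T_for P0 (sigma_sub J2) (sigma_sub (J1 \<union> J2)) A g2 g1)"

text \<open>\<open>w k\<close> for \<open>k \<ge> 1\<close> enumerates a subset of \<open>L\<^sup>2\<close> with dense linear span.\<close>

definition dense_sequence :: "'a measure \<Rightarrow> (nat \<Rightarrow> 'a \<Rightarrow> real) \<Rightarrow> bool" where
  "dense_sequence M w \<longleftrightarrow> w ` {1..} \<subseteq> L2 M \<and> l2_closure M (lin_span (w ` {1..})) = L2 M"

definition assumption_SP ::
  "(real ^ 'q) measure \<Rightarrow> 'q set \<Rightarrow> 'q set \<Rightarrow>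
   (real ^ 'q \<Rightarrow> real ^ 'd \<Rightarrow> real ^ 'p1) \<Rightarrow> (real ^ 'q \<Rightarrow> real ^ 'd \<Rightarrow> real ^ 'p2) \<Rightarrow>
   (nat \<Rightarrow> real ^ 'q \<Rightarrow> real) \<Rightarrow> (real ^ 'd) set \<Rightarrow>
   (real ^ 'd \<Rightarrow> 'e \<Rightarrow> (real ^ 'q) measure) \<Rightarrow> 'e set \<Rightarrow> (nat \<Rightarrow> 'e set) \<Rightarrow>
   real ^ 'd \<Rightarrow> 'e \<Rightarrow> (real ^ 'q \<Rightarrow> real ^ 'd) \<Rightarrow> bool" where
  "assumption_SP \<mu> J1 J2 g1 g2 w \<Theta> Par H Hk \<theta>0 \<eta>0 S \<longleftrightarrow>
     \<eta>0 \<in> H \<and>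
     semiparametric_form \<Theta> (cond_model \<mu> J1 J2 g1 g2) Par H \<and>
     vdv_25_25 \<mu> \<Theta> Par H \<theta>0 \<eta>0 S \<and>
     (\<forall>k\<ge>1. \<eta>0 \<in> Hk k \<and>
        semiparametric_form \<Theta> (uncond_model \<mu> (Par \<theta>0 \<eta>0) J1 J2 g1 g2 w k) Par (Hk k) \<and>
        vdv_25_25 \<mu> \<Theta> Par (Hk k) \<theta>0 \<eta>0 S) \<and>
     (\<exists>I. is_fisher_information \<mu> \<Theta> Par H \<theta>0 \<eta>0 I \<and> invertible I) \<and>
     (\<forall>k\<ge>1. \<exists>I. is_fisher_information_k (Par \<theta>0 \<eta>0) J1 J2 \<Theta> \<theta>0 g1 g2 w k I \<and> invertible I)"


section \<open>The spaces and the iteration\<close>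

definition T_space ::
  "'a measure \<Rightarrow> 'a measure \<Rightarrow> ('a \<Rightarrow> real ^ 'm) \<Rightarrow> ('a \<Rightarrow> real ^ 'd) set" where
  "T_space M F g =
     {s \<in> L2 M. (\<integral>z. s z \<partial>M) = 0 \<and> (AE z in M. cond_exp_mat M F (\<lambda>x. outer (g x) (s x)) z = 0)}"

definition H_space ::
  "'a measure \<Rightarrow> 'a measure \<Rightarrow> ('a \<Rightarrow> real ^ 'm) \<Rightarrow> ('a \<Rightarrow> real ^ 'd) set" where
  "H_space M F g =
     {s \<in> L2 M. \<exists>a \<in> borel_measurable F. AE z in M. s z = (a z :: real ^ 'm ^ 'd) *v g z}"

definition space_sum :: "('a \<Rightarrow> 'b::plus) set \<Rightarrow> ('a \<Rightarrow> 'b) set \<Rightarrow> ('a \<Rightarrow> 'b) set" where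
  "space_sum U V = {(\<lambda>z. u z + v z) |u v. u \<in> U \<and> v \<in> V}"

text \<open>
  In the iteration \<open>g1\<close>, \<open>g2\<close> are taken at \<open>\<theta>0\<close>, \<open>Di\<close> is the derivative of the conditional
  expectation of \<open>gi\<close>, and \<open>Wi\<close> is the generalized inverse of its conditional variance.
\<close>

primrec a1_iter ::
  "'a measure \<Rightarrow> 'a measure \<Rightarrow> 'a measure \<Rightarrow> ('a \<Rightarrow> real ^ 'p1) \<Rightarrow> ('a \<Rightarrow> real ^ 'p2) \<Rightarrow>
   ('a \<Rightarrow> real ^ 'd ^ 'p1) \<Rightarrow> ('a \<Rightarrow> real ^ 'd ^ 'p2) \<Rightarrow>
   ('a \<Rightarrow> real ^ 'p1 ^ 'p1) \<Rightarrow> ('a \<Rightarrow> real ^ 'p2 ^ 'p2) \<Rightarrow> nat \<Rightarrow> 'a \<Rightarrow> real ^ 'p1 ^ 'd" where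
  "a1_iter M F1 F2 g1 g2 D1 D2 W1 W2 0 = (\<lambda>z. 0)"
| "a1_iter M F1 F2 g1 g2 D1 D2 W1 W2 (Suc m) = (\<lambda>z.
     - (transpose (D1 z) ** W1 z)
     + cond_exp_mat M F1 (\<lambda>x. transpose (D2 x) ** W2 x ** outer (g2 x) (g1 x)) z ** W1 z
     + cond_exp_mat M F1 (\<lambda>x.
         cond_exp_mat M F2 (\<lambda>y. a1_iter M F1 F2 g1 g2 D1 D2 W1 W2 m y ** outer (g1 y) (g2 y)) x
           ** W2 x ** outer (g2 x) (g1 x)) z ** W1 z)"

definition a2_iter ::
  "'a measure \<Rightarrow> 'a measure \<Rightarrow> 'a measure \<Rightarrow> ('a \<Rightarrow> real ^ 'p1) \<Rightarrow> ('a \<Rightarrow> real ^ 'p2) \<Rightarrow>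
   ('a \<Rightarrow> real ^ 'd ^ 'p1) \<Rightarrow> ('a \<Rightarrow> real ^ 'd ^ 'p2) \<Rightarrow>
   ('a \<Rightarrow> real ^ 'p1 ^ 'p1) \<Rightarrow> ('a \<Rightarrow> real ^ 'p2 ^ 'p2) \<Rightarrow> nat \<Rightarrow> 'a \<Rightarrow> real ^ 'p2 ^ 'd" where
  "a2_iter M F1 F2 g1 g2 D1 D2 W1 W2 m = (\<lambda>z.
     - (transpose (D2 z) ** W2 z)
     - cond_exp_mat M F2 (\<lambda>y. a1_iter M F1 F2 g1 g2 D1 D2 W1 W2 m y ** outer (g1 y) (g2 y)) z
         ** W2 z)"

definition S_iter ::
  "'a measure \<Rightarrow> 'a measure \<Rightarrow> 'a measure \<Rightarrow> ('a \<Rightarrow> real ^ 'p1) \<Rightarrow> ('a \<Rightarrow> real ^ 'p2) \<Rightarrow>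
   ('a \<Rightarrow> real ^ 'd ^ 'p1) \<Rightarrow> ('a \<Rightarrow> real ^ 'd ^ 'p2) \<Rightarrow>
   ('a \<Rightarrow> real ^ 'p1 ^ 'p1) \<Rightarrow> ('a \<Rightarrow> real ^ 'p2 ^ 'p2) \<Rightarrow> nat \<Rightarrow> 'a \<Rightarrow> real ^ 'd" where
  "S_iter M F1 F2 g1 g2 D1 D2 W1 W2 m = (\<lambda>z.
     a1_iter M F1 F2 g1 g2 D1 D2 W1 W2 m z *v g1 z
     + a2_iter M F1 F2 g1 g2 D1 D2 W1 W2 m z *v g2 z)"

end

theory Submission
  imports Defs
begin

text \<open>
  The residual \<open>S - S\<^sup>(\<^sup>m\<^sup>)\<close> is obtained from the preceding one by subtracting its projection on \<open>H\<^sub>1\<close>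
  and then the projection of the result on \<open>H\<^sub>2\<close>, so that von Neumann's theorem on alternating
  projections applies.  The projection of \<open>s\<close> on \<open>H\<^sub>i\<close> is \<open>E[s g\<^sub>i' | X\<^sub>i] V\<^sup>-(g\<^sub>i | X\<^sub>i) g\<^sub>i\<close>, and the
  derivatives in the iteration enter through \<open>E[S g\<^sub>i' | X\<^sub>i] = - E[\<partial>\<^sub>\<theta> g\<^sub>i' | X\<^sub>i]\<close>, which follows from
  \<open>E\<^sub>\<theta>[g\<^sub>i(Z,\<theta>) | X\<^sub>i] = 0\<close> by differentiation.  The projection formula holds for any generalized
  inverse because \<open>E[s g\<^sub>i' | X\<^sub>i]\<close> vanishes on the null space of \<open>V(g\<^sub>i | X\<^sub>i)\<close>.
\<close>

section \<open>Square integrable functions and alternating projections\<close>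

text \<open>The generalized inverses and the coefficients \<open>a\<close> need not be bounded, so
  square integrability of \<open>a g\<close> cannot be read off its formula. It is derived from the
  normal equation \<open>a V = C\<close> with \<open>C = E[s g' | X]\<close>: truncating
  \<open>a\<close> gives vectors of norm at most that of \<open>s\<close>, and the bound survives
  the limit. Orthogonality is obtained by truncation too. Differentiation meets another obstacle:
  the Jacobian is a pointwise limit of quotients of conditional moments, while a quadratic mean
  score controls only integrals. The integrals over each conditioning event have the expected limit,
  and the two kinds of limit are compared where the quotients stay bounded. Orthogonality of the
  limiting residual \<open>r\<close> to \<open>H1\<close> and \<open>H2\<close> leaves its mean
  open, whereas complements are formed among mean-zero functions; the constant \<open>E(r)\<close>
  is therefore split off at the end. Convergence rests on decreasing norms alone, without a rate,
  and the limit lies in the closure of \<open>H1 + H2\<close> as a limit of iterates.\<close>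

lemma L2D:
  assumes "f \<in> L2 M"
  shows "f \<in> borel_measurable M" "integrable M (\<lambda>x. (norm (f x))\<^sup>2)"
  using assms by (auto simp: L2_def)

lemma L2_dominated:
  assumes "f \<in> L2 M" "h \<in> borel_measurable M" "AE x in M. norm (h x) \<le> K * norm (f x)"
  shows "h \<in> L2 M"
proof -
  have i: "integrable M (\<lambda>x. K\<^sup>2 * (norm (f x))\<^sup>2)"
    using L2D[OF assms(1)] by auto
  have b: "AE x in M. norm ((norm (h x))\<^sup>2) \<le> norm (K\<^sup>2 * (norm (f x))\<^sup>2)"
    using assms(3)
  proof eventually_elim
    case (elim x)
    then have "(norm (h x))\<^sup>2 \<le> (K * norm (f x))\<^sup>2" by (intro power_mono) auto
    then show ?case by (simp add: power_mult_distrib)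
  qed
  have "integrable M (\<lambda>x. (norm (h x))\<^sup>2)"
    using assms(2) by (intro Bochner_Integration.integrable_bound[OF i _ b]) auto
  then show ?thesis using assms by (auto simp: L2_def)
qed

lemma L2_scaleR: "f \<in> L2 M \<Longrightarrow> (\<lambda>x. c *\<^sub>R f x) \<in> L2 M"
  by (rule L2_dominated[of f _ _ "\<bar>c\<bar>"]) (auto dest: L2D)

lemma L2_uminus: "f \<in> L2 M \<Longrightarrow> (\<lambda>x. - f x) \<in> L2 M"
  using L2_scaleR[of f M "-1"] by simp

lemma L2_add:
  assumes "f \<in> L2 M" "h \<in> L2 M"
  shows "(\<lambda>x. f x + h x) \<in> L2 M"
proof -
  have i: "integrable M (\<lambda>x. 2 * (norm (f x))\<^sup>2 + 2 * (norm (h x))\<^sup>2)"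
    using L2D[OF assms(1)] L2D[OF assms(2)] by auto
  have "norm ((norm (f x + h x))\<^sup>2) \<le> norm (2 * (norm (f x))\<^sup>2 + 2 * (norm (h x))\<^sup>2)" for x
  proof -
    have "(norm (f x + h x))\<^sup>2 \<le> (norm (f x) + norm (h x))\<^sup>2"
      by (intro power_mono norm_triangle_ineq) auto
    also have "\<dots> \<le> 2 * (norm (f x))\<^sup>2 + 2 * (norm (h x))\<^sup>2"
      using sum_squares_bound[of "norm (f x)" "norm (h x)"] by (simp add: power2_sum)
    finally show ?thesis by simp
  qed
  then have "integrable M (\<lambda>x. (norm (f x + h x))\<^sup>2)"
    using L2D[OF assms(1)] L2D[OF assms(2)] by (intro Bochner_Integration.integrable_bound[OF i]) auto
  then show ?thesis using L2D[OF assms(1)] L2D[OF assms(2)] by (auto simp: L2_def)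
qed

lemma L2_diff: "f \<in> L2 M \<Longrightarrow> h \<in> L2 M \<Longrightarrow> (\<lambda>x. f x - h x) \<in> L2 M"
  using L2_add[of f M "\<lambda>x. - h x"] L2_uminus[of h M] by simp

lemma L2_zero: "(\<lambda>x. 0) \<in> L2 M"
  by (simp add: L2_def)

lemma L2_inner_integrable:
  assumes "f \<in> L2 M" "h \<in> L2 M"
  shows "integrable M (\<lambda>x. f x \<bullet> h x)"
proof (rule Bochner_Integration.integrable_bound)
  show "integrable M (\<lambda>x. (norm (f x))\<^sup>2 + (norm (h x))\<^sup>2)"
    using L2D[OF assms(1)] L2D[OF assms(2)] by auto
  show "(\<lambda>x. f x \<bullet> h x) \<in> borel_measurable M"
    using L2D[OF assms(1)] L2D[OF assms(2)] by auto
  have "\<bar>f x \<bullet> h x\<bar> \<le> (norm (f x))\<^sup>2 + (norm (h x))\<^sup>2" for x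
    using Cauchy_Schwarz_ineq2[of "f x" "h x"] sum_squares_bound[of "norm (f x)" "norm (h x)"]
      mult_nonneg_nonneg[OF norm_ge_zero[of "f x"] norm_ge_zero[of "h x"]] by linarith
  then show "AE x in M. norm (f x \<bullet> h x) \<le> norm ((norm (f x))\<^sup>2 + (norm (h x))\<^sup>2)"
    by (intro AE_I2) simp
qed

lemma L2_mult_integrable:
  fixes f h :: "'a \<Rightarrow> real"
  assumes "f \<in> L2 M" "h \<in> L2 M"
  shows "integrable M (\<lambda>x. f x * h x)"
  using L2_inner_integrable[OF assms] by simp

lemma borel_measurable_vec_nth:
  fixes f :: "'a \<Rightarrow> 'b::euclidean_space ^ 'n"
  assumes "f \<in> borel_measurable M"
  shows "(\<lambda>x. f x $ i) \<in> borel_measurable M"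
  by (rule borel_measurable_continuous_on[OF linear_continuous_on[OF bounded_linear_vec_nth] assms])

lemma L2_nth:
  fixes f :: "'a \<Rightarrow> real ^ 'n"
  assumes "f \<in> L2 M"
  shows "(\<lambda>x. f x $ i) \<in> L2 M"
proof -
  show ?thesis
  proof (rule L2_dominated[OF assms, of _ 1])
    show "(\<lambda>x. f x $ i) \<in> borel_measurable M"
      by (rule borel_measurable_vec_nth[OF L2D(1)[OF assms]])
  qed (auto simp: component_le_norm_cart)
qed

section \<open>Inner product, norm and distance of square integrable functions\<close>

lemma l2_inner_commute: "l2_inner M f h = l2_inner M h f"
  by (simp add: l2_inner_def inner_commute)

lemma l2_inner_add_left:
  "f \<in> L2 M \<Longrightarrow> g \<in> L2 M \<Longrightarrow> h \<in> L2 M \<Longrightarrow>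
     l2_inner M (\<lambda>x. f x + g x) h = l2_inner M f h + l2_inner M g h"
  by (simp add: l2_inner_def inner_add_left L2_inner_integrable)

lemma l2_inner_diff_left:
  "f \<in> L2 M \<Longrightarrow> g \<in> L2 M \<Longrightarrow> h \<in> L2 M \<Longrightarrow>
     l2_inner M (\<lambda>x. f x - g x) h = l2_inner M f h - l2_inner M g h"
  by (simp add: l2_inner_def inner_diff_left L2_inner_integrable)

lemma l2_inner_add_right:
  "f \<in> L2 M \<Longrightarrow> g \<in> L2 M \<Longrightarrow> h \<in> L2 M \<Longrightarrow>
     l2_inner M h (\<lambda>x. f x + g x) = l2_inner M h f + l2_inner M h g"
  by (simp add: l2_inner_def inner_add_right L2_inner_integrable)

lemma l2_inner_diff_right:
  "f \<in> L2 M \<Longrightarrow> g \<in> L2 M \<Longrightarrow> h \<in> L2 M \<Longrightarrow>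
     l2_inner M h (\<lambda>x. f x - g x) = l2_inner M h f - l2_inner M h g"
  by (simp add: l2_inner_def inner_diff_right L2_inner_integrable)

lemma l2_inner_scaleR_left: "l2_inner M (\<lambda>x. c *\<^sub>R f x) h = c * l2_inner M f h"
  by (simp add: l2_inner_def)

lemma l2_inner_scaleR_right: "l2_inner M h (\<lambda>x. c *\<^sub>R f x) = c * l2_inner M h f"
  by (simp add: l2_inner_def)

definition l2_norm :: "'a measure \<Rightarrow> ('a \<Rightarrow> 'b::euclidean_space) \<Rightarrow> real" where
  "l2_norm M f = sqrt (l2_inner M f f)"

lemma l2_dist_eq_norm: "l2_dist M f h = l2_norm M (\<lambda>x. f x - h x)"
  by (simp add: l2_dist_def l2_norm_def l2_inner_def power2_norm_eq_inner)

lemma l2_inner_self_nonneg: "0 \<le> l2_inner M f f"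
  by (simp add: l2_inner_def)

lemma l2_norm_nonneg: "0 \<le> l2_norm M f"
  by (simp add: l2_norm_def l2_inner_self_nonneg)

lemma l2_norm_squared: "(l2_norm M f)\<^sup>2 = l2_inner M f f"
  by (simp add: l2_norm_def l2_inner_self_nonneg)

lemma l2_dist_squared:
  assumes "f \<in> L2 M" "h \<in> L2 M"
  shows "(l2_dist M f h)\<^sup>2 = l2_inner M f f - 2 * l2_inner M f h + l2_inner M h h"
  using assms
  by (simp add: l2_dist_eq_norm l2_norm_squared l2_inner_diff_left l2_inner_diff_right L2_diff
      l2_inner_commute[of M h f])

lemma l2_Cauchy_Schwarz:
  assumes f: "f \<in> L2 M" and h: "h \<in> L2 M"
  shows "\<bar>l2_inner M f h\<bar> \<le> l2_norm M f * l2_norm M h"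
proof -
  define a b c where "a = l2_inner M f f" and "b = l2_inner M h h" and "c = l2_inner M f h"
  have ab: "a \<ge> 0" "b \<ge> 0" by (simp_all add: a_def b_def l2_inner_self_nonneg)
  have q: "0 \<le> s\<^sup>2 * a - 2 * s * t * c + t\<^sup>2 * b" for s t
  proof -
    have "0 \<le> (l2_dist M (\<lambda>x. s *\<^sub>R f x) (\<lambda>x. t *\<^sub>R h x))\<^sup>2" by simp
    also have "\<dots> = s\<^sup>2 * a - 2 * s * t * c + t\<^sup>2 * b"
      unfolding l2_dist_squared[OF L2_scaleR[OF f] L2_scaleR[OF h]]
      by (simp add: l2_inner_scaleR_left l2_inner_scaleR_right a_def b_def c_def power2_eq_square)
    finally show ?thesis .
  qed
  have "c\<^sup>2 \<le> a * b"
  proof (cases "a = 0 \<and> b = 0")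
    case True
    then show ?thesis using q[of 1 1] q[of 1 "-1"] by auto
  next
    case False
    \<comment> \<open>The choice \<open>s = b\<close>, \<open>t = c\<close> makes the form equal to
      \<open>b * (a * b - c^2)\<close>. Its mirror image below covers the case
      \<open>b = 0\<close>.\<close>
    have "b * (c\<^sup>2) \<le> b * (a * b)" using q[of b c] by (simp add: power2_eq_square algebra_simps)
    moreover have "a * (c\<^sup>2) \<le> a * (a * b)" using q[of c a] by (simp add: power2_eq_square algebra_simps)
    ultimately show ?thesis using False ab
      by (metis less_eq_real_def mult_le_cancel_left_pos)
  qed
  then have "sqrt (c\<^sup>2) \<le> sqrt (a * b)" by (rule real_sqrt_le_mono)
  then show ?thesis by (simp add: l2_norm_def real_sqrt_mult a_def b_def c_def)
qed

lemma l2_norm_triangle: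
  assumes f: "f \<in> L2 M" and h: "h \<in> L2 M"
  shows "l2_norm M (\<lambda>x. f x + h x) \<le> l2_norm M f + l2_norm M h"
proof (rule power2_le_imp_le)
  have "(l2_norm M (\<lambda>x. f x + h x))\<^sup>2 = l2_inner M f f + 2 * l2_inner M f h + l2_inner M h h"
    using f h by (simp add: l2_norm_squared l2_inner_add_left l2_inner_add_right L2_add
      l2_inner_commute[of M h f])
  also have "\<dots> \<le> (l2_norm M f + l2_norm M h)\<^sup>2"
    using l2_Cauchy_Schwarz[OF f h] by (simp add: power2_sum l2_norm_squared)
  finally show "(l2_norm M (\<lambda>x. f x + h x))\<^sup>2 \<le> (l2_norm M f + l2_norm M h)\<^sup>2" .
qed (simp add: l2_norm_nonneg)

lemma l2_norm_minus: "l2_norm M (\<lambda>x. - f x) = l2_norm M f"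
  by (simp add: l2_norm_def l2_inner_def)

lemma l2_dist_commute: "l2_dist M f h = l2_dist M h f"
  by (simp add: l2_dist_def norm_minus_commute)

lemma l2_dist_triangle:
  assumes "f \<in> L2 M" "g \<in> L2 M" "h \<in> L2 M"
  shows "l2_dist M f h \<le> l2_dist M f g + l2_dist M g h"
  using l2_norm_triangle[OF L2_diff[OF assms(1,2)] L2_diff[OF assms(2,3)]]
  by (simp add: l2_dist_eq_norm)

section \<open>Limits and completeness in mean square\<close>

lemma tendsto_l2_inner:
  assumes x: "\<And>n. x n \<in> L2 M" and y: "y \<in> L2 M" and t: "t \<in> L2 M"
    and lim: "(\<lambda>n. l2_dist M (x n) y) \<longlonglongrightarrow> 0"
  shows "(\<lambda>n. l2_inner M (x n) t) \<longlonglongrightarrow> l2_inner M y t"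
proof (rule LIM_zero_cancel, rule tendsto_rabs_zero_cancel, rule tendsto_sandwich)
  show "\<forall>\<^sub>F n in sequentially. 0 \<le> \<bar>l2_inner M (x n) t - l2_inner M y t\<bar>" by simp
  show "\<forall>\<^sub>F n in sequentially. \<bar>l2_inner M (x n) t - l2_inner M y t\<bar> \<le> l2_dist M (x n) y * l2_norm M t"
    using l2_Cauchy_Schwarz[OF L2_diff[OF x y] t] x y t
    by (simp add: l2_inner_diff_left l2_dist_eq_norm)
  show "(\<lambda>n. l2_dist M (x n) y * l2_norm M t) \<longlonglongrightarrow> 0"
    using tendsto_mult_left_zero[OF lim] by simp
qed simp

text \<open>Cauchy-Schwarz against the constant 1, which has norm 1 under a probability measure. It
  turns small mean square increments into summable mean increments.\<close>

lemma nn_integral_norm_le_l2_norm: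
  assumes "prob_space M" and f: "f \<in> L2 M"
  shows "(\<integral>\<^sup>+x. ennreal (norm (f x)) \<partial>M) \<le> ennreal (l2_norm M f)"
proof -
  interpret prob_space M by fact
  have one: "(\<lambda>x. 1 :: real) \<in> L2 M" by (simp add: L2_def)
  have nf: "(\<lambda>x. norm (f x)) \<in> L2 M"
    using L2D[OF f] by (auto simp: L2_def)
  have i: "integrable M (\<lambda>x. norm (f x))"
    using L2_mult_integrable[OF nf one] by simp
  have "(\<integral>x. norm (f x) \<partial>M) \<le> l2_norm M f"
    using l2_Cauchy_Schwarz[OF nf one]
    by (simp add: l2_norm_def l2_inner_def prob_space power2_norm_eq_inner[symmetric] power2_eq_square)
  then show ?thesis
    using nn_integral_eq_integral[OF i] by (simp add: ennreal_leI)
qed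

text \<open>Riesz-Fischer for functions instead of classes: a fast subsequence converges almost
  everywhere because its increments have summable means, and Fatou's lemma then gives mean square
  convergence of the whole sequence.\<close>

lemma L2_complete:
  fixes x :: "nat \<Rightarrow> 'a \<Rightarrow> 'b::euclidean_space"
  assumes M: "prob_space M" and x: "\<And>n. x n \<in> L2 M"
    and cauchy: "\<And>e. e > 0 \<Longrightarrow> \<exists>N. \<forall>m\<ge>N. \<forall>n\<ge>N. l2_dist M (x m) (x n) < e"
  obtains y where "y \<in> L2 M" "(\<lambda>n. l2_dist M (x n) y) \<longlonglongrightarrow> 0"
proof -
  interpret prob_space M by fact
  note L2D(1)[OF x, measurable]
  have "\<forall>k. \<exists>N. \<forall>m\<ge>N. \<forall>n\<ge>N. l2_dist M (x m) (x n) < (1/2) ^ k"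
    using cauchy by simp
  then obtain K where K: "\<And>k m n. m \<ge> K k \<Longrightarrow> n \<ge> K k \<Longrightarrow> l2_dist M (x m) (x n) < (1/2) ^ k"
    by metis
  \<comment> \<open>Summing all thresholds makes both \<open>r k\<close> and
    \<open>r (Suc k)\<close> at least \<open>K k\<close> without a monotone choice of
    \<open>K\<close>; the summand \<open>k\<close> sends \<open>r\<close> to infinity.\<close>
  define r where "r k = k + (\<Sum>i\<le>k. K i)" for k
  have "K k \<le> (\<Sum>i\<le>k. K i)" for k
    by (rule member_le_sum) auto
  then have rK: "r k \<ge> K k" "r (Suc k) \<ge> K k" for k
    unfolding r_def by (simp_all add: trans_le_add1 trans_le_add2 le_SucI)
  have rlim: "r k \<ge> k" for k by (simp add: r_def)
  define d where "d k z = norm (x (r (Suc k)) z - x (r k) z)" for k z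
  have dm[measurable]: "d k \<in> borel_measurable M" for k unfolding d_def by measurable
  have dint: "(\<integral>\<^sup>+z. ennreal (d k z) \<partial>M) \<le> ennreal ((1/2) ^ k)" for k
  proof -
    have "(\<integral>\<^sup>+z. ennreal (d k z) \<partial>M) \<le> ennreal (l2_norm M (\<lambda>z. x (r (Suc k)) z - x (r k) z))"
      unfolding d_def by (rule nn_integral_norm_le_l2_norm[OF M L2_diff[OF x x]])
    also have "\<dots> \<le> ennreal ((1/2) ^ k)"
      using K[OF rK(2) rK(1), of k] by (intro ennreal_leI) (simp add: l2_dist_eq_norm)
    finally show ?thesis .
  qed
  have "(\<integral>\<^sup>+z. (\<Sum>k. ennreal (d k z)) \<partial>M) = (\<Sum>k. \<integral>\<^sup>+z. ennreal (d k z) \<partial>M)"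
    by (rule nn_integral_suminf) measurable
  also have "\<dots> \<le> (\<Sum>k. ennreal ((1/2) ^ k))"
    by (intro suminf_le dint) auto
  also have "\<dots> < \<infinity>"
    by (subst suminf_ennreal2) (auto intro!: summable_geometric)
  finally have fin: "AE z in M. (\<Sum>k. ennreal (d k z)) \<noteq> \<infinity>"
    by (intro nn_integral_PInf_AE) auto
  have conv: "AE z in M. convergent (\<lambda>k. x (r k) z)"
    using fin
  proof eventually_elim
    case (elim z)
    then have "summable (\<lambda>k. d k z)"
      by (intro summable_suminf_not_top) (auto simp: d_def)
    then have "summable (\<lambda>k. x (r (Suc k)) z - x (r k) z)"
      unfolding d_def by (rule summable_norm_cancel)
    then have "convergent (\<lambda>n. \<Sum>k<n. x (r (Suc k)) z - x (r k) z)"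
      by (simp add: summable_iff_convergent)
    then have "convergent (\<lambda>n. x (r n) z - x (r 0) z)"
      unfolding sum_lessThan_telescope[of "\<lambda>n. x (r n) z"] .
    then have "convergent (\<lambda>n. x (r n) z - x (r 0) z + x (r 0) z)"
      by (intro convergent_add convergent_const)
    then show ?case by simp
  qed
  define y where "y z = lim (\<lambda>k. x (r k) z)" for z
  have ym[measurable]: "y \<in> borel_measurable M" unfolding y_def by measurable
  have lim: "AE z in M. (\<lambda>k. x (r k) z) \<longlonglongrightarrow> y z"
    using conv by eventually_elim (simp add: y_def convergent_LIMSEQ_iff)
  \<comment> \<open>The Cauchy bound between \<open>x n\<close> and \<open>x (r k)\<close> is passed
    to \<open>y\<close> by letting only \<open>k\<close> tend to infinity.\<close>
  have fatou: "(\<integral>\<^sup>+z. ennreal ((norm (x n z - y z))\<^sup>2) \<partial>M) \<le> ennreal (e\<^sup>2)"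
    if e: "e > 0" and N: "\<forall>m\<ge>N. \<forall>n\<ge>N. l2_dist M (x m) (x n) < e" and n: "n \<ge> N" for e N n
  proof -
    have "(\<integral>\<^sup>+z. ennreal ((norm (x n z - y z))\<^sup>2) \<partial>M)
        = (\<integral>\<^sup>+z. liminf (\<lambda>k. ennreal ((norm (x n z - x (r k) z))\<^sup>2)) \<partial>M)"
    proof (rule nn_integral_cong_AE, use lim in eventually_elim)
      case (elim z)
      then have "(\<lambda>k. ennreal ((norm (x n z - x (r k) z))\<^sup>2)) \<longlonglongrightarrow> ennreal ((norm (x n z - y z))\<^sup>2)"
        by (intro tendsto_ennrealI tendsto_intros)
      then show ?case using lim_imp_Liminf[of sequentially] by (metis sequentially_bot)
    qed
    also have "\<dots> \<le> liminf (\<lambda>k. \<integral>\<^sup>+z. ennreal ((norm (x n z - x (r k) z))\<^sup>2) \<partial>M)"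
      by (rule nn_integral_liminf) measurable
    also have "\<dots> \<le> ennreal (e\<^sup>2)"
    proof (rule Liminf_le[OF sequentially_bot], rule eventually_sequentiallyI[of N])
      fix k assume "k \<ge> N"
      then have "r k \<ge> N" using rlim[of k] by simp
      then have "l2_dist M (x n) (x (r k)) < e" using N n by auto
      then have "(l2_dist M (x n) (x (r k)))\<^sup>2 \<le> e\<^sup>2"
        by (intro power_mono) (auto simp: l2_dist_def)
      moreover have "(\<integral>\<^sup>+z. ennreal ((norm (x n z - x (r k) z))\<^sup>2) \<partial>M)
         = ennreal ((l2_dist M (x n) (x (r k)))\<^sup>2)"
        using L2D(2)[OF L2_diff[OF x x]]
        by (subst nn_integral_eq_integral) (auto simp: l2_dist_def)
      ultimately show "(\<integral>\<^sup>+z. ennreal ((norm (x n z - x (r k) z))\<^sup>2) \<partial>M) \<le> ennreal (e\<^sup>2)"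
        by (simp add: ennreal_leI)
    qed
    finally show ?thesis .
  qed
  have diffL2: "(\<lambda>z. x n z - y z) \<in> L2 M" and dist: "l2_dist M (x n) y \<le> e"
    if e: "e > 0" and N: "\<forall>m\<ge>N. \<forall>n\<ge>N. l2_dist M (x m) (x n) < e" and n: "n \<ge> N" for e N n
  proof -
    have "integrable M (\<lambda>z. (norm (x n z - y z))\<^sup>2)"
      using fatou[OF that] by (intro integrableI_bounded) (auto simp: le_less_trans)
    then show *: "(\<lambda>z. x n z - y z) \<in> L2 M" by (auto simp: L2_def)
    have "ennreal ((l2_dist M (x n) y)\<^sup>2) \<le> ennreal (e\<^sup>2)"
      using fatou[OF that] L2D(2)[OF *]
      by (subst (asm) nn_integral_eq_integral) (auto simp: l2_dist_def)
    then have "(l2_dist M (x n) y)\<^sup>2 \<le> e\<^sup>2" by simp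
    then show "l2_dist M (x n) y \<le> e" using e power2_le_imp_le[of _ e] by auto
  qed
  obtain N where N: "\<forall>m\<ge>N. \<forall>n\<ge>N. l2_dist M (x m) (x n) < 1" using cauchy[of 1] by auto
  have "y \<in> L2 M"
    using L2_diff[OF x[of N] diffL2[OF _ N order_refl]] by simp
  moreover have "(\<lambda>n. l2_dist M (x n) y) \<longlonglongrightarrow> 0"
  proof (rule LIMSEQ_I)
    fix e :: real assume "e > 0"
    then obtain N where N: "\<forall>m\<ge>N. \<forall>n\<ge>N. l2_dist M (x m) (x n) < e/2"
      using cauchy[of "e/2"] by auto
    have "norm (l2_dist M (x n) y - 0) < e" if "n \<ge> N" for n
      using dist[OF _ N that] \<open>e > 0\<close> by (auto simp: l2_dist_def)
    then show "\<exists>no. \<forall>n\<ge>no. norm (l2_dist M (x n) y - 0) < e" by blast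
  qed
  ultimately show ?thesis by (rule that)
qed

text \<open>
  Moving one step from the second index to the first one does not change the inner product of two
  residuals of the same parity, so that \<open>\<langle>x\<^sub>2\<^sub>m, x\<^sub>2\<^sub>n\<rangle> = \<parallel>x\<^sub>m\<^sub>+\<^sub>n\<parallel>\<^sup>2\<close>; as the norms decrease, the residuals
  of even index form a Cauchy sequence.
\<close>

lemma alternating_projections:
  fixes x :: "nat \<Rightarrow> 'a \<Rightarrow> 'b::euclidean_space" and U :: "nat \<Rightarrow> ('a \<Rightarrow> 'b) set"
  assumes M: "prob_space M" and x: "\<And>k. x k \<in> L2 M"
    and U: "\<And>k. U k \<subseteq> L2 M" and per: "\<And>k. U (k + 2) = U k"
    and step: "\<And>k. (\<lambda>z. x k z - x (Suc k) z) \<in> U (Suc k)"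
    and orth: "\<And>k t. t \<in> U k \<Longrightarrow> l2_inner M (x k) t = 0"
  obtains y where "y \<in> L2 M" "(\<lambda>m. l2_dist M (x (2 * m)) y) \<longlonglongrightarrow> 0"
    "\<And>k t. t \<in> U k \<Longrightarrow> l2_inner M y t = 0"
proof -
  define c where "c k = l2_inner M (x k) (x k)" for k
  have per': "U (k + 2 * n) = U k" for k n
  proof (induction n)
    case (Suc n)
    then show ?case using per[of "k + 2 * n"] by (simp add: add.assoc)
  qed simp
  have parity: "U j = U k" if "even (j + k)" for j k
  proof (cases "j \<le> k")
    case True
    then obtain i where "k = j + i" using le_Suc_ex by blast
    moreover then have "even i" using that by auto
    ultimately show ?thesis using per' by (auto elim!: evenE)
  next
    case False
    then obtain i where "j = k + i" using le_Suc_ex by (metis nat_le_linear)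
    moreover then have "even i" using that by auto
    ultimately show ?thesis using per' by (auto elim!: evenE)
  qed
  have stepL2: "(\<lambda>z. x k z - x (Suc k) z) \<in> L2 M" for k
    using step U by blast
  \<comment> \<open>The increment lies in \<open>U (Suc k)\<close>, which is \<open>U j\<close> when
    the parities agree, and \<open>x j\<close> is orthogonal to that space.\<close>
  have eq: "l2_inner M (x j) (x (Suc k)) = l2_inner M (x j) (x k)" if "even (j + Suc k)" for j k
  proof -
    have "l2_inner M (x j) (\<lambda>z. x k z - x (Suc k) z) = 0"
      using orth[of _ j] step[of k] parity[OF that] by blast
    then show ?thesis using x by (simp add: l2_inner_diff_right)
  qed
  \<comment> \<open>Both sides equal \<open><x j, x k>\<close>, by \<open>eq\<close> applied to
    either factor.\<close>
  have move: "l2_inner M (x j) (x (Suc k)) = l2_inner M (x (Suc j)) (x k)" if "even (j + Suc k)" for j k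
    using eq[OF that] eq[of k j] that
    by (simp add: l2_inner_commute[of M "x j" "x k"] l2_inner_commute[of M "x (Suc j)" "x k"] add.commute)
  have shift: "l2_inner M (x j) (x (k + i)) = l2_inner M (x (j + i)) (x k)" if "even (j + k + i)" for i j k
    using that
  proof (induction i arbitrary: j)
    case (Suc i)
    have "l2_inner M (x j) (x (Suc (k + i))) = l2_inner M (x (Suc j)) (x (k + i))"
      using Suc.prems by (intro move) (simp add: add.assoc)
    also have "\<dots> = l2_inner M (x (Suc j + i)) (x k)"
      by (rule Suc.IH) (use Suc.prems in simp)
    finally show ?case by simp
  qed simp
  \<comment> \<open>Shifting by half the gap between \<open>2 * m\<close> and \<open>2 * n\<close>
    brings both indices to the midpoint \<open>m + n\<close>.\<close>
  have even_inner: "l2_inner M (x (2 * m)) (x (2 * n)) = c (m + n)" for m n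
  proof (cases "m \<le> n")
    case True
    then have "l2_inner M (x (2 * m)) (x ((m + n) + (n - m))) = l2_inner M (x (2 * m + (n - m))) (x (m + n))"
      by (intro shift) (simp add: algebra_simps)
    then show ?thesis using True by (simp add: c_def mult_2)
  next
    case False
    then have "l2_inner M (x (2 * n)) (x ((m + n) + (m - n))) = l2_inner M (x (2 * n + (m - n))) (x (m + n))"
      by (intro shift) (simp add: algebra_simps)
    then show ?thesis using False by (simp add: c_def mult_2 l2_inner_commute add.commute[of n m])
  qed
  have pyth: "c k = c (Suc k) + (l2_dist M (x k) (x (Suc k)))\<^sup>2" for k
    using eq[of "Suc k" k] x
    by (simp add: l2_dist_squared c_def l2_inner_commute[of M "x k" "x (Suc k)"])
  have "c (Suc k) \<le> c k" for k using pyth[of k] by simp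
  then have "decseq c" by (rule decseq_SucI)
  moreover have "0 \<le> c k" for k by (simp add: c_def l2_inner_self_nonneg)
  ultimately obtain L where L: "c \<longlonglongrightarrow> L"
    using decseq_convergent[of c 0] by blast
  have dist2: "(l2_dist M (x (2 * m)) (x (2 * n)))\<^sup>2 = c (2 * m) - 2 * c (m + n) + c (2 * n)" for m n
    unfolding l2_dist_squared[OF x x] even_inner by (simp only: mult_2)
  have cauchy: "\<exists>N. \<forall>m\<ge>N. \<forall>n\<ge>N. l2_dist M (x (2 * m)) (x (2 * n)) < e" if "e > 0" for e
  proof -
    \<comment> \<open>The weights 1, -2, 1 in \<open>dist2\<close> sum to zero, so the limit
      \<open>L\<close> cancels and four errors below \<open>e^2 / 4\<close> remain.\<close>
    obtain N where N: "\<And>n. n \<ge> N \<Longrightarrow> \<bar>c n - L\<bar> < e\<^sup>2 / 4"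
      using LIMSEQ_D[OF L, of "e\<^sup>2 / 4"] \<open>e > 0\<close> by auto
    have "l2_dist M (x (2 * m)) (x (2 * n)) < e" if "m \<ge> N" "n \<ge> N" for m n
    proof (rule power2_less_imp_less)
      show "(l2_dist M (x (2 * m)) (x (2 * n)))\<^sup>2 < e\<^sup>2"
        unfolding dist2 using N[of "2 * m"] N[of "2 * n"] N[of "m + n"] that by linarith
    qed (use \<open>e > 0\<close> in simp)
    then show ?thesis by blast
  qed
  obtain y where y: "y \<in> L2 M" and lim: "(\<lambda>m. l2_dist M (x (2 * m)) y) \<longlonglongrightarrow> 0"
    using L2_complete[OF M x cauchy] .
  have even_orth: "l2_inner M y t = 0" if t: "t \<in> U 0" for t
  proof -
    have "(\<lambda>m. l2_inner M (x (2 * m)) t) \<longlonglongrightarrow> l2_inner M y t"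
      using t U by (intro tendsto_l2_inner x y lim) auto
    moreover have "l2_inner M (x (2 * m)) t = 0" for m
      using t per'[of 0 m] by (intro orth) simp
    ultimately show ?thesis by (simp add: LIMSEQ_const_iff)
  qed
  \<comment> \<open>Only the even residuals are known to converge to \<open>y\<close>. The squared
    distance to the next residual is \<open>c k - c (Suc k)\<close>, which tends to zero, so the odd
    residuals share the limit.\<close>
  have odd_orth: "l2_inner M y t = 0" if t: "t \<in> U 1" for t
  proof -
    have tL: "t \<in> L2 M" using t U by auto
    have drop: "(l2_dist M (x k) (x (Suc k)))\<^sup>2 = c k - c (Suc k)" for k
      using pyth[of k] by simp
    have "(\<lambda>k. c k - c (Suc k)) \<longlonglongrightarrow> L - L"
      by (intro tendsto_diff L LIMSEQ_Suc)
    then have "(\<lambda>k. sqrt ((l2_dist M (x k) (x (Suc k)))\<^sup>2)) \<longlonglongrightarrow> sqrt 0"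
      by (intro tendsto_real_sqrt) (simp add: drop)
    then have "(\<lambda>k. l2_dist M (x k) (x (Suc k))) \<longlonglongrightarrow> 0"
      by (simp add: l2_dist_def)
    then have "(\<lambda>m. l2_dist M (x (2 * m)) (x (Suc (2 * m)))) \<longlonglongrightarrow> 0"
      by (rule LIMSEQ_subseq_LIMSEQ[unfolded comp_def]) (simp add: strict_mono_def)
    then have "(\<lambda>m. l2_dist M (x (2 * m)) (x (Suc (2 * m))) + l2_dist M (x (2 * m)) y) \<longlonglongrightarrow> 0 + 0"
      by (intro tendsto_add lim)
    then have bound: "(\<lambda>m. l2_dist M (x (2 * m)) (x (Suc (2 * m))) + l2_dist M (x (2 * m)) y) \<longlonglongrightarrow> 0"
      by simp
    have lim': "(\<lambda>m. l2_dist M (x (Suc (2 * m))) y) \<longlonglongrightarrow> 0"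
    proof (rule tendsto_sandwich[OF _ _ tendsto_const bound])
      show "\<forall>\<^sub>F m in sequentially. l2_dist M (x (Suc (2 * m))) y
          \<le> l2_dist M (x (2 * m)) (x (Suc (2 * m))) + l2_dist M (x (2 * m)) y"
        using l2_dist_triangle[OF x x y]
        by (intro always_eventually allI) (metis l2_dist_commute)
    qed (simp_all add: l2_dist_def)
    have "(\<lambda>m. l2_inner M (x (Suc (2 * m))) t) \<longlonglongrightarrow> l2_inner M y t"
      by (intro tendsto_l2_inner x y lim' tL)
    moreover have "l2_inner M (x (Suc (2 * m))) t = 0" for m
      using t per'[of 1 m] by (intro orth) simp
    ultimately show ?thesis by (simp add: LIMSEQ_const_iff)
  qed
  have "l2_inner M y t = 0" if "t \<in> U k" for k t
  proof (cases "even k")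
    case True
    then have "U k = U 0" by (intro parity) auto
    then show ?thesis using that even_orth by blast
  next
    case False
    then have "U k = U 1" by (intro parity) auto
    then show ?thesis using that odd_orth by blast
  qed
  then show ?thesis using that y lim by blast
qed

section \<open>Projections by conditional expectations\<close>

lemma borel_measurable_vecI:
  fixes f :: "'a \<Rightarrow> 'b::euclidean_space ^ 'n"
  assumes "\<And>i. (\<lambda>x. f x $ i) \<in> borel_measurable M"
  shows "f \<in> borel_measurable M"
  using assms by (subst borel_measurable_euclidean_space) (auto simp: Basis_vec_def inner_axis)

lemma borel_measurable_matI:
  fixes A :: "'a \<Rightarrow> real ^ 'n ^ 'm"
  assumes "\<And>i j. (\<lambda>x. A x $ i $ j) \<in> borel_measurable M"
  shows "A \<in> borel_measurable M"
  by (intro borel_measurable_vecI assms)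

lemma borel_measurable_mat_nth:
  fixes A :: "'a \<Rightarrow> real ^ 'n ^ 'm"
  assumes "A \<in> borel_measurable M"
  shows "(\<lambda>x. A x $ i $ j) \<in> borel_measurable M"
  by (intro borel_measurable_vec_nth assms)

lemma borel_measurable_matrix_mult:
  fixes A :: "'a \<Rightarrow> real ^ 'n ^ 'm" and B :: "'a \<Rightarrow> real ^ 'k ^ 'n"
  assumes "A \<in> borel_measurable M" "B \<in> borel_measurable M"
  shows "(\<lambda>x. A x ** B x) \<in> borel_measurable M"
  using borel_measurable_mat_nth[OF assms(1)] borel_measurable_mat_nth[OF assms(2)]
  by (intro borel_measurable_matI) (simp add: matrix_matrix_mult_def)

lemma borel_measurable_matrix_vector_mult:
  fixes A :: "'a \<Rightarrow> real ^ 'n ^ 'm" and f :: "'a \<Rightarrow> real ^ 'n"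
  assumes "A \<in> borel_measurable M" "f \<in> borel_measurable M"
  shows "(\<lambda>x. A x *v f x) \<in> borel_measurable M"
  using borel_measurable_mat_nth[OF assms(1)] borel_measurable_vec_nth[OF assms(2)]
  by (intro borel_measurable_vecI) (simp add: matrix_vector_mult_def)

lemma borel_measurable_transpose:
  fixes A :: "'a \<Rightarrow> real ^ 'n ^ 'm"
  assumes "A \<in> borel_measurable M"
  shows "(\<lambda>x. transpose (A x)) \<in> borel_measurable M"
  using borel_measurable_mat_nth[OF assms]
  by (intro borel_measurable_matI) (simp add: transpose_def)

lemma borel_measurable_outer:
  assumes "f \<in> borel_measurable M" "h \<in> borel_measurable M"
  shows "(\<lambda>x. outer (f x) (h x)) \<in> borel_measurable M"
  using borel_measurable_vec_nth[OF assms(1)] borel_measurable_vec_nth[OF assms(2)]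
  by (intro borel_measurable_matI) (simp add: outer_def)

lemma borel_measurable_cond_exp_vec: "cond_exp_vec M F f \<in> borel_measurable F"
  by (rule borel_measurable_vecI) (simp add: cond_exp_vec_def)

lemma borel_measurable_cond_exp_mat: "cond_exp_mat M F f \<in> borel_measurable F"
  by (rule borel_measurable_matI) (simp add: cond_exp_mat_def)

lemma borel_measurable_cond_var: "cond_var M F f \<in> borel_measurable F"
proof -
  have "(\<lambda>z. cond_exp_mat M F (\<lambda>x. outer (f x) (f x)) z
       - outer (cond_exp_vec M F f z) (cond_exp_vec M F f z)) \<in> borel_measurable F"
    by (intro borel_measurable_diff borel_measurable_outer borel_measurable_cond_exp_vec
        borel_measurable_cond_exp_mat)
  then show ?thesis by (simp add: cond_var_def[abs_def])
qed

text \<open>Rewrites the products under the conditional expectations of the iteration. The vector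
  \<open>A *v u\<close> can be shown square integrable, while the matrix \<open>A\<close> alone need
  not be.\<close>

lemma matrix_mult_outer: "A ** outer u v = outer (A *v u) v"
  by (simp add: vec_eq_iff matrix_matrix_mult_def matrix_vector_mult_def outer_def
      sum_distrib_right mult.assoc)

lemma integrable_bounded_mult:
  fixes b X :: "'a \<Rightarrow> real"
  assumes "integrable M X" "b \<in> borel_measurable M" "\<And>z. \<bar>b z\<bar> \<le> K"
  shows "integrable M (\<lambda>z. b z * X z)"
proof (rule Bochner_Integration.integrable_bound)
  show "integrable M (\<lambda>z. K * X z)" using assms(1) by auto
  show "(\<lambda>z. b z * X z) \<in> borel_measurable M" using assms by auto
  have "\<bar>b z * X z\<bar> \<le> \<bar>K * X z\<bar>" for z
    using assms(3)[of z] by (auto simp: abs_mult intro!: mult_right_mono)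
  then show "AE z in M. norm (b z * X z) \<le> norm (K * X z)" by auto
qed

lemma linear_term_zero:
  fixes q c :: real
  assumes "\<And>t. 0 \<le> q - 2 * t * c"
  shows "c = 0"
proof (rule ccontr)
  assume "c \<noteq> 0"
  \<comment> \<open>At this \<open>t\<close> the assumed bound reads
    \<open>0 \<le> - 1\<close>.\<close>
  then show False using assms[of "(q + 1) / (2 * c)"] by simp
qed

text \<open>Large values are sent to zero instead of being clipped. A truncated coefficient is thus
  exact or zero, so equations for the original persist wherever the truncation is nonzero, and
  truncated integrands are dominated by the original ones.\<close>

definition truncate :: "real \<Rightarrow> 'a::real_normed_vector \<Rightarrow> 'a" where
  "truncate K x = (if norm x \<le> K then x else 0)"

lemma norm_truncate: "0 \<le> K \<Longrightarrow> norm (truncate K x) \<le> K"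
  by (simp add: truncate_def)

lemma borel_measurable_truncate:
  fixes f :: "'a \<Rightarrow> 'b::euclidean_space"
  assumes [measurable]: "f \<in> borel_measurable M"
  shows "(\<lambda>x. truncate K (f x)) \<in> borel_measurable M"
  unfolding truncate_def by measurable

lemma truncate_eventually: "\<forall>\<^sub>F n in sequentially. truncate (real n) x = x"
  using eventually_ge_at_top[of "nat \<lceil>norm x\<rceil>"]
  by eventually_elim (auto simp: truncate_def nat_le_iff ceiling_le_iff)

lemma mat_nth_le_norm: "\<bar>A $ i $ j\<bar> \<le> norm (A :: real ^ 'n ^ 'm)"
  using component_le_norm_cart[of "A $ i" j] Finite_Cartesian_Product.norm_nth_le[of A i] by linarith

lemma H_space_diff:
  assumes "s \<in> H_space M F h" "t \<in> H_space M F h"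
  shows "(\<lambda>z. s z - t z) \<in> H_space M F h"
proof -
  obtain a b where a: "a \<in> borel_measurable F" "AE z in M. s z = a z *v h z"
    and b: "b \<in> borel_measurable F" "AE z in M. t z = b z *v h z"
    using assms by (auto simp: H_space_def)
  have "AE z in M. s z - t z = (a z - b z) *v h z"
    using a(2) b(2) by eventually_elim (simp add: matrix_vector_mult_diff_rdistrib)
  moreover have "(\<lambda>z. a z - b z) \<in> borel_measurable F" using a b by auto
  ultimately show ?thesis using assms by (auto simp: H_space_def intro: L2_diff)
qed

section \<open>Conditional second moments and the projection on \<open>H_space\<close>\<close>

context finite_measure_subalgebra
begin

lemma L2_const: "(\<lambda>_. c) \<in> L2 M"
  by (simp add: L2_def)

lemma integral_bounded_mult_cond_exp:
  assumes X: "integrable M X" and b: "b \<in> borel_measurable F" and bd: "\<And>z. \<bar>b z\<bar> \<le> K"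
  shows "integrable M (\<lambda>z. b z * X z)" "integrable M (\<lambda>z. b z * real_cond_exp M F X z)"
    "(\<integral>z. b z * X z \<partial>M) = (\<integral>z. b z * real_cond_exp M F X z \<partial>M)"
proof -
  show i: "integrable M (\<lambda>z. b z * X z)"
    by (rule integrable_bounded_mult[OF X measurable_from_subalg[OF subalg b] bd])
  show "integrable M (\<lambda>z. b z * real_cond_exp M F X z)"
    by (rule real_cond_exp_intg(1)[OF i b borel_measurable_integrable[OF X]])
  show "(\<integral>z. b z * X z \<partial>M) = (\<integral>z. b z * real_cond_exp M F X z \<partial>M)"
    by (rule real_cond_exp_intg(2)[OF i b borel_measurable_integrable[OF X], symmetric])
qed

text \<open>
  The conditional mean of \<open>(s\<^sub>k - u \<bullet> h)\<^sup>2\<close> is nonnegative for all \<open>u\<close> of a countable dense set, hence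
  for all \<open>u\<close>; along the null space of \<open>E[h h' | F]\<close> it is affine in \<open>u\<close>.
\<close>

lemma null_space_cond_exp:
  fixes h :: "'a \<Rightarrow> real ^ 'm" and s :: "'a \<Rightarrow> real ^ 'd"
  assumes h: "h \<in> L2 M" and s: "s \<in> L2 M"
  shows "AE z in M. \<forall>u. cond_exp_mat M F (\<lambda>x. outer (h x) (h x)) z *v u = 0
     \<longrightarrow> cond_exp_mat M F (\<lambda>x. outer (s x) (h x)) z *v u = 0"
proof -
  let ?V = "cond_exp_mat M F (\<lambda>x. outer (h x) (h x))"
  let ?C = "cond_exp_mat M F (\<lambda>x. outer (s x) (h x))"
  let ?q = "\<lambda>k. real_cond_exp M F (\<lambda>x. s x $ k * s x $ k)"
  have hh: "integrable M (\<lambda>x. h x $ i * h x $ j)" for i j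
    by (intro L2_mult_integrable L2_nth h)
  have sh: "integrable M (\<lambda>x. s x $ i * h x $ j)" for i j
    by (intro L2_mult_integrable L2_nth h s)
  have ss: "integrable M (\<lambda>x. s x $ i * s x $ i)" for i
    by (intro L2_mult_integrable L2_nth s)
  have pos: "AE z in M. 0 \<le> ?q k z - 2 * ((?C z *v u) $ k) + u \<bullet> (?V z *v u)" for k and u :: "real ^ 'm"
  proof -
    let ?Y = "\<lambda>x. \<Sum>l\<in>UNIV. (2 * u $ l) * (s x $ k * h x $ l)"
    let ?Z = "\<lambda>x. \<Sum>i\<in>UNIV. \<Sum>j\<in>UNIV. (u $ i * u $ j) * (h x $ i * h x $ j)"
    have intY: "integrable M ?Y" using sh by auto
    have intZi: "integrable M (\<lambda>x. \<Sum>j\<in>UNIV. (u $ i * u $ j) * (h x $ i * h x $ j))" for i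
      using hh by auto
    have intZ: "integrable M ?Z" using hh by auto
    have sq: "s x $ k * s x $ k - ?Y x + ?Z x = (s x $ k - u \<bullet> h x)\<^sup>2" for x
    proof -
      have "?Y x = 2 * (s x $ k * (u \<bullet> h x))"
        by (simp add: inner_vec_def sum_distrib_left algebra_simps)
      moreover have "?Z x = (u \<bullet> h x) * (u \<bullet> h x)"
        unfolding inner_vec_def by (subst sum_product) (simp add: algebra_simps)
      ultimately show ?thesis by (simp add: power2_eq_square algebra_simps)
    qed
    have "AE z in M. 0 \<le> real_cond_exp M F (\<lambda>x. s x $ k * s x $ k - ?Y x + ?Z x) z"
    proof (rule real_cond_exp_pos)
      show "AE x in M. 0 \<le> s x $ k * s x $ k - ?Y x + ?Z x" unfolding sq by simp
      show "(\<lambda>x. s x $ k * s x $ k - ?Y x + ?Z x) \<in> borel_measurable M"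
        by (intro borel_measurable_integrable Bochner_Integration.integrable_add
            Bochner_Integration.integrable_diff ss intY intZ)
    qed
    moreover have "AE z in M. real_cond_exp M F (\<lambda>x. s x $ k * s x $ k - ?Y x + ?Z x) z
        = real_cond_exp M F (\<lambda>x. s x $ k * s x $ k - ?Y x) z + real_cond_exp M F ?Z z"
      by (rule real_cond_exp_add[OF Bochner_Integration.integrable_diff[OF ss intY] intZ])
    moreover have "AE z in M. real_cond_exp M F (\<lambda>x. s x $ k * s x $ k - ?Y x) z
        = ?q k z - real_cond_exp M F ?Y z"
      by (rule real_cond_exp_diff[OF ss intY])
    moreover have "AE z in M. real_cond_exp M F ?Y z
        = (\<Sum>l\<in>UNIV. real_cond_exp M F (\<lambda>x. (2 * u $ l) * (s x $ k * h x $ l)) z)"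
      by (rule real_cond_exp_sum) (use sh in auto)
    moreover have "AE z in M. \<forall>l\<in>UNIV. real_cond_exp M F (\<lambda>x. (2 * u $ l) * (s x $ k * h x $ l)) z
        = (2 * u $ l) * real_cond_exp M F (\<lambda>x. s x $ k * h x $ l) z"
      by (intro AE_finite_allI real_cond_exp_cmult sh) simp
    moreover have "AE z in M. real_cond_exp M F ?Z z
        = (\<Sum>i\<in>UNIV. real_cond_exp M F (\<lambda>x. \<Sum>j\<in>UNIV. (u $ i * u $ j) * (h x $ i * h x $ j)) z)"
      by (rule real_cond_exp_sum[OF intZi])
    moreover have "AE z in M. \<forall>i\<in>UNIV.
          real_cond_exp M F (\<lambda>x. \<Sum>j\<in>UNIV. (u $ i * u $ j) * (h x $ i * h x $ j)) z
        = (\<Sum>j\<in>UNIV. real_cond_exp M F (\<lambda>x. (u $ i * u $ j) * (h x $ i * h x $ j)) z)"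
      by (intro AE_finite_allI real_cond_exp_sum) (use hh in auto)
    moreover have "AE z in M. \<forall>i\<in>UNIV. \<forall>j\<in>UNIV.
          real_cond_exp M F (\<lambda>x. (u $ i * u $ j) * (h x $ i * h x $ j)) z
        = (u $ i * u $ j) * real_cond_exp M F (\<lambda>x. h x $ i * h x $ j) z"
      by (intro AE_finite_allI real_cond_exp_cmult hh) simp_all
    ultimately show ?thesis
    proof eventually_elim
      case (elim z)
      have "(\<Sum>l\<in>UNIV. (2 * u $ l) * real_cond_exp M F (\<lambda>x. s x $ k * h x $ l) z) = 2 * ((?C z *v u) $ k)"
        by (simp add: matrix_vector_mult_def cond_exp_mat_def outer_def sum_distrib_left algebra_simps)
      moreover have "(\<Sum>i\<in>UNIV. \<Sum>j\<in>UNIV. (u $ i * u $ j) * real_cond_exp M F (\<lambda>x. h x $ i * h x $ j) z)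
          = u \<bullet> (?V z *v u)"
        by (simp add: matrix_vector_mult_def cond_exp_mat_def outer_def inner_vec_def
            sum_distrib_left algebra_simps)
      ultimately show ?case using elim by simp
    qed
  qed
  \<comment> \<open>The exceptional null set in \<open>pos\<close> depends on \<open>u\<close>. A
    common one is needed because the vectors \<open>u\<close> of interest are later built from the
    matrices at \<open>z\<close> and so vary with \<open>z\<close>.\<close>
  obtain D :: "(real ^ 'm) set" where D: "countable D" "\<And>X. open X \<Longrightarrow> X \<noteq> {} \<Longrightarrow> \<exists>d\<in>D. d \<in> X"
    by (rule countable_dense_setE) blast
  have "AE z in M. \<forall>u\<in>D. \<forall>k\<in>UNIV. 0 \<le> ?q k z - 2 * ((?C z *v u) $ k) + u \<bullet> (?V z *v u)"
    by (subst AE_ball_countable[OF D(1)]) (intro ballI AE_finite_allI pos finite)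
  then show ?thesis
  proof eventually_elim
    case (elim z)
    have all: "0 \<le> ?q k z - 2 * ((?C z *v u) $ k) + u \<bullet> (?V z *v u)" for u k
    proof (rule ccontr)
      let ?f = "\<lambda>u. ?q k z - 2 * ((?C z *v u) $ k) + u \<bullet> (?V z *v u)"
      assume neg: "\<not> 0 \<le> ?f u"
      have "continuous_on UNIV ?f"
        by (intro continuous_intros linear_continuous_on matrix_vector_mul_bounded_linear)
      then have "open {u. ?f u < 0}"
        by (intro open_Collect_less continuous_on_const)
      moreover have "u \<in> {u. ?f u < 0}" using neg by simp
      ultimately obtain d where "d \<in> D" "?f d < 0" using D(2)[of "{u. ?f u < 0}"] by blast
      then show False using elim[rule_format, OF \<open>d \<in> D\<close> UNIV_I, of k] by simp
    qed
    show ?case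
    proof (intro allI impI)
      fix u assume u: "?V z *v u = 0"
      have "(?C z *v u) $ k = 0" for k
      proof (rule linear_term_zero)
        fix t :: real
        show "0 \<le> ?q k z - 2 * t * ((?C z *v u) $ k)"
          using all[of k "t *\<^sub>R u"] u by (simp add: matrix_vector_mult_scaleR algebra_simps)
      qed
      then show "?C z *v u = 0" by (simp add: vec_eq_iff)
    qed
  qed
qed

text \<open>Turns the coefficient formula into the normal equation \<open>a V = C\<close>. By
  \<open>V G V = V\<close> every vector \<open>v - G V v\<close> lies in the null space of
  \<open>V\<close>, hence in that of \<open>C\<close>, so \<open>C = C G V\<close>.\<close>

lemma cond_exp_mat_generalized_inverse:
  fixes h :: "'a \<Rightarrow> real ^ 'm" and s :: "'a \<Rightarrow> real ^ 'd"
  assumes h: "h \<in> L2 M" and s: "s \<in> L2 M" and G: "generalized_inverse G"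
    and W: "AE z in M. W z = G (cond_exp_mat M F (\<lambda>x. outer (h x) (h x)) z)"
    and a: "AE z in M. a z = cond_exp_mat M F (\<lambda>x. outer (s x) (h x)) z ** W z"
  shows "AE z in M. a z ** cond_exp_mat M F (\<lambda>x. outer (h x) (h x)) z
     = cond_exp_mat M F (\<lambda>x. outer (s x) (h x)) z"
  using null_space_cond_exp[OF h s] W a
proof eventually_elim
  case (elim z)
  let ?V = "cond_exp_mat M F (\<lambda>x. outer (h x) (h x)) z"
  let ?C = "cond_exp_mat M F (\<lambda>x. outer (s x) (h x)) z"
  have gi: "?V ** G ?V ** ?V = ?V" using G by (simp add: generalized_inverse_def)
  have "?C *v (v - (G ?V ** ?V) *v v) = 0" for v
  proof -
    have "?V *v (v - (G ?V ** ?V) *v v) = 0"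
      by (simp add: matrix_vector_mult_diff_distrib matrix_vector_mul_assoc matrix_mul_assoc gi)
    then show ?thesis using elim(1) by blast
  qed
  then have "?C *v v = (?C ** G ?V ** ?V) *v v" for v
    by (simp add: matrix_vector_mult_diff_distrib matrix_vector_mul_assoc matrix_mul_assoc)
  then have "?C = ?C ** G ?V ** ?V" by (subst matrix_eq) blast
  then show ?case using elim by simp
qed

text \<open>With bounded coefficients all products are integrable and the factors measurable for
  \<open>F\<close> pass through the conditional expectation. The normal equation is asked for only
  where \<open>b\<close> is nonzero, which is where a truncated \<open>c\<close> can satisfy
  it.\<close>

lemma truncated_orthogonal:
  fixes h :: "'a \<Rightarrow> real ^ 'm" and s :: "'a \<Rightarrow> real ^ 'd"
  assumes h: "h \<in> L2 M" and s: "s \<in> L2 M"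
    and c: "c \<in> borel_measurable F" "\<And>z. norm (c z) \<le> K"
    and b: "b \<in> borel_measurable F" "\<And>z. norm (b z) \<le> L"
    and eq: "AE z in M. b z \<noteq> 0 \<longrightarrow> c z ** cond_exp_mat M F (\<lambda>x. outer (h x) (h x)) z
         = cond_exp_mat M F (\<lambda>x. outer (s x) (h x)) z"
  shows "(\<integral>z. (s z - c z *v h z) \<bullet> (b z *v h z) \<partial>M) = 0"
proof -
  let ?V = "cond_exp_mat M F (\<lambda>x. outer (h x) (h x))"
  let ?C = "cond_exp_mat M F (\<lambda>x. outer (s x) (h x))"
  have hh: "integrable M (\<lambda>x. h x $ i * h x $ j)" for i j
    by (intro L2_mult_integrable L2_nth h)
  have sh: "integrable M (\<lambda>x. s x $ i * h x $ j)" for i j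
    by (intro L2_mult_integrable L2_nth h s)
  have b': "(\<lambda>z. b z $ k $ l) \<in> borel_measurable F" "\<bar>b z $ k $ l\<bar> \<le> L" for z k l
    using b borel_measurable_mat_nth mat_nth_le_norm order_trans by blast+
  have c': "(\<lambda>z. c z $ k $ l) \<in> borel_measurable F" "\<bar>c z $ k $ l\<bar> \<le> K" for z k l
    using c borel_measurable_mat_nth mat_nth_le_norm order_trans by blast+
  have L: "L \<ge> 0" using b(2) norm_ge_zero order_trans by blast
  have bc: "(\<lambda>z. b z $ k $ l * c z $ k $ j) \<in> borel_measurable F"
     "\<bar>b z $ k $ l * c z $ k $ j\<bar> \<le> L * K" for z k l j
    using b' c' L by (auto simp: abs_mult intro!: mult_mono)
  note I1 = integral_bounded_mult_cond_exp[OF sh b']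
  note I2 = integral_bounded_mult_cond_exp[OF hh bc]
  let ?P = "\<lambda>k l z. b z $ k $ l * (s z $ k * h z $ l)
      - (\<Sum>j\<in>UNIV. (b z $ k $ l * c z $ k $ j) * (h z $ j * h z $ l))"
  have P: "integrable M (?P k l)" "(\<integral>z. ?P k l z \<partial>M) = 0" for k l
  proof -
    show "integrable M (?P k l)" using I1(1) I2(1)
      by (intro Bochner_Integration.integrable_diff Bochner_Integration.integrable_sum)
    have "(\<integral>z. ?P k l z \<partial>M) = (\<integral>z. b z $ k $ l * real_cond_exp M F (\<lambda>x. s x $ k * h x $ l) z
      - (\<Sum>j\<in>UNIV. (b z $ k $ l * c z $ k $ j) * real_cond_exp M F (\<lambda>x. h x $ j * h x $ l) z) \<partial>M)"
      using I1 I2 by (simp add: Bochner_Integration.integral_diff Bochner_Integration.integral_sum)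
    also have "\<dots> = (\<integral>z. 0 \<partial>M)"
    proof (rule integral_cong_AE)
      show "AE z in M. b z $ k $ l * real_cond_exp M F (\<lambda>x. s x $ k * h x $ l) z
        - (\<Sum>j\<in>UNIV. (b z $ k $ l * c z $ k $ j) * real_cond_exp M F (\<lambda>x. h x $ j * h x $ l) z) = 0"
        using eq
      proof eventually_elim
        case (elim z)
        show ?case
        proof (cases "b z = 0")
          case False
          with elim have "(c z ** ?V z) $ k $ l = ?C z $ k $ l" by simp
          then have "real_cond_exp M F (\<lambda>x. s x $ k * h x $ l) z
              = (\<Sum>j\<in>UNIV. c z $ k $ j * real_cond_exp M F (\<lambda>x. h x $ j * h x $ l) z)"
            by (simp add: matrix_matrix_mult_def cond_exp_mat_def outer_def)
          then show ?thesis by (simp add: sum_distrib_left mult.assoc)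
        qed simp
      qed
    qed (use I1(2) I2(2) in \<open>auto intro!: borel_measurable_diff borel_measurable_sum borel_measurable_integrable\<close>)
    finally show "(\<integral>z. ?P k l z \<partial>M) = 0" by simp
  qed
  have "(s z - c z *v h z) \<bullet> (b z *v h z) = (\<Sum>k\<in>UNIV. \<Sum>l\<in>UNIV. ?P k l z)" for z
  proof -
    have "(s z - c z *v h z) $ k * (b z *v h z) $ k = (\<Sum>l\<in>UNIV. ?P k l z)" for k
    proof -
      have "(s z - c z *v h z) $ k * (b z *v h z) $ k
          = (\<Sum>l\<in>UNIV. (s z $ k - (\<Sum>j\<in>UNIV. c z $ k $ j * h z $ j)) * (b z $ k $ l * h z $ l))"
        by (simp add: matrix_vector_mult_def sum_distrib_left)
      also have "\<dots> = (\<Sum>l\<in>UNIV. ?P k l z)"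
        by (intro sum.cong refl)
          (simp add: left_diff_distrib right_diff_distrib sum_distrib_right sum_distrib_left mult_ac)
      finally show ?thesis .
    qed
    then show ?thesis by (simp add: inner_vec_def)
  qed
  moreover have "(\<integral>z. (\<Sum>k\<in>UNIV. \<Sum>l\<in>UNIV. ?P k l z) \<partial>M) = 0"
    using P by (simp add: Bochner_Integration.integral_sum Bochner_Integration.integrable_sum)
  ultimately show ?thesis by simp
qed

lemma L2_bounded_matrix_mult:
  fixes h :: "'a \<Rightarrow> real ^ 'm" and c :: "'a \<Rightarrow> real ^ 'm ^ 'd"
  assumes h: "h \<in> L2 M" and c: "c \<in> borel_measurable M" "\<And>z. norm (c z) \<le> K"
  shows "(\<lambda>z. c z *v h z) \<in> L2 M"
proof (rule L2_dominated[OF h])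
  show "(\<lambda>z. c z *v h z) \<in> borel_measurable M"
    by (rule borel_measurable_matrix_vector_mult[OF c(1) L2D(1)[OF h]])
  show "AE z in M. norm (c z *v h z) \<le> real CARD('d) * real CARD('m) * K * norm (h z)"
  proof (rule AE_I2)
    fix z
    have "onorm ((*v) (c z)) \<le> real CARD('d) * real CARD('m) * K"
      using c(2)[of z] order_trans[OF mat_nth_le_norm] by (intro onorm_le_matrix_component) blast
    moreover have "norm (c z *v h z) \<le> onorm ((*v) (c z)) * norm (h z)"
      by (rule onorm) (rule matrix_vector_mul_bounded_linear)
    ultimately show "norm (c z *v h z) \<le> real CARD('d) * real CARD('m) * K * norm (h z)"
      using mult_right_mono[OF _ norm_ge_zero[of "h z"]] by (meson order_trans)
  qed
qed

text \<open>Testing a truncated coefficient \<open>c\<close> against itself gives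
  \<open>\<parallel>c h\<parallel>^2 = <s, c h>\<close>, hence
  \<open>\<parallel>c h\<parallel> \<le> \<parallel>s\<parallel>\<close> by Cauchy-Schwarz at every
  truncation level. Fatou's lemma removes the truncation.\<close>

lemma projection_L2:
  fixes h :: "'a \<Rightarrow> real ^ 'm" and s :: "'a \<Rightarrow> real ^ 'd"
  assumes h: "h \<in> L2 M" and s: "s \<in> L2 M" and a: "a \<in> borel_measurable F"
    and eq: "AE z in M. a z ** cond_exp_mat M F (\<lambda>x. outer (h x) (h x)) z
         = cond_exp_mat M F (\<lambda>x. outer (s x) (h x)) z"
  shows "(\<lambda>z. a z *v h z) \<in> L2 M"
proof -
  define c where "c n z = truncate (real n) (a z)" for n z
  have c: "c n \<in> borel_measurable F" "norm (c n z) \<le> real n" for n z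
    unfolding c_def using a by (auto intro: borel_measurable_truncate simp: norm_truncate)
  have ch: "(\<lambda>z. c n z *v h z) \<in> L2 M" for n
    by (rule L2_bounded_matrix_mult[OF h measurable_from_subalg[OF subalg c(1)] c(2)])
  have ah: "(\<lambda>z. a z *v h z) \<in> borel_measurable M"
    by (rule borel_measurable_matrix_vector_mult[OF measurable_from_subalg[OF subalg a] L2D(1)[OF h]])
  have le: "l2_norm M (\<lambda>z. c n z *v h z) \<le> l2_norm M s" for n
  proof -
    have "(\<integral>z. (s z - c n z *v h z) \<bullet> (c n z *v h z) \<partial>M) = 0"
      by (rule truncated_orthogonal[OF h s c c], use eq in eventually_elim)
        (auto simp: c_def truncate_def)
    then have "l2_inner M s (\<lambda>z. c n z *v h z) = (l2_norm M (\<lambda>z. c n z *v h z))\<^sup>2"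
      using l2_inner_diff_left[OF s ch ch] unfolding l2_norm_squared by (simp add: l2_inner_def)
    then have "(l2_norm M (\<lambda>z. c n z *v h z))\<^sup>2 \<le> l2_norm M s * l2_norm M (\<lambda>z. c n z *v h z)"
      using l2_Cauchy_Schwarz[OF s ch[of n]] by linarith
    then show ?thesis
      using l2_norm_nonneg[of M s] l2_norm_nonneg[of M "\<lambda>z. c n z *v h z"]
      by (cases "l2_norm M (\<lambda>z. c n z *v h z) = 0") (auto simp: power2_eq_square)
  qed
  have "(\<integral>\<^sup>+z. ennreal ((norm (a z *v h z))\<^sup>2) \<partial>M)
      \<le> (\<integral>\<^sup>+z. liminf (\<lambda>n. ennreal ((norm (c n z *v h z))\<^sup>2)) \<partial>M)"
  proof (rule nn_integral_mono)
    fix z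
    have "(\<lambda>n. ennreal ((norm (c n z *v h z))\<^sup>2)) \<longlonglongrightarrow> ennreal ((norm (a z *v h z))\<^sup>2)"
      using truncate_eventually[of "a z"]
      by (intro tendsto_eventually) (auto simp: c_def elim: eventually_mono)
    then show "ennreal ((norm (a z *v h z))\<^sup>2) \<le> liminf (\<lambda>n. ennreal ((norm (c n z *v h z))\<^sup>2))"
      using lim_imp_Liminf[OF sequentially_bot] by fastforce
  qed
  also have "\<dots> \<le> liminf (\<lambda>n. \<integral>\<^sup>+z. ennreal ((norm (c n z *v h z))\<^sup>2) \<partial>M)"
    using L2D(1)[OF ch] by (intro nn_integral_liminf) auto
  also have "\<dots> \<le> ennreal ((l2_norm M s)\<^sup>2)"
  proof (rule Liminf_le[OF sequentially_bot], rule always_eventually, rule allI)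
    fix n
    have "(\<integral>\<^sup>+z. ennreal ((norm (c n z *v h z))\<^sup>2) \<partial>M) = ennreal ((l2_norm M (\<lambda>z. c n z *v h z))\<^sup>2)"
      unfolding l2_norm_squared
      using L2D(2)[OF ch] by (subst nn_integral_eq_integral) (auto simp: l2_inner_def power2_norm_eq_inner)
    also have "\<dots> \<le> ennreal ((l2_norm M s)\<^sup>2)"
      by (intro ennreal_leI power_mono le l2_norm_nonneg)
    finally show "(\<integral>\<^sup>+z. ennreal ((norm (c n z *v h z))\<^sup>2) \<partial>M) \<le> ennreal ((l2_norm M s)\<^sup>2)" .
  qed
  finally have "integrable M (\<lambda>z. (norm (a z *v h z))\<^sup>2)"
    using ah by (intro integrableI_bounded) (auto simp: le_less_trans)
  then show ?thesis using ah by (simp add: L2_def)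
qed

lemma projection_orthogonal:
  fixes h :: "'a \<Rightarrow> real ^ 'm" and s :: "'a \<Rightarrow> real ^ 'd"
  assumes h: "h \<in> L2 M" and s: "s \<in> L2 M" and a: "a \<in> borel_measurable F"
    and eq: "AE z in M. a z ** cond_exp_mat M F (\<lambda>x. outer (h x) (h x)) z
         = cond_exp_mat M F (\<lambda>x. outer (s x) (h x)) z"
    and t: "t \<in> H_space M F h"
  shows "l2_inner M (\<lambda>z. s z - a z *v h z) t = 0"
proof -
  obtain b where b: "b \<in> borel_measurable F" and tb: "AE z in M. t z = b z *v h z" and tL: "t \<in> L2 M"
    using t by (auto simp: H_space_def)
  note aL = projection_L2[OF h s a eq]
  define c where "c n z = truncate (real n) (a z)" for n z
  \<comment> \<open>\<open>d\<close> vanishes wherever \<open>a\<close> or \<open>b\<close> is cut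
    off, so almost surely the truncated integrand is either \<open>(s - a h) \<bullet> t\<close> or
    zero. Pointwise convergence and the dominating function both follow from this.\<close>
  define d where "d n z = (if norm (a z) \<le> real n then truncate (real n) (b z) else 0)" for n z
  have [measurable]: "a \<in> borel_measurable F" "b \<in> borel_measurable F"
    "(\<lambda>z. truncate (real n) (b z)) \<in> borel_measurable F" for n
    using a b by (auto intro: borel_measurable_truncate)
  have c: "c n \<in> borel_measurable F" "norm (c n z) \<le> real n" for n z
    unfolding c_def using a by (auto intro: borel_measurable_truncate simp: norm_truncate)
  have d: "d n \<in> borel_measurable F" "norm (d n z) \<le> real n" for n z
    unfolding d_def by (measurable, auto simp: norm_truncate)
  have zero: "(\<integral>z. (s z - c n z *v h z) \<bullet> (d n z *v h z) \<partial>M) = 0" for n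
    by (rule truncated_orthogonal[OF h s c d], use eq in eventually_elim)
      (auto simp: c_def d_def truncate_def)
  have int: "integrable M (\<lambda>z. (s z - a z *v h z) \<bullet> t z)"
    by (intro L2_inner_integrable L2_diff s aL tL)
  have "(\<lambda>n. \<integral>z. (s z - c n z *v h z) \<bullet> (d n z *v h z) \<partial>M) \<longlonglongrightarrow> (\<integral>z. (s z - a z *v h z) \<bullet> t z \<partial>M)"
  proof (rule integral_dominated_convergence[where w = "\<lambda>z. \<bar>(s z - a z *v h z) \<bullet> t z\<bar>"])
    show "(\<lambda>z. (s z - a z *v h z) \<bullet> t z) \<in> borel_measurable M" using int by auto
    show "integrable M (\<lambda>z. \<bar>(s z - a z *v h z) \<bullet> t z\<bar>)" using int by auto
    show "(\<lambda>z. (s z - c n z *v h z) \<bullet> (d n z *v h z)) \<in> borel_measurable M" for n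
      by (intro borel_measurable_inner borel_measurable_diff borel_measurable_matrix_vector_mult
          L2D(1)[OF s] L2D(1)[OF h] measurable_from_subalg[OF subalg] c d)
    show "AE z in M. (\<lambda>n. (s z - c n z *v h z) \<bullet> (d n z *v h z)) \<longlonglongrightarrow> (s z - a z *v h z) \<bullet> t z"
      using tb
    proof eventually_elim
      case (elim z)
      have "\<forall>\<^sub>F n in sequentially. norm (a z) \<le> real n"
        using eventually_ge_at_top[of "nat \<lceil>norm (a z)\<rceil>"]
        by eventually_elim (simp add: nat_le_iff ceiling_le_iff)
      then show ?case
        using truncate_eventually[of "a z"] truncate_eventually[of "b z"]
        by (intro tendsto_eventually, eventually_elim) (simp add: c_def d_def elim)
    qed
    show "AE z in M. norm ((s z - c n z *v h z) \<bullet> (d n z *v h z)) \<le> \<bar>(s z - a z *v h z) \<bullet> t z\<bar>" for n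
      using tb by eventually_elim (auto simp: c_def d_def truncate_def)
  qed
  then show ?thesis by (simp add: zero l2_inner_def LIMSEQ_const_iff)
qed

text \<open>Links the constraint in \<open>T_space\<close> to orthogonality. From right to left, the
  zero coefficient solves the normal equation for \<open>r\<close>; from left to right, coefficients
  with a single nonzero entry, the indicator of an event of \<open>F\<close>, suffice as
  tests.\<close>

lemma H_space_orthogonal_iff:
  fixes h :: "'a \<Rightarrow> real ^ 'm" and r :: "'a \<Rightarrow> real ^ 'd"
  assumes h: "h \<in> L2 M" and r: "r \<in> L2 M"
  shows "(\<forall>t\<in>H_space M F h. l2_inner M r t = 0)
    \<longleftrightarrow> (AE z in M. cond_exp_mat M F (\<lambda>x. outer (h x) (r x)) z = 0)"
proof
  assume "AE z in M. cond_exp_mat M F (\<lambda>x. outer (h x) (r x)) z = 0"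
  then have "AE z in M. 0 ** cond_exp_mat M F (\<lambda>x. outer (h x) (h x)) z
         = cond_exp_mat M F (\<lambda>x. outer (r x) (h x)) z"
    by eventually_elim (simp add: vec_eq_iff cond_exp_mat_def outer_def mult.commute matrix_matrix_mult_def)
  from projection_orthogonal[OF h r borel_measurable_const this]
  show "\<forall>t\<in>H_space M F h. l2_inner M r t = 0" by simp
next
  assume orth: "\<forall>t\<in>H_space M F h. l2_inner M r t = 0"
  have "AE z in M. real_cond_exp M F (\<lambda>x. h x $ l * r x $ k) z = 0" for l k
  proof (rule real_cond_exp_charact)
    fix A assume A: "A \<in> sets F"
    define a :: "'a \<Rightarrow> real ^ 'm ^ 'd" where
      "a z = (\<chi> i j. if i = k \<and> j = l then indicator A z else 0)" for z
    have a: "a \<in> borel_measurable F"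
      by (rule borel_measurable_matI) (use A in \<open>simp add: a_def\<close>)
    have ah: "a z *v h z = (indicator A z * h z $ l) *\<^sub>R axis k 1" for z
      by (simp add: vec_eq_iff a_def matrix_vector_mult_def axis_def if_distrib[where f="\<lambda>x. x * _"]
          sum.delta cong: if_cong)
    have "(\<lambda>z. a z *v h z) \<in> L2 M"
    proof (rule L2_dominated[OF h, of _ 1])
      show "(\<lambda>z. a z *v h z) \<in> borel_measurable M"
        by (rule borel_measurable_matrix_vector_mult[OF measurable_from_subalg[OF subalg a] L2D(1)[OF h]])
      show "AE z in M. norm (a z *v h z) \<le> 1 * norm (h z)"
        using component_le_norm_cart[of "h _" l] by (intro AE_I2) (simp add: ah indicator_def)
    qed
    then have "(\<lambda>z. a z *v h z) \<in> H_space M F h" using a by (auto simp: H_space_def)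
    then have "l2_inner M r (\<lambda>z. a z *v h z) = 0" using orth by blast
    then show "(\<integral>x\<in>A. h x $ l * r x $ k \<partial>M) = (\<integral>x\<in>A. 0 \<partial>M)"
      by (simp add: ah inner_axis l2_inner_def set_lebesgue_integral_def mult_ac)
  next
    show "integrable M (\<lambda>x. h x $ l * r x $ k)" by (intro L2_mult_integrable L2_nth h r)
  qed auto
  then have "AE z in M. \<forall>l\<in>UNIV. \<forall>k\<in>UNIV. real_cond_exp M F (\<lambda>x. h x $ l * r x $ k) z = 0"
    by (intro AE_finite_allI finite)
  then show "AE z in M. cond_exp_mat M F (\<lambda>x. outer (h x) (r x)) z = 0"
    by eventually_elim (simp add: vec_eq_iff cond_exp_mat_def outer_def)
qed

text \<open>This is the mean-zero property of \<open>H_space\<close>, phrased as orthogonality to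
  constants so that it combines with the other inner products.\<close>

lemma const_orthogonal_H_space:
  fixes h :: "'a \<Rightarrow> real ^ 'm" and v :: "real ^ 'd"
  assumes h: "h \<in> L2 M" and mean: "AE z in M. cond_exp_vec M F h z = 0" and t: "t \<in> H_space M F h"
  shows "l2_inner M (\<lambda>_. v) t = 0"
proof -
  have "integrable M (\<lambda>x. h x $ l)" for l
    using L2_mult_integrable[OF L2_nth[OF h] L2_const[of 1]] by simp
  then have "AE z in M. \<forall>l\<in>UNIV. \<forall>k\<in>UNIV. real_cond_exp M F (\<lambda>x. v $ k * h x $ l) z
     = v $ k * real_cond_exp M F (\<lambda>x. h x $ l) z"
    by (intro AE_finite_allI finite real_cond_exp_cmult)
  then have "AE z in M. cond_exp_mat M F (\<lambda>x. outer (h x) v) z = 0"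
    using mean by eventually_elim
      (simp add: vec_eq_iff cond_exp_mat_def cond_exp_vec_def outer_def mult.commute)
  then show ?thesis using H_space_orthogonal_iff[OF h L2_const[of v]] t by blast
qed

end

section \<open>Conditional moments and the score\<close>

lemma tendsto_l2_inner_bounded_null:
  assumes x: "\<And>n. x n \<in> L2 M" and d: "\<And>n. d n \<in> L2 M"
    and B: "\<And>n. l2_norm M (x n) \<le> B" and null: "(\<lambda>n. l2_norm M (d n)) \<longlonglongrightarrow> 0"
  shows "(\<lambda>n. l2_inner M (x n) (d n)) \<longlonglongrightarrow> 0"
proof (rule tendsto_rabs_zero_cancel, rule tendsto_sandwich[OF _ _ tendsto_const])
  show "\<forall>\<^sub>F n in sequentially. \<bar>l2_inner M (x n) (d n)\<bar> \<le> B * l2_norm M (d n)"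
  proof (intro always_eventually allI)
    fix n
    have "\<bar>l2_inner M (x n) (d n)\<bar> \<le> l2_norm M (x n) * l2_norm M (d n)"
      by (rule l2_Cauchy_Schwarz[OF x d])
    also have "\<dots> \<le> B * l2_norm M (d n)"
      by (rule mult_right_mono[OF B l2_norm_nonneg])
    finally show "\<bar>l2_inner M (x n) (d n)\<bar> \<le> B * l2_norm M (d n)" .
  qed
  show "(\<lambda>n. B * l2_norm M (d n)) \<longlonglongrightarrow> 0"
    using tendsto_mult_right_zero[OF null] by simp
qed simp

lemma l2_norm_bounded:
  assumes x: "\<And>n. x n \<in> L2 M" and y: "y \<in> L2 M" and lim: "(\<lambda>n. l2_dist M (x n) y) \<longlonglongrightarrow> 0"
  obtains B where "\<And>n. l2_norm M (x n) \<le> B"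
proof -
  from convergent_imp_Bseq[OF convergentI[OF lim]]
  obtain K where K: "\<And>n. \<bar>l2_dist M (x n) y\<bar> \<le> K" by (auto simp: Bseq_def)
  have "l2_norm M (x n) \<le> l2_norm M y + K" for n
    using l2_norm_triangle[OF y L2_diff[OF x y], of n] K[of n] by (simp add: l2_dist_eq_norm)
  then show ?thesis by (rule that)
qed

lemma tendsto_l2_inner2:
  assumes x: "\<And>n. x n \<in> L2 M" "y \<in> L2 M" "(\<lambda>n. l2_dist M (x n) y) \<longlonglongrightarrow> 0"
    and u: "\<And>n. u n \<in> L2 M" "v \<in> L2 M" "(\<lambda>n. l2_dist M (u n) v) \<longlonglongrightarrow> 0"
  shows "(\<lambda>n. l2_inner M (x n) (u n)) \<longlonglongrightarrow> l2_inner M y v"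
proof -
  obtain B where B: "\<And>n. l2_norm M (x n) \<le> B" using l2_norm_bounded[OF x] by blast
  have "(\<lambda>n. l2_inner M (x n) (\<lambda>z. u n z - v z) + l2_inner M (x n) v) \<longlonglongrightarrow> 0 + l2_inner M y v"
  proof (rule tendsto_add)
    show "(\<lambda>n. l2_inner M (x n) (\<lambda>z. u n z - v z)) \<longlonglongrightarrow> 0"
      by (rule tendsto_l2_inner_bounded_null[OF x(1) L2_diff[OF u(1,2)] B])
        (use u(3) in \<open>simp add: l2_dist_eq_norm\<close>)
    show "(\<lambda>n. l2_inner M (x n) v) \<longlonglongrightarrow> l2_inner M y v"
      by (rule tendsto_l2_inner[OF x(1,2) u(2) x(3)])
  qed
  then show ?thesis using x u by (simp add: l2_inner_diff_right)
qed

text \<open>Under a common norm bound, convergence of inner products with \<open>v\<close> can be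
  checked on functions approximating \<open>v\<close>; the bound takes the place of strong
  convergence of \<open>x n\<close>.\<close>

lemma tendsto_l2_inner_dense:
  assumes x: "\<And>n. x n \<in> L2 M" and y: "y \<in> L2 M" and v: "v \<in> L2 M" and V: "\<And>k. V k \<in> L2 M"
    and B: "\<And>n. l2_norm M (x n) \<le> B"
    and dense: "(\<lambda>k::nat. l2_dist M (V k) v) \<longlonglongrightarrow> 0"
    and lim: "\<And>k. (\<lambda>n. l2_inner M (x n) (V k)) \<longlonglongrightarrow> l2_inner M y (V k)"
  shows "(\<lambda>n. l2_inner M (x n) v) \<longlonglongrightarrow> l2_inner M y v"
proof (rule LIMSEQ_I)
  fix e :: real assume e: "e > 0"
  \<comment> \<open>\<open>C\<close> bounds the norms of the sequence and of the limit, and the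
    added 1 makes it positive. The error is then shared by two approximations of \<open>v\<close>
    and the convergence at \<open>V k\<close>.\<close>
  define C where "C = max B (l2_norm M y) + 1"
  have C: "C > 0" "\<And>n. l2_norm M (x n) \<le> C" "l2_norm M y \<le> C"
    using l2_norm_nonneg[of M y] B by (auto simp: C_def intro: order_trans[OF B])
  obtain k where k: "l2_dist M (V k) v < e / (3 * C)"
    using LIMSEQ_D[OF dense, of "e / (3 * C)"] e C(1) by (auto simp: l2_dist_def)
  have near: "\<bar>l2_inner M f (V k) - l2_inner M f v\<bar> < e / 3" if f: "f \<in> L2 M" "l2_norm M f \<le> C" for f
  proof -
    have "\<bar>l2_inner M f (V k) - l2_inner M f v\<bar> = \<bar>l2_inner M f (\<lambda>z. V k z - v z)\<bar>"
      using l2_inner_diff_right[OF V v f(1)] by simp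
    also have "\<dots> \<le> l2_norm M f * l2_dist M (V k) v"
      using l2_Cauchy_Schwarz[OF f(1) L2_diff[OF V v]] by (simp add: l2_dist_eq_norm)
    also have "\<dots> \<le> C * l2_dist M (V k) v"
      by (rule mult_right_mono[OF f(2)]) (simp add: l2_dist_def)
    also have "\<dots> < C * (e / (3 * C))" by (rule mult_strict_left_mono[OF k C(1)])
    finally show ?thesis using C(1) by simp
  qed
  obtain N where N: "\<And>n. n \<ge> N \<Longrightarrow> \<bar>l2_inner M (x n) (V k) - l2_inner M y (V k)\<bar> < e / 3"
    using LIMSEQ_D[OF lim, of "e / 3" k] e by auto
  have "norm (l2_inner M (x n) v - l2_inner M y v) < e" if "n \<ge> N" for n
    using near[OF x C(2), of n] near[OF y C(3)] N[OF that] unfolding real_norm_def by linarith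
  then show "\<exists>no. \<forall>n\<ge>no. norm (l2_inner M (x n) v - l2_inner M y v) < e" by blast
qed

lemma l2_dist_truncate:
  fixes w r :: "'a \<Rightarrow> real"
  assumes wr: "(\<lambda>z. w z * r z) \<in> L2 M" and w[measurable]: "w \<in> borel_measurable M"
    and r[measurable]: "r \<in> borel_measurable M"
  shows "(\<lambda>k. l2_dist M (\<lambda>z. truncate (real k) (w z) * r z) (\<lambda>z. w z * r z)) \<longlonglongrightarrow> 0"
proof -
  have [measurable]: "(\<lambda>z. truncate (real k) (w z)) \<in> borel_measurable M" for k
    by (rule borel_measurable_truncate[OF w])
  have "(\<lambda>k. \<integral>z. (norm (truncate (real k) (w z) * r z - w z * r z))\<^sup>2 \<partial>M) \<longlonglongrightarrow> (\<integral>z. 0 \<partial>M)"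
  proof (rule integral_dominated_convergence[where w = "\<lambda>z. (norm (w z * r z))\<^sup>2"])
    show "integrable M (\<lambda>z. (norm (w z * r z))\<^sup>2)" by (rule L2D[OF wr])
    show "AE z in M. (\<lambda>k. (norm (truncate (real k) (w z) * r z - w z * r z))\<^sup>2) \<longlonglongrightarrow> 0"
    proof (rule AE_I2, rule tendsto_eventually)
      fix z
      show "\<forall>\<^sub>F k in sequentially. (norm (truncate (real k) (w z) * r z - w z * r z))\<^sup>2 = 0"
        using truncate_eventually[of "w z"] by eventually_elim simp
    qed
    show "AE z in M. norm ((norm (truncate (real k) (w z) * r z - w z * r z))\<^sup>2) \<le> (norm (w z * r z))\<^sup>2" for k
      by (rule AE_I2) (simp add: truncate_def)
  qed auto
  from tendsto_real_sqrt[OF this] show ?thesis by (simp add: l2_dist_def)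
qed

text \<open>
  With \<open>u\<^sub>n = (r\<^sub>n - r\<^sub>0) / t\<^sub>n\<close>, the left-hand side is \<open>- \<integral> (G\<^sub>n r\<^sub>n + G\<^sub>n r\<^sub>0) u\<^sub>n\<close>.  The functions
  \<open>G\<^sub>n r\<^sub>n\<close> converge only weakly, which is why \<open>w\<close> is truncated.
\<close>

lemma qmd_moment_limit:
  fixes r G :: "nat \<Rightarrow> 'a \<Rightarrow> real" and r0 G0 w :: "'a \<Rightarrow> real"
  assumes r: "\<And>n. r n \<in> L2 M" and r0: "r0 \<in> L2 M" and w: "w \<in> borel_measurable M"
    and wr: "(\<lambda>z. w z * r0 z) \<in> L2 M" and t: "\<And>n. t n > 0" "t \<longlonglongrightarrow> 0"
    and score: "(\<lambda>n. l2_dist M (\<lambda>z. (r n z - r0 z) / t n) (\<lambda>z. w z * r0 z / 2)) \<longlonglongrightarrow> 0"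
    and y: "\<And>n. (\<lambda>z. G n z * r n z) \<in> L2 M" "\<And>n. l2_norm M (\<lambda>z. G n z * r n z) \<le> B"
    and x: "\<And>n. (\<lambda>z. G n z * r0 z) \<in> L2 M" "(\<lambda>z. G0 z * r0 z) \<in> L2 M"
      "(\<lambda>n. l2_dist M (\<lambda>z. G n z * r0 z) (\<lambda>z. G0 z * r0 z)) \<longlonglongrightarrow> 0"
    and zero: "\<And>n. (\<integral>z. G n z * (r n z)\<^sup>2 \<partial>M) = 0"
  shows "(\<lambda>n. (\<integral>z. G n z * (r0 z)\<^sup>2 \<partial>M) / t n) \<longlonglongrightarrow> - (\<integral>z. w z * G0 z * (r0 z)\<^sup>2 \<partial>M)"
proof -
  define u where "u n z = (r n z - r0 z) / t n" for n z
  define v where "v z = w z * r0 z / 2" for z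
  define Y where "Y n z = G n z * r n z" for n z
  define X where "X n z = G n z * r0 z" for n z
  define X0 where "X0 z = G0 z * r0 z" for z
  define V where "V k z = truncate (real k) (w z) * r0 z / 2" for k z
  note [measurable] = L2D(1)[OF r] L2D(1)[OF r0] w
  have [measurable]: "(\<lambda>z. truncate (real k) (w z)) \<in> borel_measurable M" for k
    by (rule borel_measurable_truncate[OF w])
  have uL: "u n \<in> L2 M" for n
    using L2_scaleR[OF L2_diff[OF r r0], of "1 / t n" n] by (simp add: u_def[abs_def])
  have vL: "v \<in> L2 M" using L2_scaleR[OF wr, of "1/2"] by (simp add: v_def[abs_def])
  have YL: "Y n \<in> L2 M" and XL: "X n \<in> L2 M" and X0L: "X0 \<in> L2 M" for n
    using x y by (simp_all add: Y_def[abs_def] X_def[abs_def] X0_def[abs_def])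
  have bd: "norm (truncate (real k) (w z) * f) \<le> real k * norm f" for k z f
    using norm_truncate[of "real k" "w z"] by (simp add: abs_mult mult_right_mono)
  have VL: "V k \<in> L2 M" for k
    unfolding V_def
  proof (rule L2_dominated[OF r0, of _ "real k"])
    show "AE z in M. norm (truncate (real k) (w z) * r0 z / 2) \<le> real k * norm (r0 z)"
      using bd[of k _ "r0 _"] by (intro AE_I2) (smt (verit) real_norm_def abs_divide abs_ge_zero field_sum_of_halves)
  qed measurable
  have xlim: "(\<lambda>n. l2_dist M (X n) X0) \<longlonglongrightarrow> 0"
    using x(3) by (simp add: X_def[abs_def] X0_def[abs_def])
  have ulim: "(\<lambda>n. l2_dist M (u n) v) \<longlonglongrightarrow> 0"
    using score by (simp add: u_def[abs_def] v_def[abs_def])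
  have YB: "l2_norm M (Y n) \<le> B" for n using y(2) by (simp add: Y_def[abs_def])
  obtain Bu where Bu: "\<And>n. l2_norm M (u n) \<le> Bu" using l2_norm_bounded[OF uL vL ulim] by blast
  \<comment> \<open>The difference \<open>r n - r0\<close> is \<open>t n\<close> times a quotient of
    bounded norm.\<close>
  have rlim: "(\<lambda>n. l2_norm M (\<lambda>z. r n z - r0 z)) \<longlonglongrightarrow> 0"
  proof (rule tendsto_sandwich[OF _ _ tendsto_const])
    have "l2_norm M (\<lambda>z. r n z - r0 z) = t n * l2_norm M (u n)" for n
    proof -
      have "(\<lambda>z. r n z - r0 z) = (\<lambda>z. t n *\<^sub>R u n z)" using t(1)[of n] by (auto simp: u_def)
      then have "l2_inner M (\<lambda>z. r n z - r0 z) (\<lambda>z. r n z - r0 z) = (t n)\<^sup>2 * l2_inner M (u n) (u n)"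
        by (simp only: l2_inner_scaleR_left l2_inner_scaleR_right power2_eq_square mult.assoc)
      then show ?thesis using t(1)[of n] by (simp add: l2_norm_def real_sqrt_mult)
    qed
    then show "\<forall>\<^sub>F n in sequentially. l2_norm M (\<lambda>z. r n z - r0 z) \<le> t n * Bu"
      using Bu t(1) by (simp add: mult_left_mono less_imp_le)
    show "(\<lambda>n. t n * Bu) \<longlonglongrightarrow> 0" using tendsto_mult_left_zero[OF t(2)] by simp
  qed (simp add: l2_norm_nonneg)
  have weak: "(\<lambda>n. l2_inner M (Y n) v) \<longlonglongrightarrow> l2_inner M X0 v"
  proof (rule tendsto_l2_inner_dense[OF YL X0L vL VL YB])
    have "(\<lambda>k. l2_dist M (V k) v) = (\<lambda>k. l2_dist M (\<lambda>z. truncate (real k) (w z) * r0 z) (\<lambda>z. w z * r0 z) / 2)"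
    proof
      fix k
      have "(\<lambda>z. (norm (V k z - v z))\<^sup>2)
          = (\<lambda>z. (norm (truncate (real k) (w z) * r0 z - w z * r0 z))\<^sup>2 / 4)"
        by (auto simp: V_def v_def power2_eq_square algebra_simps)
      then show "l2_dist M (V k) v = l2_dist M (\<lambda>z. truncate (real k) (w z) * r0 z) (\<lambda>z. w z * r0 z) / 2"
        by (simp add: l2_dist_def real_sqrt_divide)
    qed
    then show "(\<lambda>k. l2_dist M (V k) v) \<longlonglongrightarrow> 0"
      using tendsto_divide_zero[OF l2_dist_truncate[OF wr w L2D(1)[OF r0]], of 2] by simp
  next
    fix k
    \<comment> \<open>With a bounded factor in place of \<open>w\<close> the root densities can
      change sides, \<open><Y n, V k> = <X n, ?q n>\<close>, and on the right both arguments
      converge strongly. For \<open>w\<close> itself, \<open>w * r n\<close> need not be square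
      integrable.\<close>
    let ?q = "\<lambda>n z. truncate (real k) (w z) * r n z / 2"
    have qL: "?q n \<in> L2 M" for n
    proof (rule L2_dominated[OF r, of _ "real k"])
      show "AE z in M. norm (truncate (real k) (w z) * r n z / 2) \<le> real k * norm (r n z)"
        using bd[of k _ "r n _"] by (intro AE_I2) (smt (verit) real_norm_def abs_divide abs_ge_zero field_sum_of_halves)
    qed measurable
    have "l2_norm M (\<lambda>z. ?q n z - V k z) \<le> real k * l2_norm M (\<lambda>z. r n z - r0 z)" for n
    proof -
      have "l2_inner M (\<lambda>z. ?q n z - V k z) (\<lambda>z. ?q n z - V k z)
          \<le> l2_inner M (\<lambda>z. real k *\<^sub>R (r n z - r0 z)) (\<lambda>z. real k *\<^sub>R (r n z - r0 z))"
        unfolding l2_inner_def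
      proof (rule integral_mono)
        show "integrable M (\<lambda>z. (?q n z - V k z) \<bullet> (?q n z - V k z))"
          by (intro L2_inner_integrable L2_diff qL VL)
        show "integrable M (\<lambda>z. (real k *\<^sub>R (r n z - r0 z)) \<bullet> (real k *\<^sub>R (r n z - r0 z)))"
          by (intro L2_inner_integrable L2_scaleR L2_diff r r0)
        fix z
        have "?q n z - V k z = (truncate (real k) (w z) * (r n z - r0 z)) / 2"
          by (simp add: V_def algebra_simps diff_divide_distrib)
        then have "\<bar>?q n z - V k z\<bar> \<le> \<bar>real k *\<^sub>R (r n z - r0 z)\<bar>"
          using bd[of k z "r n z - r0 z"] abs_ge_zero[of "truncate (real k) (w z) * (r n z - r0 z)"]
          by (simp only: abs_divide abs_mult real_norm_def real_scaleR_def abs_of_nat abs_numeral)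
        from power_mono[OF this, of 2]
        show "(?q n z - V k z) \<bullet> (?q n z - V k z) \<le> (real k *\<^sub>R (r n z - r0 z)) \<bullet> (real k *\<^sub>R (r n z - r0 z))"
          by (simp add: power2_eq_square)
      qed
      then have "l2_norm M (\<lambda>z. ?q n z - V k z) \<le> sqrt ((real k)\<^sup>2 * l2_inner M (\<lambda>z. r n z - r0 z) (\<lambda>z. r n z - r0 z))"
        unfolding l2_norm_def l2_inner_scaleR_left l2_inner_scaleR_right
        by (simp add: power2_eq_square mult.assoc)
      then show ?thesis by (simp add: l2_norm_def real_sqrt_mult)
    qed
    then have qlim: "(\<lambda>n. l2_dist M (?q n) (V k)) \<longlonglongrightarrow> 0"
      unfolding l2_dist_eq_norm
      by (intro tendsto_sandwich[OF _ _ tendsto_const tendsto_mult_right_zero[OF rlim, of "real k"]])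
        (simp_all add: l2_norm_nonneg)
    have "(\<lambda>n. l2_inner M (X n) (?q n)) \<longlonglongrightarrow> l2_inner M X0 (V k)"
      by (rule tendsto_l2_inner2[OF XL X0L xlim qL VL qlim])
    moreover have "l2_inner M (X n) (?q n) = l2_inner M (Y n) (V k)" for n
      unfolding l2_inner_def by (rule Bochner_Integration.integral_cong) (simp_all add: X_def Y_def V_def)
    ultimately show "(\<lambda>n. l2_inner M (Y n) (V k)) \<longlonglongrightarrow> l2_inner M X0 (V k)" by simp
  qed
  \<comment> \<open>The pairing of \<open>Y n + X n\<close> with \<open>u n\<close> is split so that
    the weakly convergent \<open>Y n\<close> meets either the null sequence \<open>u n - v\<close>,
    where boundedness suffices, or the fixed \<open>v\<close>.\<close>
  have "(\<lambda>n. l2_inner M (Y n) (\<lambda>z. u n z - v z) + l2_inner M (Y n) v + l2_inner M (X n) (u n))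
      \<longlonglongrightarrow> 0 + l2_inner M X0 v + l2_inner M X0 v"
    by (intro tendsto_add weak tendsto_l2_inner2[OF XL X0L xlim uL vL ulim]
        tendsto_l2_inner_bounded_null[OF YL L2_diff[OF uL vL] YB] ulim[unfolded l2_dist_eq_norm])
  then have "(\<lambda>n. - (l2_inner M (Y n) (\<lambda>z. u n z - v z) + l2_inner M (Y n) v + l2_inner M (X n) (u n)))
      \<longlonglongrightarrow> - (0 + l2_inner M X0 v + l2_inner M X0 v)"
    by (rule tendsto_minus)
  moreover have "- (l2_inner M (Y n) (\<lambda>z. u n z - v z) + l2_inner M (Y n) v + l2_inner M (X n) (u n))
      = (\<integral>z. G n z * (r0 z)\<^sup>2 \<partial>M) / t n" for n
  proof -
    have i: "integrable M (\<lambda>z. G n z * (r n z)\<^sup>2)" "integrable M (\<lambda>z. G n z * (r0 z)\<^sup>2)"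
      using L2_mult_integrable[OF YL r] L2_mult_integrable[OF XL r0]
      by (simp_all add: Y_def X_def power2_eq_square mult.assoc)
    have "l2_inner M (Y n) (\<lambda>z. u n z - v z) + l2_inner M (Y n) v + l2_inner M (X n) (u n)
        = l2_inner M (\<lambda>z. Y n z + X n z) (u n)"
      using YL XL uL vL by (simp add: l2_inner_diff_right l2_inner_add_left)
    also have "\<dots> = (\<integral>z. (G n z * (r n z)\<^sup>2 - G n z * (r0 z)\<^sup>2) / t n \<partial>M)"
      unfolding l2_inner_def
      by (rule Bochner_Integration.integral_cong)
        (simp_all add: Y_def X_def u_def power2_eq_square algebra_simps diff_divide_distrib)
    also have "\<dots> = - (\<integral>z. G n z * (r0 z)\<^sup>2 \<partial>M) / t n"
      using i zero[of n] by (simp add: Bochner_Integration.integral_diff)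
    finally show ?thesis by simp
  qed
  \<comment> \<open>\<open>v\<close> carries the factor 1/2 of the quadratic mean derivative; the
    two equal limits compensate it.\<close>
  moreover have "l2_inner M X0 v + l2_inner M X0 v = (\<integral>z. w z * G0 z * (r0 z)\<^sup>2 \<partial>M)"
  proof -
    have "2 * l2_inner M X0 v = (\<integral>z. 2 * (X0 z * v z) \<partial>M)" by (simp add: l2_inner_def)
    also have "\<dots> = (\<integral>z. w z * G0 z * (r0 z)\<^sup>2 \<partial>M)"
      by (rule Bochner_Integration.integral_cong) (simp_all add: X0_def v_def power2_eq_square)
    finally show ?thesis by simp
  qed
  ultimately show ?thesis by simp
qed

context finite_measure_subalgebra
begin

text \<open>
  On the sets \<open>{z. \<bar>f\<^sub>n z\<bar> \<le> N for all n \<ge> N}\<close>, which exhaust the space, bounded convergence applies.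
\<close>

lemma AE_real_cond_exp_eq_limit:
  fixes f :: "nat \<Rightarrow> 'a \<Rightarrow> real"
  assumes f: "\<And>n. f n \<in> borel_measurable F" and g: "g \<in> borel_measurable F"
    and phi: "integrable M \<phi>"
    and lim: "AE z in M. (\<lambda>n. f n z) \<longlonglongrightarrow> g z"
    and int: "\<And>A. A \<in> sets F \<Longrightarrow> (\<lambda>n. \<integral>z. indicator A z * f n z \<partial>M) \<longlonglongrightarrow> (\<integral>z. indicator A z * \<phi> z \<partial>M)"
  shows "AE z in M. real_cond_exp M F \<phi> z = g z"
proof -
  define B where "B N = {z \<in> space F. \<forall>n\<ge>N. \<bar>f n z\<bar> \<le> real N}" for N :: nat
  note f[measurable] g[measurable]
  have BF[measurable]: "B N \<in> sets F" for N unfolding B_def by measurable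
  have FM: "A \<in> sets M" if "A \<in> sets F" for A using that subalg by (auto simp: subalgebra_def)
  have sp: "space F = space M" using subalg by (simp add: subalgebra_def)
  have fM: "f n \<in> borel_measurable M" and gM: "g \<in> borel_measurable M" for n
    by (rule measurable_from_subalg[OF subalg f], rule measurable_from_subalg[OF subalg g])
  have step: "(\<integral>z. indicator A z * g z \<partial>M) = (\<integral>z. indicator A z * \<phi> z \<partial>M)
      \<and> integrable M (\<lambda>z. indicator A z * g z)"
    if A: "A \<in> sets F" "A \<subseteq> B N" for A N
  proof -
    have Am[measurable]: "A \<in> sets M" using FM A by blast
    have dom: "AE z in M. norm (indicator A z * f (n + N) z) \<le> real N" for n
      using A(2) by (intro AE_I2) (auto simp: indicator_def B_def)
    have lim': "AE z in M. (\<lambda>n. indicator A z * f (n + N) z) \<longlonglongrightarrow> indicator A z * g z"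
      using lim by eventually_elim (intro tendsto_mult tendsto_const LIMSEQ_ignore_initial_segment)
    have m: "(\<lambda>z. indicator A z * g z) \<in> borel_measurable M"
      "(\<lambda>z. indicator A z * f (n + N) z) \<in> borel_measurable M" for n
      using fM gM by auto
    have "(\<lambda>n. \<integral>z. indicator A z * f (n + N) z \<partial>M) \<longlonglongrightarrow> (\<integral>z. indicator A z * g z \<partial>M)"
      by (rule integral_dominated_convergence[OF m _ lim' dom]) simp
    moreover have "(\<lambda>n. \<integral>z. indicator A z * f (n + N) z \<partial>M) \<longlonglongrightarrow> (\<integral>z. indicator A z * \<phi> z \<partial>M)"
      by (rule LIMSEQ_ignore_initial_segment[OF int[OF A(1)]])
    moreover have "integrable M (\<lambda>z. indicator A z * g z)"
      by (rule integrable_dominated_convergence[OF m _ lim' dom]) simp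
    ultimately show ?thesis using LIMSEQ_unique by blast
  qed
  \<comment> \<open>So far \<open>g\<close> is known to be integrable only on each
    \<open>B N\<close>. The conditional expectation is therefore identified piece by piece, the
    indicator being measurable for \<open>F\<close>.\<close>
  have "AE z in M. indicator (B N) z * real_cond_exp M F \<phi> z = indicator (B N) z * g z" for N
  proof -
    have i: "integrable M (\<lambda>z. indicator (B N) z * \<phi> z)"
      using integrable_mult_indicator[OF FM[OF BF] phi] by simp
    have "AE z in M. real_cond_exp M F (\<lambda>z. indicator (B N) z * \<phi> z) z = indicator (B N) z * g z"
    proof (rule real_cond_exp_charact)
      fix A assume A: "A \<in> sets F"
      have "A \<inter> B N \<in> sets F" using A by auto
      from step[OF this, of N]
      show "(\<integral>z\<in>A. indicator (B N) z * \<phi> z \<partial>M) = (\<integral>z\<in>A. indicator (B N) z * g z \<partial>M)"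
        by (simp add: set_lebesgue_integral_def indicator_inter_arith mult.assoc)
    next
      show "integrable M (\<lambda>z. indicator (B N) z * g z)" using step[of "B N" N] by simp
      show "(\<lambda>z. indicator (B N) z * g z) \<in> borel_measurable F" by measurable
    qed (rule i)
    moreover have "AE z in M. real_cond_exp M F (\<lambda>z. indicator (B N) z * \<phi> z) z
        = indicator (B N) z * real_cond_exp M F \<phi> z"
      by (rule real_cond_exp_mult[OF _ borel_measurable_integrable[OF phi] i]) simp
    ultimately show ?thesis by eventually_elim simp
  qed
  then have "AE z in M. \<forall>N. indicator (B N) z * real_cond_exp M F \<phi> z = indicator (B N) z * g z"
    by (subst AE_all_countable) blast
  moreover have "AE z in M. \<exists>N. z \<in> B N"
    using lim AE_space
  proof eventually_elim
    case (elim z)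
    then obtain K where K: "\<And>n. \<bar>f n z\<bar> \<le> K"
      using convergent_imp_Bseq[OF convergentI] by (fastforce simp: Bseq_def)
    have "\<bar>f n z\<bar> \<le> real (nat \<lceil>K\<rceil>)" for n
      using K[of n] by (rule order_trans) linarith
    then show ?case using elim sp by (auto simp: B_def)
  qed
  ultimately show ?thesis
  proof eventually_elim
    case (elim z)
    then obtain N where "z \<in> B N" by blast
    then show ?case using spec[OF elim(1), of N] by simp
  qed
qed

end

section \<open>Square roots of densities\<close>

lemma borel_measurable_root_density: "root_density M N \<in> borel_measurable M"
  unfolding root_density_def by measurable

text \<open>The derivative of a finite measure is finite almost everywhere, so passing to real
  values before taking the root changes it only on a null set.\<close>

lemma (in sigma_finite_measure) density_root_density:
  assumes N: "prob_space N" "absolutely_continuous M N" "sets N = sets M"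
  shows "density M (\<lambda>z. ennreal ((root_density M N z)\<^sup>2)) = N"
proof -
  interpret N: prob_space N by fact
  have "AE z in M. RN_deriv M N z \<noteq> \<infinity>"
    by (rule RN_deriv_finite[OF N.sigma_finite_measure_axioms N(2,3)])
  then have "AE z in M. ennreal ((root_density M N z)\<^sup>2) = RN_deriv M N z"
    by eventually_elim (simp add: root_density_def ennreal_enn2real_if)
  then have "density M (\<lambda>z. ennreal ((root_density M N z)\<^sup>2)) = density M (RN_deriv M N)"
    using borel_measurable_root_density[of M N] by (intro density_cong) auto
  then show ?thesis using density_RN_deriv[OF N(2,3)] by simp
qed

lemma (in sigma_finite_measure) integral_root_density:
  fixes f :: "'a \<Rightarrow> real"
  assumes N: "prob_space N" "absolutely_continuous M N" "sets N = sets M"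
    and f: "f \<in> borel_measurable M"
  shows "(\<integral>z. f z \<partial>N) = (\<integral>z. f z * (root_density M N z)\<^sup>2 \<partial>M)"
    and "integrable N f \<longleftrightarrow> integrable M (\<lambda>z. f z * (root_density M N z)\<^sup>2)"
  using integral_density[OF f, of "\<lambda>z. (root_density M N z)\<^sup>2"]
    integrable_density[OF f, of "\<lambda>z. (root_density M N z)\<^sup>2"]
    borel_measurable_root_density[of M N]
  unfolding density_root_density[OF N] by (simp_all add: mult.commute)

text \<open>Multiplication by the root density is an isometry into \<open>L2 M\<close>. It places
  functions living under different laws of the model in one space, where their limits can be
  compared.\<close>

lemma (in sigma_finite_measure) L2_root_density:
  fixes f :: "'a \<Rightarrow> real"
  assumes N: "prob_space N" "absolutely_continuous M N" "sets N = sets M"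
    and f: "f \<in> L2 N"
  shows "(\<lambda>z. f z * root_density M N z) \<in> L2 M"
    and "l2_norm M (\<lambda>z. f z * root_density M N z) = l2_norm N f"
proof -
  have m: "f \<in> borel_measurable M"
    using L2D(1)[OF f] measurable_cong_sets[OF N(3) refl] by blast
  have e: "(f z * root_density M N z)\<^sup>2 = (f z)\<^sup>2 * (root_density M N z)\<^sup>2" for z
    by (simp add: power_mult_distrib)
  have m2: "(\<lambda>z. (f z)\<^sup>2) \<in> borel_measurable M" using m by auto
  show "(\<lambda>z. f z * root_density M N z) \<in> L2 M"
    using L2D(2)[OF f] m borel_measurable_root_density[of M N] integral_root_density(2)[OF N m2]
    by (simp add: L2_def e)
  show "l2_norm M (\<lambda>z. f z * root_density M N z) = l2_norm N f"
    using integral_root_density(1)[OF N m2]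
    by (simp add: l2_norm_def l2_inner_def e power2_eq_square[symmetric])
qed

lemma l2_norm_mono:
  assumes h: "h \<in> L2 M" and f: "f \<in> borel_measurable M" and le: "\<And>z. norm (f z) \<le> norm (h z)"
  shows "f \<in> L2 M" "l2_norm M f \<le> l2_norm M h"
proof -
  show fL: "f \<in> L2 M" by (rule L2_dominated[OF h f, of 1]) (simp add: le)
  show "l2_norm M f \<le> l2_norm M h"
    unfolding l2_norm_def l2_inner_def power2_norm_eq_inner[symmetric]
    by (intro real_sqrt_le_mono integral_mono L2D[OF fL] L2D[OF h] power_mono le) simp
qed

section \<open>Difference quotients along a ray and the score identity\<close>

lemma has_derivative_along_sequence:
  fixes f :: "'a::real_normed_vector \<Rightarrow> 'b::real_normed_vector"
  assumes f: "(f has_derivative f') (at x within A)" and a: "norm a = 1" and t: "\<And>n. t n > 0"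
    and lim: "filterlim (\<lambda>n. x + t n *\<^sub>R a) (at x within A) sequentially"
  shows "(\<lambda>n. (f (x + t n *\<^sub>R a) - f x) /\<^sub>R t n) \<longlonglongrightarrow> f' a"
proof -
  have bl: "bounded_linear f'" and d: "((\<lambda>y. ((f y - f x) - f' (y - x)) /\<^sub>R norm (y - x)) \<longlongrightarrow> 0) (at x within A)"
    using f by (auto simp: has_derivative_at_within)
  have "(\<lambda>n. ((f (x + t n *\<^sub>R a) - f x) - f' (x + t n *\<^sub>R a - x)) /\<^sub>R norm (x + t n *\<^sub>R a - x)) \<longlonglongrightarrow> 0"
    by (rule filterlim_compose[OF d lim])
  moreover have "((f (x + t n *\<^sub>R a) - f x) - f' (x + t n *\<^sub>R a - x)) /\<^sub>R norm (x + t n *\<^sub>R a - x)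
      = (f (x + t n *\<^sub>R a) - f x) /\<^sub>R t n - f' a" for n
    using t[of n] a linear_scale[OF bounded_linear.linear[OF bl]]
    by (simp add: scaleR_diff_right)
  ultimately show ?thesis by (simp add: LIM_zero_iff)
qed

text \<open>A ray that stays in \<open>A\<close> near \<open>x\<close> turns limits within
  \<open>A\<close> into limits of a sequence. Properties valid near \<open>x\<close> are arranged to
  hold at every index.\<close>

lemma direction_sequence:
  fixes x a :: "'a::real_normed_vector"
  assumes a: "a \<noteq> 0" and dir: "\<forall>\<^sub>F t in at_right (0::real). x + t *\<^sub>R a \<in> A"
    and ev: "\<forall>\<^sub>F y in at x within A. Q y"
  obtains t :: "nat \<Rightarrow> real" where "\<And>n. t n > 0" "t \<longlonglongrightarrow> 0" "\<And>n. x + t n *\<^sub>R a \<in> A"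
    "\<And>n. Q (x + t n *\<^sub>R a)" "filterlim (\<lambda>n. x + t n *\<^sub>R a) (at x within A) sequentially"
proof -
  have lim: "filterlim (\<lambda>t. x + t *\<^sub>R a) (at x within A) (at_right 0)"
    unfolding filterlim_at
  proof
    have "((\<lambda>t. x + t *\<^sub>R a) \<longlongrightarrow> x + 0 *\<^sub>R a) (at_right 0)"
      by (intro tendsto_intros)
    then show "((\<lambda>t. x + t *\<^sub>R a) \<longlongrightarrow> x) (at_right 0)" by simp
    show "\<forall>\<^sub>F t in at_right 0. x + t *\<^sub>R a \<in> A \<and> x + t *\<^sub>R a \<noteq> x"
      using dir eventually_at_right_less[of 0] by eventually_elim (use a in auto)
  qed
  have "\<forall>\<^sub>F t in at_right 0. Q (x + t *\<^sub>R a)"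
    by (rule eventually_compose_filterlim[OF ev lim])
  with dir have "\<forall>\<^sub>F t in at_right 0. x + t *\<^sub>R a \<in> A \<and> Q (x + t *\<^sub>R a)" by eventually_elim simp
  then obtain b where b: "b > 0" "\<And>t. 0 < t \<Longrightarrow> t < b \<Longrightarrow> x + t *\<^sub>R a \<in> A \<and> Q (x + t *\<^sub>R a)"
    unfolding eventually_at_right_field by auto
  \<comment> \<open>The shift by 2 keeps \<open>t n\<close> strictly below \<open>b\<close> already
    for \<open>n = 0\<close>.\<close>
  define t where "t n = b / real (n + 2)" for n
  have t: "t n > 0" "t n < b" for n
    using b(1) by (auto simp: t_def field_simps intro: add_pos_nonneg)
  have "(\<lambda>n. b / real n) \<longlonglongrightarrow> 0" by (rule lim_const_over_n)
  then have t0: "t \<longlonglongrightarrow> 0" unfolding t_def by (rule LIMSEQ_ignore_initial_segment)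
  have "filterlim t (at_right 0) sequentially"
    unfolding filterlim_at using t(1) t0 by (auto simp: less_imp_neq[symmetric])
  from filterlim_compose[OF lim this] show ?thesis
    using that t t0 b by blast
qed

text \<open>Differentiates \<open>E\<^sub>\<theta>[g(Z,\<theta>) | F] = 0\<close> at \<open>\<theta>0\<close>.\<close>

lemma score_jacobian:
  fixes g :: "'a \<Rightarrow> real ^ 'd \<Rightarrow> real ^ 'm" and S :: "'a \<Rightarrow> real ^ 'd"
  assumes mu: "sigma_finite_measure \<mu>" and sub: "subalgebra \<mu> F" and "\<theta>0 \<in> \<Theta>"
    and law: "\<And>\<theta>. \<theta> \<in> \<Theta> \<Longrightarrow> prob_space (Pth \<theta>)" "\<And>\<theta>. \<theta> \<in> \<Theta> \<Longrightarrow> sets (Pth \<theta>) = sets \<mu>"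
      "\<And>\<theta>. \<theta> \<in> \<Theta> \<Longrightarrow> absolutely_continuous \<mu> (Pth \<theta>)"
    and mom: "\<And>\<theta>. \<theta> \<in> \<Theta> \<Longrightarrow> moment_restriction (Pth \<theta>) F (\<lambda>z. g z \<theta>)"
    and dir: "\<And>a. \<forall>\<^sub>F t in at_right (0::real). \<theta>0 + t *\<^sub>R a \<in> \<Theta>"
    and score: "is_theta_score \<mu> \<Theta> \<theta>0 Pth S"
    and jac: "cond_jacobian (Pth \<theta>0) F \<Theta> \<theta>0 g D"
    and reg: "quadratic_mean_regular (Pth \<theta>0) \<Theta> \<theta>0 Pth g"
  shows "AE z in Pth \<theta>0. cond_exp_mat (Pth \<theta>0) F (\<lambda>x. outer (S x) (g x \<theta>0)) z = - transpose (D z)"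
proof -
  define P0 where "P0 = Pth \<theta>0"
  interpret mu: sigma_finite_measure \<mu> by (rule mu)
  have subP: "finite_measure_subalgebra (Pth \<theta>) F" if "\<theta> \<in> \<Theta>" for \<theta>
  proof -
    interpret prob_space "Pth \<theta>" by (rule law(1)[OF that])
    show ?thesis
      using sub law(2)[OF that] sets_eq_imp_space_eq[OF law(2)[OF that]]
      by unfold_locales (simp add: subalgebra_def)
  qed
  interpret P0: finite_measure_subalgebra P0 F using subP[OF \<open>\<theta>0 \<in> \<Theta>\<close>] by (simp add: P0_def)
  have P0: "prob_space P0" "absolutely_continuous \<mu> P0" "sets P0 = sets \<mu>"
    using law \<open>\<theta>0 \<in> \<Theta>\<close> by (simp_all add: P0_def)
  define r0 where "r0 = root_density \<mu> P0"
  have S: "S \<in> L2 P0" using score by (simp add: is_theta_score_def P0_def)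
  have g0: "(\<lambda>z. g z \<theta>0) \<in> L2 P0" using reg by (simp add: quadratic_mean_regular_def P0_def)
  have gev: "\<forall>\<^sub>F \<theta> in at \<theta>0 within \<Theta>. (\<lambda>z. g z \<theta>) \<in> L2 P0"
    and glim: "((\<lambda>\<theta>. l2_dist P0 (\<lambda>z. g z \<theta>) (\<lambda>z. g z \<theta>0)) \<longlongrightarrow> 0) (at \<theta>0 within \<Theta>)"
    using reg by (simp_all add: quadratic_mean_regular_def P0_def)
  obtain C where gC: "\<forall>\<^sub>F \<theta> in at \<theta>0 within \<Theta>.
        (\<lambda>z. g z \<theta>) \<in> L2 (Pth \<theta>) \<and> (\<integral>z. (norm (g z \<theta>))\<^sup>2 \<partial>Pth \<theta>) \<le> C"
    using reg by (auto simp: quadratic_mean_regular_def)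
  obtain m where mF: "\<And>\<theta>. \<theta> \<in> \<Theta> \<Longrightarrow> m \<theta> \<in> borel_measurable F"
    and m: "\<And>\<theta>. \<theta> \<in> \<Theta> \<Longrightarrow> AE z in P0. m \<theta> z = cond_exp_vec P0 F (\<lambda>x. g x \<theta>) z"
    and mD: "AE z in P0. ((\<lambda>\<theta>. m \<theta> z) has_derivative (\<lambda>h. D z *v h)) (at \<theta>0 within \<Theta>)"
    using jac unfolding cond_jacobian_def P0_def by blast
  have DF: "D \<in> borel_measurable F" using jac by (simp add: cond_jacobian_def)
  have one: "(\<lambda>_. 1::real) \<in> L2 N" if "prob_space N" for N :: "'a measure"
  proof -
    interpret prob_space N by fact
    show ?thesis by (simp add: L2_def)
  qed
  have main: "AE z in P0. real_cond_exp P0 F (\<lambda>z. - (S z $ k * g z \<theta>0 $ l)) z = D z $ l $ k" for k l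
  proof -
    \<comment> \<open>A coordinate direction isolates column \<open>k\<close> of the Jacobian; its
      unit length makes \<open>t n\<close> the step size.\<close>
    let ?a = "axis k 1 :: real ^ 'd"
    have "?a \<noteq> 0" by (simp add: axis_eq_0_iff)
    moreover have "\<forall>\<^sub>F \<theta> in at \<theta>0 within \<Theta>. (\<lambda>z. g z \<theta>) \<in> L2 P0 \<and>
        (\<lambda>z. g z \<theta>) \<in> L2 (Pth \<theta>) \<and> (\<integral>z. (norm (g z \<theta>))\<^sup>2 \<partial>Pth \<theta>) \<le> C"
      using gev gC by eventually_elim simp
    ultimately obtain t where t: "\<And>n. t n > 0" "t \<longlonglongrightarrow> 0" and th: "\<And>n. \<theta>0 + t n *\<^sub>R ?a \<in> \<Theta>"
      and Q: "\<And>n. (\<lambda>z. g z (\<theta>0 + t n *\<^sub>R ?a)) \<in> L2 P0 \<and> (\<lambda>z. g z (\<theta>0 + t n *\<^sub>R ?a)) \<in> L2 (Pth (\<theta>0 + t n *\<^sub>R ?a))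
         \<and> (\<integral>z. (norm (g z (\<theta>0 + t n *\<^sub>R ?a)))\<^sup>2 \<partial>Pth (\<theta>0 + t n *\<^sub>R ?a)) \<le> C"
      and lim: "filterlim (\<lambda>n. \<theta>0 + t n *\<^sub>R ?a) (at \<theta>0 within \<Theta>) sequentially"
      by (rule direction_sequence[OF _ dir]) (blast intro: that)
    define \<theta> where "\<theta> n = \<theta>0 + t n *\<^sub>R ?a" for n
    define P where "P n = Pth (\<theta> n)" for n
    define r where "r n = root_density \<mu> (P n)" for n
    have \<theta>: "\<theta> n \<in> \<Theta>" for n using th by (simp add: \<theta>_def)
    have gL: "(\<lambda>z. g z (\<theta> n)) \<in> L2 P0" "(\<lambda>z. g z (\<theta> n)) \<in> L2 (P n)"
      "(\<integral>z. (norm (g z (\<theta> n)))\<^sup>2 \<partial>P n) \<le> C" for n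
      using Q[of n] by (simp_all add: \<theta>_def P_def)
    have P: "prob_space (P n)" "absolutely_continuous \<mu> (P n)" "sets (P n) = sets \<mu>" for n
      using law \<theta> by (simp_all add: P_def)
    have rL: "r n \<in> L2 \<mu>" and r0L: "r0 \<in> L2 \<mu>" for n
      using mu.L2_root_density(1)[OF P one[OF P(1)], of n] mu.L2_root_density(1)[OF P0 one[OF P0(1)]]
      by (simp_all add: r_def r0_def)
    have meas: "f \<in> borel_measurable \<mu>" if "f \<in> borel_measurable P0" for f :: "'a \<Rightarrow> real"
      using that measurable_cong_sets[OF P0(3) refl] by blast
    have wm: "(\<lambda>z. S z $ k) \<in> borel_measurable \<mu>"
      by (rule meas[OF L2D(1)[OF L2_nth[OF S]]])
    have wr: "(\<lambda>z. S z $ k * r0 z) \<in> L2 \<mu>"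
      using mu.L2_root_density(1)[OF P0 L2_nth[OF S]] by (simp add: r0_def)
    have qmd: "(\<lambda>n. l2_dist \<mu> (\<lambda>z. (r n z - r0 z) / t n) (\<lambda>z. S z $ k * r0 z / 2)) \<longlonglongrightarrow> 0"
    proof -
      have "((\<lambda>\<theta>. \<integral>\<^sup>+z. ennreal (((root_density \<mu> (Pth \<theta>) z - root_density \<mu> (Pth \<theta>0) z
                             - 1 / 2 * ((\<theta> - \<theta>0) \<bullet> S z) * root_density \<mu> (Pth \<theta>0) z)
                            / norm (\<theta> - \<theta>0))\<^sup>2) \<partial>\<mu>) \<longlongrightarrow> 0) (at \<theta>0 within \<Theta>)"
        using score by (simp add: is_theta_score_def)
      from filterlim_compose[OF this lim]
      have "(\<lambda>n. \<integral>\<^sup>+z. ennreal (((r n z - r0 z - 1 / 2 * ((\<theta> n - \<theta>0) \<bullet> S z) * r0 z)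
                            / norm (\<theta> n - \<theta>0))\<^sup>2) \<partial>\<mu>) \<longlonglongrightarrow> 0"
        by (simp add: r_def r0_def P_def P0_def \<theta>_def)
      moreover have "(\<integral>\<^sup>+z. ennreal (((r n z - r0 z - 1 / 2 * ((\<theta> n - \<theta>0) \<bullet> S z) * r0 z)
          / norm (\<theta> n - \<theta>0))\<^sup>2) \<partial>\<mu>)
          = ennreal ((l2_dist \<mu> (\<lambda>z. (r n z - r0 z) / t n) (\<lambda>z. S z $ k * r0 z / 2))\<^sup>2)" for n
      proof -
        have eq: "(r n z - r0 z - 1 / 2 * ((\<theta> n - \<theta>0) \<bullet> S z) * r0 z) / norm (\<theta> n - \<theta>0)
            = (r n z - r0 z) / t n - S z $ k * r0 z / 2" for z
        proof -
          have "norm (\<theta> n - \<theta>0) = t n" using t(1)[of n] by (simp add: \<theta>_def)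
          moreover have "(\<theta> n - \<theta>0) \<bullet> S z = t n * S z $ k" by (simp add: \<theta>_def inner_axis')
          ultimately show ?thesis using t(1)[of n] by (simp add: field_simps)
        qed
        have "(\<lambda>z. (r n z - r0 z) / t n - S z $ k * r0 z / 2) \<in> L2 \<mu>"
          using L2_diff[OF L2_scaleR[OF L2_diff[OF rL[of n] r0L], of "1 / t n"] L2_scaleR[OF wr, of "1/2"]]
          by simp
        from L2D(2)[OF this] show ?thesis
          unfolding eq l2_dist_def by (subst nn_integral_eq_integral) auto
      qed
      ultimately have "(\<lambda>n. ennreal ((l2_dist \<mu> (\<lambda>z. (r n z - r0 z) / t n) (\<lambda>z. S z $ k * r0 z / 2))\<^sup>2))
          \<longlonglongrightarrow> ennreal 0" by simp
      then have "(\<lambda>n. (l2_dist \<mu> (\<lambda>z. (r n z - r0 z) / t n) (\<lambda>z. S z $ k * r0 z / 2))\<^sup>2) \<longlonglongrightarrow> 0"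
        by (subst (asm) tendsto_ennreal_iff) auto
      from tendsto_real_sqrt[OF this] show ?thesis by (simp add: l2_dist_def)
    qed
    \<comment> \<open>Since \<open>m \<theta>0\<close> vanishes almost surely, this is the
      difference quotient of the conditional moment.\<close>
    define f where "f n z = m (\<theta> n) z $ l / t n" for n z
    have "AE z in P0. real_cond_exp P0 F (\<lambda>z. - (S z $ k * g z \<theta>0 $ l)) z = D z $ l $ k"
    proof (rule P0.AE_real_cond_exp_eq_limit)
      show "f n \<in> borel_measurable F" for n
        unfolding f_def using borel_measurable_vec_nth[OF mF[OF \<theta>]] by auto
      show "(\<lambda>z. D z $ l $ k) \<in> borel_measurable F" by (rule borel_measurable_mat_nth[OF DF])
      show "integrable P0 (\<lambda>z. - (S z $ k * g z \<theta>0 $ l))"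
        using L2_mult_integrable[OF L2_nth[OF S] L2_nth[OF g0]] by simp
      have "AE z in P0. cond_exp_vec P0 F (\<lambda>x. g x \<theta>0) z = 0"
        using mom[OF \<open>\<theta>0 \<in> \<Theta>\<close>] unfolding moment_restriction_def P0_def by blast
      with mD m[OF \<open>\<theta>0 \<in> \<Theta>\<close>]
      show "AE z in P0. (\<lambda>n. f n z) \<longlonglongrightarrow> D z $ l $ k"
      proof eventually_elim
        case (elim z)
        have "(\<lambda>n. (m (\<theta>0 + t n *\<^sub>R ?a) z - m \<theta>0 z) /\<^sub>R t n) \<longlonglongrightarrow> D z *v ?a"
          by (rule has_derivative_along_sequence[OF elim(1) _ t(1) lim]) simp
        then have "(\<lambda>n. ((m (\<theta>0 + t n *\<^sub>R ?a) z - m \<theta>0 z) /\<^sub>R t n) $ l) \<longlonglongrightarrow> (D z *v ?a) $ l"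
          by (rule tendsto_vec_nth)
        moreover have "(D z *v ?a) $ l = D z $ l $ k"
          by (simp add: matrix_vector_mul_component inner_axis)
        ultimately show ?case using elim by (simp add: f_def \<theta>_def divide_inverse mult.commute)
      qed
      fix A assume A: "A \<in> sets F"
      have AM: "A \<in> sets \<mu>" using A sub by (auto simp: subalgebra_def)
      \<comment> \<open>With the indicator of \<open>A\<close> absorbed into the function, integrals
        over conditioning events become unconditional moments.\<close>
      define G where "G n z = indicator A z * g z (\<theta> n) $ l" for n z
      define G0 where "G0 z = indicator A z * g z \<theta>0 $ l" for z
      have ind_le: "norm (indicator A z * v $ l) \<le> norm v" for z :: 'a and v :: "real ^ 'm"
        using component_le_norm_cart[of v l] by (simp add: indicator_def)
      have ind_L2: "(\<lambda>z. indicator A z * f z $ l) \<in> L2 N"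
          "l2_norm N (\<lambda>z. indicator A z * f z $ l) \<le> l2_norm N f"
        if "f \<in> L2 N" "sets N = sets \<mu>" for f :: "'a \<Rightarrow> real ^ 'm" and N
      proof -
        have "A \<in> sets N" using that(2) AM by simp
        then have "(\<lambda>z. indicator A z * f z $ l) \<in> borel_measurable N"
          using L2D(1)[OF L2_nth[OF that(1), of l]] by auto
        from l2_norm_mono[OF that(1) this ind_le]
        show "(\<lambda>z. indicator A z * f z $ l) \<in> L2 N"
          "l2_norm N (\<lambda>z. indicator A z * f z $ l) \<le> l2_norm N f" by auto
      qed
      have GL: "G n \<in> L2 P0" "G n \<in> L2 (P n)" and G0L: "G0 \<in> L2 P0" for n
        using ind_L2(1)[OF gL(1) P0(3)] ind_L2(1)[OF gL(2) P(3)] ind_L2(1)[OF g0 P0(3)]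
        by (simp_all add: G_def[abs_def] G0_def[abs_def])
      have Gm: "G n \<in> borel_measurable \<mu>" and G0m: "G0 \<in> borel_measurable \<mu>" for n
        by (rule meas[OF L2D(1)[OF GL(1)]], rule meas[OF L2D(1)[OF G0L]])
      \<comment> \<open>Here \<open>w\<close> is the \<open>k\<close>-th score component: the moment
        of \<open>G n\<close> under \<open>P0\<close> is compared with its vanishing moment under
        \<open>P n\<close>.\<close>
      have "(\<lambda>n. (\<integral>z. G n z * (r0 z)\<^sup>2 \<partial>\<mu>) / t n) \<longlonglongrightarrow> - (\<integral>z. S z $ k * G0 z * (r0 z)\<^sup>2 \<partial>\<mu>)"
      proof (rule qmd_moment_limit[OF rL r0L wm wr t qmd])
        show "(\<lambda>z. G n z * r n z) \<in> L2 \<mu>" for n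
          using mu.L2_root_density(1)[OF P GL(2)] by (simp add: r_def)
        show "l2_norm \<mu> (\<lambda>z. G n z * r n z) \<le> sqrt C" for n
        proof -
          have "l2_norm \<mu> (\<lambda>z. G n z * r n z) = l2_norm (P n) (G n)"
            using mu.L2_root_density(2)[OF P GL(2)] by (simp add: r_def)
          also have "\<dots> \<le> l2_norm (P n) (\<lambda>z. g z (\<theta> n))"
            using ind_L2(2)[OF gL(2) P(3), of n] by (simp add: G_def[abs_def])
          also have "\<dots> \<le> sqrt C"
            using gL(3)[of n] by (simp add: l2_norm_def l2_inner_def power2_norm_eq_inner)
          finally show ?thesis .
        qed
        show "(\<lambda>z. G n z * r0 z) \<in> L2 \<mu>" "(\<lambda>z. G0 z * r0 z) \<in> L2 \<mu>" for n
          using mu.L2_root_density(1)[OF P0 GL(1)] mu.L2_root_density(1)[OF P0 G0L]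
          by (simp_all add: r0_def)
        show "(\<lambda>n. l2_dist \<mu> (\<lambda>z. G n z * r0 z) (\<lambda>z. G0 z * r0 z)) \<longlonglongrightarrow> 0"
        proof (rule tendsto_sandwich[OF _ _ tendsto_const filterlim_compose[OF glim lim]])
          have "l2_dist \<mu> (\<lambda>z. G n z * r0 z) (\<lambda>z. G0 z * r0 z)
              \<le> l2_dist P0 (\<lambda>z. g z (\<theta> n)) (\<lambda>z. g z \<theta>0)" for n
          proof -
            have "l2_dist \<mu> (\<lambda>z. G n z * r0 z) (\<lambda>z. G0 z * r0 z) = l2_norm P0 (\<lambda>z. G n z - G0 z)"
              using mu.L2_root_density(2)[OF P0 L2_diff[OF GL(1) G0L]]
              by (simp add: l2_dist_eq_norm r0_def left_diff_distrib)
            also have "(\<lambda>z. G n z - G0 z) = (\<lambda>z. indicator A z * (g z (\<theta> n) - g z \<theta>0) $ l)"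
              by (auto simp: G_def G0_def algebra_simps)
            also have "l2_norm P0 \<dots> \<le> l2_norm P0 (\<lambda>z. g z (\<theta> n) - g z \<theta>0)"
              by (rule ind_L2(2)[OF L2_diff[OF gL(1) g0] P0(3)])
            finally show ?thesis by (simp add: l2_dist_eq_norm)
          qed
          then show "\<forall>\<^sub>F n in sequentially. l2_dist \<mu> (\<lambda>z. G n z * r0 z) (\<lambda>z. G0 z * r0 z)
              \<le> l2_dist P0 (\<lambda>z. g z (\<theta>0 + t n *\<^sub>R ?a)) (\<lambda>z. g z \<theta>0)"
            by (simp add: \<theta>_def)
        qed (simp add: l2_dist_eq_norm l2_norm_nonneg)
        \<comment> \<open>The restriction at \<open>\<theta> n\<close> holds under the law
          \<open>P n\<close>, whereas the quotient \<open>f n\<close> is formed under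
          \<open>P0\<close>.\<close>
        show "(\<integral>z. G n z * (r n z)\<^sup>2 \<partial>\<mu>) = 0" for n
        proof -
          interpret Pn: finite_measure_subalgebra "P n" F using subP[OF \<theta>] by (simp add: P_def)
          have mr: "AE z in P n. cond_exp_vec (P n) F (\<lambda>z. g z (\<theta> n)) z = 0"
            using mom[OF \<theta>] unfolding moment_restriction_def P_def by blast
          have int: "integrable (P n) (\<lambda>z. g z (\<theta> n) $ l)"
            using L2_mult_integrable[OF L2_nth[OF gL(2)] one[OF P(1)]] by simp
          have "(\<integral>z. G n z * (r n z)\<^sup>2 \<partial>\<mu>) = (\<integral>z. G n z \<partial>P n)"
            using mu.integral_root_density(1)[OF P Gm] by (simp add: r_def)
          also have "\<dots> = (\<integral>z. indicator A z * real_cond_exp (P n) F (\<lambda>z. g z (\<theta> n) $ l) z \<partial>P n)"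
            using Pn.real_cond_exp_intA[OF int A] by (simp add: set_lebesgue_integral_def G_def)
          also have "\<dots> = 0"
            by (rule integral_eq_zero_AE, use mr in eventually_elim)
              (simp add: cond_exp_vec_def vec_eq_iff)
          finally show ?thesis .
        qed
      qed
      moreover have "(\<integral>z. G n z * (r0 z)\<^sup>2 \<partial>\<mu>) / t n = (\<integral>z. indicator A z * f n z \<partial>P0)" for n
      proof -
        have int: "integrable P0 (\<lambda>z. g z (\<theta> n) $ l)"
          using L2_mult_integrable[OF L2_nth[OF gL(1)] one[OF P0(1)]] by simp
        have AP: "A \<in> sets P0" using AM P0(3) by simp
        have mm: "m (\<theta> n) \<in> borel_measurable P0"
          by (rule measurable_from_subalg[OF P0.subalg mF[OF \<theta>]])
        have "(\<integral>z. G n z * (r0 z)\<^sup>2 \<partial>\<mu>) = (\<integral>z. G n z \<partial>P0)"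
          using mu.integral_root_density(1)[OF P0 Gm] by (simp add: r0_def)
        also have "\<dots> = (\<integral>z. indicator A z * real_cond_exp P0 F (\<lambda>z. g z (\<theta> n) $ l) z \<partial>P0)"
          using P0.real_cond_exp_intA[OF int A] by (simp add: set_lebesgue_integral_def G_def)
        also have "\<dots> = (\<integral>z. indicator A z * m (\<theta> n) z $ l \<partial>P0)"
        proof (rule integral_cong_AE)
          show "(\<lambda>z. indicator A z * m (\<theta> n) z $ l) \<in> borel_measurable P0"
            using AP borel_measurable_vec_nth[OF mm] by auto
          show "(\<lambda>z. indicator A z * real_cond_exp P0 F (\<lambda>z. g z (\<theta> n) $ l) z) \<in> borel_measurable P0"
            using AP by auto
          show "AE z in P0. indicator A z * real_cond_exp P0 F (\<lambda>z. g z (\<theta> n) $ l) z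
              = indicator A z * m (\<theta> n) z $ l"
            using m[OF \<theta>[of n]] by eventually_elim (simp add: cond_exp_vec_def)
        qed
        finally show ?thesis by (simp add: f_def)
      qed
      moreover have "- (\<integral>z. S z $ k * G0 z * (r0 z)\<^sup>2 \<partial>\<mu>) = (\<integral>z. indicator A z * - (S z $ k * g z \<theta>0 $ l) \<partial>P0)"
      proof -
        have "(\<integral>z. S z $ k * G0 z * (r0 z)\<^sup>2 \<partial>\<mu>) = (\<integral>z. S z $ k * G0 z \<partial>P0)"
          using mu.integral_root_density(1)[OF P0, of "\<lambda>z. S z $ k * G0 z"] wm G0m by (simp add: r0_def)
        then show ?thesis by (simp add: G0_def mult_ac)
      qed
      ultimately show "(\<lambda>n. \<integral>z. indicator A z * f n z \<partial>P0)
          \<longlonglongrightarrow> (\<integral>z. indicator A z * - (S z $ k * g z \<theta>0 $ l) \<partial>P0)" by simp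
    qed
    then show ?thesis .
  qed
  have "AE z in P0. \<forall>k\<in>UNIV. \<forall>l\<in>UNIV. real_cond_exp P0 F (\<lambda>z. S z $ k * g z \<theta>0 $ l) z = - (D z $ l $ k)"
  proof (intro AE_finite_allI finite)
    fix k l
    have "AE z in P0. real_cond_exp P0 F (\<lambda>z. - 1 * (S z $ k * g z \<theta>0 $ l)) z
        = - 1 * real_cond_exp P0 F (\<lambda>z. S z $ k * g z \<theta>0 $ l) z"
      by (rule P0.real_cond_exp_cmult[OF L2_mult_integrable[OF L2_nth[OF S] L2_nth[OF g0]]])
    with main[of k l]
    show "AE z in P0. real_cond_exp P0 F (\<lambda>z. S z $ k * g z \<theta>0 $ l) z = - (D z $ l $ k)"
      by eventually_elim simp
  qed
  then show ?thesis
    unfolding P0_def[symmetric]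
    by eventually_elim (simp add: vec_eq_iff cond_exp_mat_def outer_def transpose_def)
qed

section \<open>The iteration\<close>

lemma matrix_mult_uminus_left: "(- A) ** B = - (A ** (B :: real ^ 'k ^ 'n))"
  by (simp add: vec_eq_iff matrix_matrix_mult_def sum_negf)

lemma matrix_mult_diff_left: "(A - B) ** C = A ** C - B ** (C :: real ^ 'k ^ 'n)"
  by (simp add: vec_eq_iff matrix_matrix_mult_def left_diff_distrib sum_subtractf)

lemma matrix_mult_add_left: "(A + B) ** C = A ** C + B ** (C :: real ^ 'k ^ 'n)"
  by (simp add: vec_eq_iff matrix_matrix_mult_def distrib_right sum.distrib)

lemma matrix_vector_mult_uminus_left: "(- A) *v x = - (A *v (x :: real ^ 'n))"
  by (simp add: vec_eq_iff matrix_vector_mult_def sum_negf)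

lemma l2_inner_const_left:
  assumes "integrable M f"
  shows "l2_inner M (\<lambda>_. c) f = c \<bullet> (\<integral>x. f x \<partial>M)"
  using integral_inner_right[of c M f] assms by (simp add: l2_inner_def)

lemma l2_closure_mono: "U \<subseteq> V \<Longrightarrow> l2_closure M U \<subseteq> l2_closure M V"
  unfolding l2_closure_def by blast

lemma l2_closure_limit:
  assumes "y \<in> L2 M" "\<And>n. x n \<in> V" "(\<lambda>n. l2_dist M (x n) y) \<longlonglongrightarrow> 0"
  shows "y \<in> l2_closure M V"
  unfolding l2_closure_def
proof (intro CollectI conjI allI impI)
  fix e :: real assume "e > 0"
  then obtain n where "l2_dist M (x n) y < e"
    using LIMSEQ_D[OF assms(3), of e] by (auto simp: l2_dist_def)
  then show "\<exists>h\<in>V. l2_dist M y h < e" using assms(2) by (auto simp: l2_dist_commute[of M y])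
qed (rule assms(1))

context finite_measure_subalgebra
begin

lemma L2_integrable:
  assumes "f \<in> L2 M"
  shows "integrable M f"
proof (rule integrable_norm_cancel)
  show "integrable M (\<lambda>x. norm (f x))"
    by (rule square_integrable_imp_integrable[OF measurable_compose[OF L2D(1)[OF assms] borel_measurable_norm] L2D(2)[OF assms]])
qed (rule L2D(1)[OF assms])

lemma cond_exp_mat_outer_diff:
  fixes s t :: "'a \<Rightarrow> real ^ 'd" and h :: "'a \<Rightarrow> real ^ 'm"
  assumes s: "s \<in> L2 M" and t: "t \<in> L2 M" and h: "h \<in> L2 M"
  shows "AE z in M. cond_exp_mat M F (\<lambda>x. outer (s x - t x) (h x)) z
    = cond_exp_mat M F (\<lambda>x. outer (s x) (h x)) z - cond_exp_mat M F (\<lambda>x. outer (t x) (h x)) z"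
proof -
  have "AE z in M. \<forall>k\<in>UNIV. \<forall>l\<in>UNIV. real_cond_exp M F (\<lambda>x. s x $ k * h x $ l - t x $ k * h x $ l) z
      = real_cond_exp M F (\<lambda>x. s x $ k * h x $ l) z - real_cond_exp M F (\<lambda>x. t x $ k * h x $ l) z"
    by (intro AE_finite_allI finite real_cond_exp_diff L2_mult_integrable L2_nth s t h)
  then show ?thesis
    by eventually_elim (simp add: vec_eq_iff cond_exp_mat_def outer_def left_diff_distrib)
qed

lemma cond_exp_mat_outer_add:
  fixes s t :: "'a \<Rightarrow> real ^ 'd" and h :: "'a \<Rightarrow> real ^ 'm"
  assumes s: "s \<in> L2 M" and t: "t \<in> L2 M" and h: "h \<in> L2 M"
  shows "AE z in M. cond_exp_mat M F (\<lambda>x. outer (s x + t x) (h x)) z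
    = cond_exp_mat M F (\<lambda>x. outer (s x) (h x)) z + cond_exp_mat M F (\<lambda>x. outer (t x) (h x)) z"
proof -
  have "AE z in M. \<forall>k\<in>UNIV. \<forall>l\<in>UNIV. real_cond_exp M F (\<lambda>x. s x $ k * h x $ l + t x $ k * h x $ l) z
      = real_cond_exp M F (\<lambda>x. s x $ k * h x $ l) z + real_cond_exp M F (\<lambda>x. t x $ k * h x $ l) z"
    by (intro AE_finite_allI finite real_cond_exp_add L2_mult_integrable L2_nth s t h)
  then show ?thesis
    by eventually_elim (simp add: vec_eq_iff cond_exp_mat_def outer_def distrib_right)
qed

lemma cond_var_eq_second_moment:
  assumes "AE z in M. cond_exp_vec M F h z = 0"
  shows "AE z in M. cond_var M F h z = cond_exp_mat M F (\<lambda>x. outer (h x) (h x)) z"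
  using assms by eventually_elim (simp add: cond_var_def outer_def vec_eq_iff)

text \<open>Puts the projection in the form used by the iteration, with the conditional variance in
  place of the second moment; they agree because the conditional mean is zero.\<close>

lemma projection:
  fixes h :: "'a \<Rightarrow> real ^ 'm" and s :: "'a \<Rightarrow> real ^ 'd"
  assumes h: "h \<in> L2 M" and mean: "AE z in M. cond_exp_vec M F h z = 0" and G: "generalized_inverse G"
    and s: "s \<in> L2 M" and a: "a \<in> borel_measurable F"
    and eq: "AE z in M. a z = cond_exp_mat M F (\<lambda>x. outer (s x) (h x)) z ** G (cond_var M F h z)"
  shows "(\<lambda>z. a z *v h z) \<in> H_space M F h"
    and "\<And>t. t \<in> H_space M F h \<Longrightarrow> l2_inner M (\<lambda>z. s z - a z *v h z) t = 0"
proof -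
  have "AE z in M. G (cond_var M F h z) = G (cond_exp_mat M F (\<lambda>x. outer (h x) (h x)) z)"
    using cond_var_eq_second_moment[OF mean] by eventually_elim simp
  from cond_exp_mat_generalized_inverse[OF h s G this eq]
  have aV: "AE z in M. a z ** cond_exp_mat M F (\<lambda>x. outer (h x) (h x)) z
     = cond_exp_mat M F (\<lambda>x. outer (s x) (h x)) z" .
  show "(\<lambda>z. a z *v h z) \<in> H_space M F h"
    using projection_L2[OF h s a aV] a by (auto simp: H_space_def)
  show "l2_inner M (\<lambda>z. s z - a z *v h z) t = 0" if "t \<in> H_space M F h" for t
    by (rule projection_orthogonal[OF h s a aV that])
qed

end

lemma H_space_L2: "H_space M F h \<subseteq> L2 M"
  by (auto simp: H_space_def)

text \<open>Each half step refits one of the two components to \<open>S\<close> minus the other,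
  which makes the new residual orthogonal to the space just refitted; changes of a component stay in
  its space. These are the properties that alternating projections ask for.\<close>

lemma backfitting_converges:
  fixes h1 :: "'a \<Rightarrow> real ^ 'p1" and h2 :: "'a \<Rightarrow> real ^ 'p2" and S :: "'a \<Rightarrow> real ^ 'd"
  assumes M: "prob_space M" and sub: "subalgebra M F1" "subalgebra M F2"
    and h: "h1 \<in> L2 M" "h2 \<in> L2 M" and S: "S \<in> L2 M"
    and mean: "AE z in M. cond_exp_vec M F1 h1 z = 0" "AE z in M. cond_exp_vec M F2 h2 z = 0"
    and G: "generalized_inverse G1" "generalized_inverse G2"
    and D: "D1 \<in> borel_measurable F1" "D2 \<in> borel_measurable F2"
    and score: "AE z in M. cond_exp_mat M F1 (\<lambda>x. outer (S x) (h1 x)) z = - transpose (D1 z)"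
      "AE z in M. cond_exp_mat M F2 (\<lambda>x. outer (S x) (h2 x)) z = - transpose (D2 z)"
  defines "W1 \<equiv> (\<lambda>z. G1 (cond_var M F1 h1 z))" and "W2 \<equiv> (\<lambda>z. G2 (cond_var M F2 h2 z))"
  defines "A1 \<equiv> a1_iter M F1 F2 h1 h2 D1 D2 W1 W2" and "A2 \<equiv> a2_iter M F1 F2 h1 h2 D1 D2 W1 W2"
  obtains r where "r \<in> L2 M" "\<And>t. t \<in> H_space M F1 h1 \<Longrightarrow> l2_inner M r t = 0"
    "\<And>t. t \<in> H_space M F2 h2 \<Longrightarrow> l2_inner M r t = 0"
    "(\<lambda>m. l2_dist M (S_iter M F1 F2 h1 h2 D1 D2 W1 W2 m) (\<lambda>z. S z - r z)) \<longlonglongrightarrow> 0"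
    "\<And>m. (\<lambda>z. A1 m z *v h1 z) \<in> H_space M F1 h1" "\<And>m. (\<lambda>z. A2 m z *v h2 z) \<in> H_space M F2 h2"
proof -
  interpret prob_space M by fact
  interpret F1: finite_measure_subalgebra M F1 by unfold_locales fact
  interpret F2: finite_measure_subalgebra M F2 by unfold_locales fact
  have G_meas: "G1 \<in> borel_measurable borel" "G2 \<in> borel_measurable borel"
    using G by (simp_all add: generalized_inverse_def)
  have W: "W1 \<in> borel_measurable F1" "W2 \<in> borel_measurable F2"
    unfolding W1_def W2_def
    by (rule measurable_compose[OF borel_measurable_cond_var G_meas(1)],
        rule measurable_compose[OF borel_measurable_cond_var G_meas(2)])
  define p where "p m z = A1 m z *v h1 z" for m z
  define q where "q m z = A2 m z *v h2 z" for m z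
  define C where "C m = cond_exp_mat M F2 (\<lambda>y. outer (p m y) (h2 y))" for m
  have A2_eq: "A2 m z = - (transpose (D2 z) ** W2 z) - C m z ** W2 z" for m z
    by (simp add: A2_def a2_iter_def A1_def C_def p_def matrix_mult_outer)
  have A2F: "A2 m \<in> borel_measurable F2" for m
  proof -
    have "(\<lambda>z. - (transpose (D2 z) ** W2 z) - C m z ** W2 z) \<in> borel_measurable F2"
      unfolding C_def
      by (intro borel_measurable_diff borel_measurable_uminus borel_measurable_matrix_mult
          borel_measurable_transpose borel_measurable_cond_exp_mat D W)
    then show ?thesis using A2_eq[of m] by presburger
  qed
  have q_proj: "q m \<in> H_space M F2 h2"
      "\<And>t. t \<in> H_space M F2 h2 \<Longrightarrow> l2_inner M (\<lambda>z. S z - p m z - q m z) t = 0"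
    if p: "p m \<in> L2 M" for m
  proof -
    \<comment> \<open>The score identity reads \<open>- transpose (D2 z)\<close> as the conditional
      moment of \<open>S\<close> with \<open>h2\<close>, so \<open>A2 m\<close> is the projection
      coefficient of \<open>S - p m\<close>.\<close>
    have "AE z in M. A2 m z = cond_exp_mat M F2 (\<lambda>x. outer (S x - p m x) (h2 x)) z ** G2 (cond_var M F2 h2 z)"
      using score(2) F2.cond_exp_mat_outer_diff[OF S p h(2)]
      by eventually_elim (simp add: A2_eq C_def W2_def matrix_mult_diff_left matrix_mult_uminus_left)
    note pr = F2.projection[OF h(2) mean(2) G(2) L2_diff[OF S p] A2F this]
    show "q m \<in> H_space M F2 h2" using pr(1) by (simp add: q_def[abs_def])
    show "\<And>t. t \<in> H_space M F2 h2 \<Longrightarrow> l2_inner M (\<lambda>z. S z - p m z - q m z) t = 0"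
      using pr(2) by (simp add: q_def)
  qed
  \<comment> \<open>The recursion for \<open>A1\<close> takes conditional expectations of the two
    parts of \<open>q m\<close> separately, so each part must be square integrable by itself. It is,
    since \<open>- u\<close> is the projection of \<open>S\<close> and \<open>e m\<close> that of
    \<open>p m\<close> on the space of \<open>h2\<close>.\<close>
  define u where "u z = (transpose (D2 z) ** W2 z) *v h2 z" for z
  define e where "e m z = (C m z ** W2 z) *v h2 z" for m z
  have uL: "u \<in> L2 M"
  proof -
    have "AE z in M. - (transpose (D2 z) ** W2 z)
        = cond_exp_mat M F2 (\<lambda>x. outer (S x) (h2 x)) z ** G2 (cond_var M F2 h2 z)"
      using score(2) by eventually_elim (simp add: W2_def matrix_mult_uminus_left)
    moreover have "(\<lambda>z. - (transpose (D2 z) ** W2 z)) \<in> borel_measurable F2"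
      by (intro borel_measurable_uminus borel_measurable_matrix_mult borel_measurable_transpose D W)
    ultimately have "(\<lambda>z. - (transpose (D2 z) ** W2 z) *v h2 z) \<in> H_space M F2 h2"
      by (intro F2.projection(1)[OF h(2) mean(2) G(2) S])
    then have "(\<lambda>z. - u z) \<in> L2 M"
      by (simp add: H_space_def u_def matrix_vector_mult_uminus_left)
    from L2_uminus[OF this] show ?thesis by simp
  qed
  have eL: "e m \<in> L2 M" if p: "p m \<in> L2 M" for m
  proof -
    have "(\<lambda>z. C m z ** W2 z) \<in> borel_measurable F2"
      unfolding C_def by (intro borel_measurable_matrix_mult borel_measurable_cond_exp_mat W)
    from F2.projection(1)[OF h(2) mean(2) G(2) p this]
    have "e m \<in> H_space M F2 h2" by (simp add: e_def[abs_def] C_def W2_def)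
    then show ?thesis by (simp add: H_space_def)
  qed
  have q_eq: "q m z = - u z - e m z" for m z
    by (simp add: q_def A2_eq u_def e_def matrix_vector_mult_diff_rdistrib matrix_vector_mult_uminus_left)
  have A1_Suc: "A1 (Suc m) z = - (transpose (D1 z) ** W1 z)
      + cond_exp_mat M F1 (\<lambda>x. outer (u x) (h1 x)) z ** W1 z
      + cond_exp_mat M F1 (\<lambda>x. outer (e m x) (h1 x)) z ** W1 z" for m z
    by (simp add: A1_def C_def p_def u_def e_def matrix_mult_outer)
  have A1F: "A1 m \<in> borel_measurable F1" for m
  proof (cases m)
    case 0
    then show ?thesis by (simp add: A1_def)
  next
    case (Suc k)
    have "(\<lambda>z. - (transpose (D1 z) ** W1 z)
      + cond_exp_mat M F1 (\<lambda>x. outer (u x) (h1 x)) z ** W1 z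
      + cond_exp_mat M F1 (\<lambda>x. outer (e k x) (h1 x)) z ** W1 z) \<in> borel_measurable F1"
      by (intro borel_measurable_add borel_measurable_uminus borel_measurable_matrix_mult
          borel_measurable_transpose borel_measurable_cond_exp_mat D W)
    then show ?thesis unfolding Suc using A1_Suc[of k] by presburger
  qed
  have p_proj: "p (Suc m) \<in> H_space M F1 h1"
      "\<And>t. t \<in> H_space M F1 h1 \<Longrightarrow> l2_inner M (\<lambda>z. S z - p (Suc m) z - q m z) t = 0"
    if p: "p m \<in> L2 M" for m
  proof -
    have Sq: "S z - q m z = (S z + u z) + e m z" for z by (simp add: q_eq)
    have "AE z in M. A1 (Suc m) z
        = cond_exp_mat M F1 (\<lambda>x. outer (S x - q m x) (h1 x)) z ** G1 (cond_var M F1 h1 z)"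
      using score(1) F1.cond_exp_mat_outer_add[OF S uL h(1)]
        F1.cond_exp_mat_outer_add[OF L2_add[OF S uL] eL[OF p] h(1)]
      unfolding Sq
      by eventually_elim (simp add: A1_Suc W1_def matrix_mult_add_left matrix_mult_diff_left matrix_mult_uminus_left)
    note pr = F1.projection[OF h(1) mean(1) G(1) _ A1F this]
    have "(\<lambda>z. S z - q m z) \<in> L2 M"
      unfolding Sq by (intro L2_add S uL eL p)
    note pr = pr[OF this]
    show "p (Suc m) \<in> H_space M F1 h1" using pr(1) by (simp add: p_def[abs_def])
    show "\<And>t. t \<in> H_space M F1 h1 \<Longrightarrow> l2_inner M (\<lambda>z. S z - p (Suc m) z - q m z) t = 0"
      using pr(2) by (simp add: p_def algebra_simps)
  qed
  \<comment> \<open>Every half step requires the current \<open>p m\<close> to be square integrable,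
    which is carried along from \<open>p 0 = 0\<close>.\<close>
  have pH: "p m \<in> H_space M F1 h1" for m
  proof (induction m)
    case 0
    have "p 0 = (\<lambda>z. 0)" by (auto simp: p_def A1_def)
    moreover have "(\<lambda>z. 0) \<in> H_space M F1 h1"
      using A1F[of 0] by (auto simp: H_space_def A1_def L2_zero intro!: bexI[of _ "\<lambda>_. 0"])
    ultimately show ?case by simp
  next
    case (Suc m)
    then show ?case using p_proj(1) H_space_L2 by blast
  qed
  then have pL: "p m \<in> L2 M" for m using H_space_L2 by blast
  have qH: "q m \<in> H_space M F2 h2" for m by (rule q_proj(1)[OF pL])
  then have qL: "q m \<in> L2 M" for m using H_space_L2 by blast
  define U where "U k = (if even k then H_space M F2 h2 else H_space M F1 h1 :: ('a \<Rightarrow> real ^ 'd) set)" for k :: nat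
  \<comment> \<open>The rounding updates \<open>p\<close> on passing to an odd index and
    \<open>q\<close> on passing to an even one. At the start \<open>p 0 = 0\<close>, but
    \<open>q 0\<close> is already the projection of \<open>S\<close> on the space of
    \<open>h2\<close>, so \<open>x 0\<close> is orthogonal to \<open>U 0\<close>.\<close>
  define x where "x k z = S z - p ((k + 1) div 2) z - q (k div 2) z" for k :: nat and z
  have x_even: "x (2 * m) = (\<lambda>z. S z - p m z - q m z)" for m by (auto simp: x_def)
  have x_odd: "x (Suc (2 * m)) = (\<lambda>z. S z - p (Suc m) z - q m z)" for m by (auto simp: x_def)
  have "\<exists>y. y \<in> L2 M \<and> (\<lambda>m. l2_dist M (x (2 * m)) y) \<longlonglongrightarrow> 0 \<and> (\<forall>k. \<forall>t\<in>U k. l2_inner M y t = 0)"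
  proof (rule alternating_projections[OF M, of x U])
    show "x k \<in> L2 M" for k unfolding x_def by (intro L2_diff S pL qL)
    show "U k \<subseteq> L2 M" for k by (simp add: U_def H_space_L2)
    show "U (k + 2) = U k" for k by (simp add: U_def)
    show "(\<lambda>z. x k z - x (Suc k) z) \<in> U (Suc k)" for k
    proof (cases "even k")
      case True
      then obtain m where k: "k = 2 * m" by blast
      have "(\<lambda>z. x k z - x (Suc k) z) = (\<lambda>z. p (Suc m) z - p m z)"
        by (simp add: k x_even x_odd)
      then show ?thesis using H_space_diff[OF pH pH] True by (simp add: U_def)
    next
      case False
      then obtain m where k: "k = Suc (2 * m)" by (auto elim: oddE)
      then have k': "Suc k = 2 * Suc m" by simp
      have "(\<lambda>z. x k z - x (Suc k) z) = (\<lambda>z. q (Suc m) z - q m z)"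
        unfolding k' x_even by (simp add: k x_odd)
      then show ?thesis using H_space_diff[OF qH qH] False by (simp add: U_def)
    qed
    show "l2_inner M (x k) t = 0" if "t \<in> U k" for k t
    proof (cases "even k")
      case True
      then obtain m where k: "k = 2 * m" by blast
      show ?thesis using q_proj(2)[OF pL, of t m] that True by (simp add: U_def k x_even)
    next
      case False
      then obtain m where k: "k = Suc (2 * m)" by (auto elim: oddE)
      show ?thesis using p_proj(2)[OF pL, of t m] that False by (simp add: U_def k x_odd)
    qed
  qed blast
  then obtain r where r: "r \<in> L2 M" "(\<lambda>m. l2_dist M (x (2 * m)) r) \<longlonglongrightarrow> 0"
    and orth: "\<And>k t. t \<in> U k \<Longrightarrow> l2_inner M r t = 0" by blast
  have "l2_dist M (S_iter M F1 F2 h1 h2 D1 D2 W1 W2 m) (\<lambda>z. S z - r z) = l2_dist M (x (2 * m)) r" for m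
  proof -
    have "(\<lambda>z. S_iter M F1 F2 h1 h2 D1 D2 W1 W2 m z - (S z - r z)) = (\<lambda>z. - (x (2 * m) z - r z))"
      by (auto simp: x_even S_iter_def p_def q_def A1_def A2_def)
    then show ?thesis by (simp only: l2_dist_eq_norm l2_norm_minus)
  qed
  then have "(\<lambda>m. l2_dist M (S_iter M F1 F2 h1 h2 D1 D2 W1 W2 m) (\<lambda>z. S z - r z)) \<longlonglongrightarrow> 0"
    using r(2) by simp
  with r(1) show ?thesis
    using that[of r] orth[of _ 0] orth[of _ 1] pH qH
    by (simp add: U_def p_def[abs_def] q_def[abs_def])
qed

section \<open>From the semiparametric model to the iteration\<close>

lemma subalgebra_sigma_sub:
  assumes "sets M = sets borel"
  shows "subalgebra M (sigma_sub J)"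
proof -
  have "subvec J \<in> borel_measurable borel"
    unfolding subvec_def
    by (rule borel_measurable_vecI) (simp add: borel_measurable_nth)
  then have "subvec J -` A \<inter> UNIV \<in> sets borel" if "A \<in> sets borel" for A
    using measurable_sets[of "subvec J" borel borel A] that by simp
  then show ?thesis
    using assms sets_eq_imp_space_eq[OF assms]
    by (auto simp: subalgebra_def sigma_sub_def sets_vimage_algebra2)
qed

text \<open>The constant path at \<open>\<eta>0\<close> has score zero, so zero is in the tangent
  set, and the joint path supplied for it and \<open>a\<close> contains the required points of
  \<open>\<Theta>\<close>. This justifies differentiating along coordinate rays.\<close>

lemma eventually_direction_in_parameter_set:
  assumes "vdv_25_25 \<mu> \<Theta> Par H \<theta>0 \<eta>0 S" "\<eta>0 \<in> H"
  shows "\<forall>\<^sub>F t in at_right (0::real). \<theta>0 + t *\<^sub>R a \<in> \<Theta>"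
proof -
  have "(\<lambda>_. 0) \<in> nuisance_tangent_set \<mu> Par H \<theta>0 \<eta>0"
    using assms(2)
    by (auto simp: nuisance_tangent_set_def qmd_path_def L2_zero intro!: exI[of _ "\<lambda>_. \<eta>0"])
  then obtain \<eta> where "\<forall>\<^sub>F t in at_right (0::real). \<theta>0 + t *\<^sub>R a \<in> \<Theta> \<and> \<eta> t \<in> H"
    using assms(1) unfolding vdv_25_25_def by blast
  then show ?thesis by eventually_elim simp
qed

theorem lemma2:
  fixes \<mu> P0 :: "(real ^ 'q) measure"
    and J1 J2 :: "'q set"
    and g1 :: "real ^ 'q \<Rightarrow> real ^ 'd \<Rightarrow> real ^ 'p1"
    and g2 :: "real ^ 'q \<Rightarrow> real ^ 'd \<Rightarrow> real ^ 'p2"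
    and \<Theta> :: "(real ^ 'd) set" and \<theta>0 :: "real ^ 'd"
    and Par :: "real ^ 'd \<Rightarrow> 'e \<Rightarrow> (real ^ 'q) measure"
    and H :: "'e set" and Hk :: "nat \<Rightarrow> 'e set" and \<eta>0 :: 'e
    and w :: "nat \<Rightarrow> real ^ 'q \<Rightarrow> real"
    and S :: "real ^ 'q \<Rightarrow> real ^ 'd"
    and D1 :: "real ^ 'q \<Rightarrow> real ^ 'd ^ 'p1" and D2 :: "real ^ 'q \<Rightarrow> real ^ 'd ^ 'p2"
    and G1 :: "real ^ 'p1 ^ 'p1 \<Rightarrow> real ^ 'p1 ^ 'p1"
    and G2 :: "real ^ 'p2 ^ 'p2 \<Rightarrow> real ^ 'p2 ^ 'p2"
  defines "F1 \<equiv> sigma_sub J1" and "F2 \<equiv> sigma_sub J2"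
    and "h1 \<equiv> (\<lambda>z. g1 z \<theta>0)" and "h2 \<equiv> (\<lambda>z. g2 z \<theta>0)"
  defines "W1 \<equiv> (\<lambda>z. G1 (cond_var P0 F1 h1 z))" and "W2 \<equiv> (\<lambda>z. G2 (cond_var P0 F2 h2 z))"
  assumes "sigma_finite_measure \<mu>" and "sets \<mu> = sets borel"
    and "card J1 < CARD('q)" and "card J2 < CARD('q)"
    and "\<And>\<theta>. (\<lambda>z. g1 z \<theta>) \<in> borel_measurable borel"
    and "\<And>\<theta>. (\<lambda>z. g2 z \<theta>) \<in> borel_measurable borel"
    and "\<theta>0 \<in> \<Theta>" and "P0 \<in> cond_model \<mu> J1 J2 g1 g2 \<theta>0"
    and "\<And>\<theta>. \<theta> \<in> \<Theta> \<Longrightarrow> P0 \<in> cond_model \<mu> J1 J2 g1 g2 \<theta> \<Longrightarrow> \<theta> = \<theta>0"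
    and "P0 = Par \<theta>0 \<eta>0"
    and "is_theta_score \<mu> \<Theta> \<theta>0 (\<lambda>\<theta>. Par \<theta> \<eta>0) S"
    and "cond_jacobian P0 F1 \<Theta> \<theta>0 g1 D1" and "cond_jacobian P0 F2 \<Theta> \<theta>0 g2 D2"
    and "quadratic_mean_regular P0 \<Theta> \<theta>0 (\<lambda>\<theta>. Par \<theta> \<eta>0) g1"
    and "quadratic_mean_regular P0 \<Theta> \<theta>0 (\<lambda>\<theta>. Par \<theta> \<eta>0) g2"
    and "generalized_inverse G1" and "generalized_inverse G2"
    and "dense_sequence P0 w"
    and "assumption_T P0 J1 J2 h1 h2"
    and "assumption_SP \<mu> J1 J2 g1 g2 w \<Theta> Par H Hk \<theta>0 \<eta>0 S"
  shows "\<exists>Sbar.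
      is_proj P0 (orth_compl P0 (T_space P0 F1 h1 \<inter> T_space P0 F2 h2)) S Sbar
      \<and> is_proj P0 (space_sum (H_space P0 F1 h1) (H_space P0 F2 h2)) S Sbar
      \<and> (\<forall>m\<ge>1. S_iter P0 F1 F2 h1 h2 D1 D2 W1 W2 m \<in> L2 P0)
      \<and> (\<lambda>m. l2_dist P0 (S_iter P0 F1 F2 h1 h2 D1 D2 W1 W2 m) Sbar) \<longlonglongrightarrow> 0"
proof -
  have SP: "\<eta>0 \<in> H" "semiparametric_form \<Theta> (cond_model \<mu> J1 J2 g1 g2) Par H"
    "vdv_25_25 \<mu> \<Theta> Par H \<theta>0 \<eta>0 S"
    using \<open>assumption_SP \<mu> J1 J2 g1 g2 w \<Theta> Par H Hk \<theta>0 \<eta>0 S\<close> by (simp_all add: assumption_SP_def)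
  define Pth where "Pth \<theta> = Par \<theta> \<eta>0" for \<theta>
  have Pth0: "Pth \<theta>0 = P0" using \<open>P0 = Par \<theta>0 \<eta>0\<close> by (simp add: Pth_def)
  \<comment> \<open>With \<open>\<eta>0\<close> fixed, the law at \<open>\<theta>\<close> obeys the
    restrictions at \<open>\<theta>\<close>; this is the path along which they are
    differentiated.\<close>
  have model: "Pth \<theta> \<in> cond_model \<mu> J1 J2 g1 g2 \<theta>" if "\<theta> \<in> \<Theta>" for \<theta>
    using SP(1,2) that by (simp add: semiparametric_form_def Pth_def)
  have law: "prob_space (Pth \<theta>)" "sets (Pth \<theta>) = sets \<mu>" "absolutely_continuous \<mu> (Pth \<theta>)"
    "moment_restriction (Pth \<theta>) F1 (\<lambda>z. g1 z \<theta>)" "moment_restriction (Pth \<theta>) F2 (\<lambda>z. g2 z \<theta>)"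
    if "\<theta> \<in> \<Theta>" for \<theta>
    using model[OF that] \<open>sets \<mu> = sets borel\<close>
    by (simp_all add: cond_model_def dominated_laws_def F1_def F2_def)
  note law0 = law[OF \<open>\<theta>0 \<in> \<Theta>\<close>, unfolded Pth0]
  have M: "prob_space P0" by (rule law0(1))
  interpret prob_space P0 by (rule M)
  have sub: "subalgebra P0 F1" "subalgebra P0 F2"
    using law0(2) \<open>sets \<mu> = sets borel\<close> by (simp_all add: F1_def F2_def subalgebra_sigma_sub)
  interpret F1: finite_measure_subalgebra P0 F1 by unfold_locales (rule sub)
  interpret F2: finite_measure_subalgebra P0 F2 by unfold_locales (rule sub)
  have h: "h1 \<in> L2 P0" "h2 \<in> L2 P0"
    using \<open>quadratic_mean_regular P0 \<Theta> \<theta>0 (\<lambda>\<theta>. Par \<theta> \<eta>0) g1\<close>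
      \<open>quadratic_mean_regular P0 \<Theta> \<theta>0 (\<lambda>\<theta>. Par \<theta> \<eta>0) g2\<close>
    by (simp_all add: quadratic_mean_regular_def h1_def h2_def)
  have S: "S \<in> L2 P0"
    using \<open>is_theta_score \<mu> \<Theta> \<theta>0 (\<lambda>\<theta>. Par \<theta> \<eta>0) S\<close> \<open>P0 = Par \<theta>0 \<eta>0\<close>
    by (simp add: is_theta_score_def)
  have mean: "AE z in P0. cond_exp_vec P0 F1 h1 z = 0" "AE z in P0. cond_exp_vec P0 F2 h2 z = 0"
    using law0(4,5) unfolding moment_restriction_def h1_def h2_def by blast+
  have D: "D1 \<in> borel_measurable F1" "D2 \<in> borel_measurable F2"
    using \<open>cond_jacobian P0 F1 \<Theta> \<theta>0 g1 D1\<close> \<open>cond_jacobian P0 F2 \<Theta> \<theta>0 g2 D2\<close>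
    by (simp_all add: cond_jacobian_def)
  have submu: "subalgebra \<mu> F1" "subalgebra \<mu> F2"
    using \<open>sets \<mu> = sets borel\<close> by (simp_all add: F1_def F2_def subalgebra_sigma_sub)
  note dir = eventually_direction_in_parameter_set[OF SP(3,1)]
  have Pth_eq: "(\<lambda>\<theta>. Par \<theta> \<eta>0) = Pth" by (simp add: Pth_def[abs_def])
  have score: "AE z in P0. cond_exp_mat P0 F1 (\<lambda>x. outer (S x) (h1 x)) z = - transpose (D1 z)"
      "AE z in P0. cond_exp_mat P0 F2 (\<lambda>x. outer (S x) (h2 x)) z = - transpose (D2 z)"
    using score_jacobian[where Pth = Pth and g = g1 and S = S and D = D1,
        OF \<open>sigma_finite_measure \<mu>\<close> submu(1) \<open>\<theta>0 \<in> \<Theta>\<close> law(1,2,3,4) dir]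
      score_jacobian[where Pth = Pth and g = g2 and S = S and D = D2,
        OF \<open>sigma_finite_measure \<mu>\<close> submu(2) \<open>\<theta>0 \<in> \<Theta>\<close> law(1,2,3,5) dir]
      \<open>is_theta_score \<mu> \<Theta> \<theta>0 (\<lambda>\<theta>. Par \<theta> \<eta>0) S\<close>
      \<open>cond_jacobian P0 F1 \<Theta> \<theta>0 g1 D1\<close> \<open>cond_jacobian P0 F2 \<Theta> \<theta>0 g2 D2\<close>
      \<open>quadratic_mean_regular P0 \<Theta> \<theta>0 (\<lambda>\<theta>. Par \<theta> \<eta>0) g1\<close>
      \<open>quadratic_mean_regular P0 \<Theta> \<theta>0 (\<lambda>\<theta>. Par \<theta> \<eta>0) g2\<close>
    unfolding Pth_eq Pth0 h1_def h2_def by blast+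
  let ?S = "S_iter P0 F1 F2 h1 h2 D1 D2 W1 W2"
  let ?H1 = "H_space P0 F1 h1 :: (real ^ 'q \<Rightarrow> real ^ 'd) set"
  let ?H2 = "H_space P0 F2 h2 :: (real ^ 'q \<Rightarrow> real ^ 'd) set"
  let ?T = "T_space P0 F1 h1 \<inter> T_space P0 F2 h2 :: (real ^ 'q \<Rightarrow> real ^ 'd) set"
  obtain r where r: "r \<in> L2 P0" "\<And>t. t \<in> ?H1 \<Longrightarrow> l2_inner P0 r t = 0"
    "\<And>t. t \<in> ?H2 \<Longrightarrow> l2_inner P0 r t = 0"
    and lim: "(\<lambda>m. l2_dist P0 (?S m) (\<lambda>z. S z - r z)) \<longlonglongrightarrow> 0"
    and A1: "\<And>m. (\<lambda>z. a1_iter P0 F1 F2 h1 h2 D1 D2 W1 W2 m z *v h1 z) \<in> ?H1"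
    and A2: "\<And>m. (\<lambda>z. a2_iter P0 F1 F2 h1 h2 D1 D2 W1 W2 m z *v h2 z) \<in> ?H2"
    using backfitting_converges[OF M sub h S mean \<open>generalized_inverse G1\<close> \<open>generalized_inverse G2\<close> D score]
    unfolding W1_def W2_def by blast
  have sum_L2: "space_sum ?H1 ?H2 \<subseteq> L2 P0"
    unfolding space_sum_def H_space_def by (auto intro: L2_add)
  have iter: "?S m \<in> space_sum ?H1 ?H2" for m
    unfolding space_sum_def S_iter_def by (intro CollectI exI conjI, rule refl) (rule A1 A2)+
  have Sbar: "(\<lambda>z. S z - r z) \<in> L2 P0" by (rule L2_diff[OF S r(1)])
  have closure: "(\<lambda>z. S z - r z) \<in> l2_closure P0 (space_sum ?H1 ?H2)"
    by (rule l2_closure_limit[OF Sbar iter lim])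
  have const: "l2_inner P0 (\<lambda>_. c) t = c \<bullet> (\<integral>z. t z \<partial>P0)" if "t \<in> L2 P0" for c and t :: "real ^ 'q \<Rightarrow> real ^ 'd"
    by (rule l2_inner_const_left[OF F1.L2_integrable[OF that]])
  have sum_orth: "space_sum ?H1 ?H2 \<subseteq> orth_compl P0 ?T"
  proof
    fix s assume s: "s \<in> space_sum ?H1 ?H2"
    then obtain u v where s_eq: "s = (\<lambda>z. u z + v z)" and u: "u \<in> ?H1" and v: "v \<in> ?H2"
      by (auto simp: space_sum_def)
    have sL: "s \<in> L2 P0" and uL: "u \<in> L2 P0" and vL: "v \<in> L2 P0"
      using s sum_L2 u v H_space_L2 by blast+
    have "l2_inner P0 (\<lambda>_. c) s = 0" for c
      using F1.const_orthogonal_H_space[OF h(1) mean(1) u, of c]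
        F2.const_orthogonal_H_space[OF h(2) mean(2) v, of c]
      unfolding s_eq by (simp add: l2_inner_add_right F1.L2_const uL vL)
    \<comment> \<open>The constant is chosen equal to the mean itself, whose squared length is then
      zero.\<close>
    then have "(\<integral>z. s z \<partial>P0) = 0" using const[OF sL, of "\<integral>z. s z \<partial>P0"] by simp
    moreover have "l2_inner P0 s t = 0" if "t \<in> ?T" for t
    proof -
      have tL: "t \<in> L2 P0" using that by (simp add: T_space_def)
      have "l2_inner P0 t u = 0" "l2_inner P0 t v = 0"
        using F1.H_space_orthogonal_iff[OF h(1) tL] F2.H_space_orthogonal_iff[OF h(2) tL] that u v
        by (simp_all add: T_space_def)
      then show ?thesis
        unfolding s_eq using l2_inner_add_left[OF uL vL tL] by (simp add: l2_inner_commute[of P0 _ t])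
    qed
    ultimately show "s \<in> orth_compl P0 ?T" using sL by (simp add: orth_compl_def)
  qed
  \<comment> \<open>\<open>r\<close> is orthogonal to both spaces but may have a nonzero mean.
    Constants are orthogonal to both spaces as well, so subtracting the mean places \<open>r\<close>
    in \<open>T\<close>.\<close>
  define c where "c = (\<integral>z. r z \<partial>P0)"
  have shift: "l2_inner P0 (\<lambda>z. r z - c) t = l2_inner P0 r t - l2_inner P0 (\<lambda>_. c) t" if "t \<in> L2 P0" for t
    by (rule l2_inner_diff_left[OF r(1) F1.L2_const that])
  have rc: "(\<lambda>z. r z - c) \<in> ?T"
  proof -
    have L: "(\<lambda>z. r z - c) \<in> L2 P0" by (rule L2_diff[OF r(1) F1.L2_const])
    have "(\<integral>z. r z - c \<partial>P0) = 0"
      using F1.L2_integrable[OF r(1)] by (simp add: c_def prob_space)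
    moreover have "AE z in P0. cond_exp_mat P0 F1 (\<lambda>x. outer (h1 x) (r x - c)) z = 0"
      unfolding F1.H_space_orthogonal_iff[OF h(1) L, symmetric]
      using shift[OF subsetD[OF H_space_L2]] r(2) F1.const_orthogonal_H_space[OF h(1) mean(1)]
      by (metis diff_self)
    moreover have "AE z in P0. cond_exp_mat P0 F2 (\<lambda>x. outer (h2 x) (r x - c)) z = 0"
      unfolding F2.H_space_orthogonal_iff[OF h(2) L, symmetric]
      using shift[OF subsetD[OF H_space_L2]] r(3) F2.const_orthogonal_H_space[OF h(2) mean(2)]
      by (metis diff_self)
    ultimately show ?thesis using L by (simp add: T_space_def)
  qed
  have "is_proj P0 (space_sum ?H1 ?H2) S (\<lambda>z. S z - r z)"
    unfolding is_proj_def
  proof (intro conjI ballI closure)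
    fix t assume "t \<in> space_sum ?H1 ?H2"
    then obtain u v where t: "t = (\<lambda>z. u z + v z)" and u: "u \<in> ?H1" and v: "v \<in> ?H2"
      by (auto simp: space_sum_def)
    then have "u \<in> L2 P0" "v \<in> L2 P0" using H_space_L2 by blast+
    then show "l2_inner P0 (\<lambda>z. S z - (S z - r z)) t = 0"
      using r(2)[OF u] r(3)[OF v] r(1) by (simp add: t l2_inner_add_right)
  qed
  \<comment> \<open>The inclusion \<open>sum_orth\<close> transfers membership in the closure to the
    larger space; it remains to see that \<open>r\<close> is orthogonal to all of that
    space.\<close>
  moreover have "is_proj P0 (orth_compl P0 ?T) S (\<lambda>z. S z - r z)"
    unfolding is_proj_def
  proof (intro conjI ballI)
    show "(\<lambda>z. S z - r z) \<in> l2_closure P0 (orth_compl P0 ?T)"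
      using closure l2_closure_mono[OF sum_orth] by blast
    fix t assume "t \<in> orth_compl P0 ?T"
    then have t: "t \<in> L2 P0" "(\<integral>z. t z \<partial>P0) = 0" "l2_inner P0 t (\<lambda>z. r z - c) = 0"
      using rc by (simp_all add: orth_compl_def)
    \<comment> \<open>Split \<open><r, t> = <r - c, t> + <c, t>\<close>: the first term vanishes
      since \<open>r - c\<close> is in \<open>T\<close>, the second since \<open>t\<close> has mean
      zero.\<close>
    show "l2_inner P0 (\<lambda>z. S z - (S z - r z)) t = 0"
      using t(2,3) const[OF t(1), of c] shift[OF t(1)] by (simp add: l2_inner_commute[of P0 t])
  qed
  ultimately show ?thesis using iter sum_L2 lim by blast
qed

end
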